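(* Let $p\in[2,\infty)$ be fixed and let $\beta_c(p):=\frac{3}{p^{2/p}}\cdot\frac{\Gamma(1+1/p)}{\Gamma(1+3/p)}$. For all $\beta\ge 0$, \begin{align*} \lim_{n\to\infty}\frac1n \log \mathcal{Z}_{n,p}(\beta) &=\sup_{z,w\ge 0}\left\{\psi_{p}\left(\sqrt{\beta}\frac{zw}{(1+z^p)^{1/p}}\right)-\frac{1}{p}\log(1+z^p)-\frac{p-2}{2p}w^{2p/(p-2)}\right\}\\ &= \sup_{0\le u< 1,\,v\ge 0 }\left\{\psi_{p}\left(\sqrt{\beta u^2 v^{p-2} }\right)+\frac{1}{p}\log(1-u^{p})-\frac{p-2}{2p}v^p\right\}. \end{align*} Moreover: (a) If $\beta<\beta_c(p)$, then $m_{n,\beta,p}$ is concentrated at zero and $\sqrt{n}\, m_{n,\beta,p}=\frac{1}{\sqrt{n}}\sum_{i=1}^n \sigma_i$ converges in distribution to $\mathrm{N}(0,(\beta_c(p)-\beta)^{-1})$ as $n\to\infty$; furthermore $\mathcal{Z}_{n,p}(\beta)$ is uniformly bounded in $n$, and in particular $\lim_{n\to\infty}\frac1n \log\mathcal{Z}_{n,p}(\beta)=0$. (b) If $\beta>\beta_c(p)$, then $m_{n,\beta,p}$ is concentrated at $K\cup (-K)$ for some closed set $K\subset (0,1]$ (i.e. the law of $m_{n,\beta,p}$ puts asymptotically vanishing mass outside any neighborhood of $K\cup(-K)$), and $\lim_{n\to\infty}\frac1n \log\mathcal{Z}_{n,p}(\beta)>0$.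
   Context: For $p>0$ let $S_{n,p}:=\{\sigma\in\mathbb{R}^n: \frac1n\sum_{i=1}^n|\sigma_i|^p=1\}$ and let $d_{n,p}\sigma$ denote the uniform probability measure on $S_{n,p}$ (equivalently, the law of $\widehat X=X/\|X\|_{n,p}$ where $X_1,\dots,X_n$ are i.i.d. with density $\rho_p$ and $\|x\|_{n,p}=(\frac1n\sum_i|x_i|^p)^{1/p}$). Here $\rho_p(x)=c_p e^{-|x|^p/p}$, $x\in\mathbb{R}$, with $c_p=\frac{p^{-1/p}}{2\Gamma(1+1/p)}$. The Hamiltonian is $H_n(\sigma)=\frac1n\sum_{i<j}\sigma_i\sigma_j$, the partition function is $\mathcal{Z}_{n,p}(\beta)=\int_{S_{n,p}}\exp(\beta H_n(\sigma))\,d_{n,p}\sigma$, and the Gibbs measure is $d\mu_{n,\beta,p}(\sigma)=\mathcal{Z}_{n,p}(\beta)^{-1}\exp(\beta H_n(\sigma))\,d_{n,p}\sigma$. The magnetization is $m_{n,\beta,p}=\frac1n\sum_{i=1}^n\sigma_i$ with $\sigma\sim\mu_{n,\beta,p}$. Finally $\psi_p(t):=\log\mathbb{E}[e^{tX}]$ for $X\sim\rho_p$, $t\in\mathbb{R}$.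
   Formalization: For p=2 the exponent 2p/(p-2) in the first variational formula is undefined; there the last term is read as its limit as p tends to 2, i.e. the supremum runs over z≥0, 0≤w≤1 with zero penalty. For p>2 the formula is literal. *)

theory Defs
  imports "HOL-Probability.Probability"
begin

definition c_const :: "real \<Rightarrow> real" where
  "c_const p = p powr (-1/p) / (2 * Gamma (1 + 1/p))"

definition rho :: "real \<Rightarrow> real \<Rightarrow> real" where
  "rho p x = c_const p * exp (- (\<bar>x\<bar> powr p) / p)"

definition rho_measure :: "real \<Rightarrow> real measure" where
  "rho_measure p = density lborel (\<lambda>x. ennreal (rho p x))"

definition psi :: "real \<Rightarrow> real \<Rightarrow> real" where
  "psi p t = ln (\<integral>x. exp (t * x) * rho p x \<partial>lborel)"

definition norm_np :: "nat \<Rightarrow> real \<Rightarrow> (nat \<Rightarrow> real) \<Rightarrow> real" where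
  "norm_np n p x = ((1 / real n) * (\<Sum>i<n. \<bar>x i\<bar> powr p)) powr (1/p)"

definition unif_sphere :: "nat \<Rightarrow> real \<Rightarrow> (nat \<Rightarrow> real) measure" where
  "unif_sphere n p =
     distr (PiM {..<n} (\<lambda>_. rho_measure p)) (PiM {..<n} (\<lambda>_. lborel))
       (\<lambda>x. \<lambda>i\<in>{..<n}. x i / norm_np n p x)"

definition hamiltonian :: "nat \<Rightarrow> (nat \<Rightarrow> real) \<Rightarrow> real" where
  "hamiltonian n \<sigma> = (1 / real n) * (\<Sum>j<n. \<Sum>i<j. \<sigma> i * \<sigma> j)"

definition partition_fn :: "nat \<Rightarrow> real \<Rightarrow> real \<Rightarrow> real" where
  "partition_fn n p \<beta> = (\<integral>\<sigma>. exp (\<beta> * hamiltonian n \<sigma>) \<partial>unif_sphere n p)"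

definition gibbs :: "nat \<Rightarrow> real \<Rightarrow> real \<Rightarrow> (nat \<Rightarrow> real) measure" where
  "gibbs n p \<beta> = density (unif_sphere n p)
      (\<lambda>\<sigma>. ennreal (exp (\<beta> * hamiltonian n \<sigma>) / partition_fn n p \<beta>))"

definition magnetization_law :: "nat \<Rightarrow> real \<Rightarrow> real \<Rightarrow> real measure" where
  "magnetization_law n p \<beta> = distr (gibbs n p \<beta>) borel (\<lambda>\<sigma>. (\<Sum>i<n. \<sigma> i) / real n)"

definition scaled_magnetization_law :: "nat \<Rightarrow> real \<Rightarrow> real \<Rightarrow> real measure" where
  "scaled_magnetization_law n p \<beta> = distr (gibbs n p \<beta>) borel (\<lambda>\<sigma>. (\<Sum>i<n. \<sigma> i) / sqrt (real n))"

definition beta_c :: "real \<Rightarrow> real" where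
  "beta_c p = 3 / (p powr (2/p)) * (Gamma (1 + 1/p) / Gamma (1 + 3/p))"

definition var_formula1 :: "real \<Rightarrow> real \<Rightarrow> real" where
  "var_formula1 p \<beta> =
     (SUP zw \<in> {(z, w). z \<ge> 0 \<and> w \<ge> 0 \<and> (p = 2 \<longrightarrow> w \<le> 1)}.
        (case zw of (z, w) \<Rightarrow>
          psi p (sqrt \<beta> * (z * w) / (1 + z powr p) powr (1/p))
          - (1/p) * ln (1 + z powr p)
          - (p - 2) / (2 * p) * w powr (2 * p / (p - 2))))"

definition var_formula2 :: "real \<Rightarrow> real \<Rightarrow> real" where
  "var_formula2 p \<beta> =
     (SUP uv \<in> {(u, v). 0 \<le> u \<and> u < 1 \<and> v \<ge> 0}.
        (case uv of (u, v) \<Rightarrow>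
          psi p (sqrt (\<beta> * u\<^sup>2 * v powr (p - 2)))
          + (1/p) * ln (1 - u powr p)
          - (p - 2) / (2 * p) * v powr p))"

end

theory Submission
  imports Defs
begin

text \<open>Write \<open>S\<close> for the sum of the i.i.d. variables \<open>X\<^sub>i\<close>, \<open>R\<close> for their normalised \<open>p\<close>-norm and
  \<open>m = S / (n R)\<close> for the magnetization. Up to a factor between \<open>exp (- \<beta> / 2)\<close> and 1 the partition function is the
  expectation of \<open>exp (n \<beta> m\<^sup>2 / 2)\<close>. Since \<open>m\<close> is invariant under rescaling while
  tilting by a power of \<open>exp (R\<^sup>p)\<close> merely rescales the product density, \<open>R\<close> can be steered at an explicit cost: the moment generating
  function of \<open>S\<close> together with Young's inequality bounds the free energy from below by each value of the variational
  formulas, and a Chernoff bound after moving \<open>R\<close> to \<open>r\<close> with \<open>r\<^sup>p = 1 + \<beta> m\<^sup>2\<close> gives the matching upper bound cell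
  by cell in \<open>m\<close>. Below \<open>\<beta>\<^sub>c\<close>, the density is strictly sub-Gaussian (\<open>\<psi>\<^sub>p t \<le> t\<^sup>2 / (2 \<beta>\<^sub>c)\<close>, by log-convexity of the
  Gamma function), so Gaussian linearisation bounds the partition function uniformly and the classical central
  limit theorem transfers to the weighted measure; above \<open>\<beta>\<^sub>c\<close>, the bound \<open>\<psi>\<^sub>p t \<ge> ln (1 + t\<^sup>2 / (2 \<beta>\<^sub>c))\<close> makes the limit positive.\<close>

text \<open>The obstacle is the radius \<open>R\<close>: it couples all coordinates of the sphere,
  and exponentially large weights could favour atypical values of it. What removes it is the
  independence of direction and radius under the product of \<open>rho p\<close>, expressed through
  dilations alone: under every weight that depends only on the direction, \<open>W = n R^p\<close>
  has, up to the total mass, one and the same law. Deviations of \<open>W\<close> therefore have the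
  same exponential cost for all such weights, and restricting to the typical shell loses at most a
  factor 2 even when the weight itself is exponentially large. The function \<open>G\<close>
  restricts both variational functionals to a curve. Every value of either functional is a lower
  bound for \<open>ln (A n \<beta>) / n\<close> at each positive \<open>n\<close>, while the upper
  bound uses only points with \<open>z^p = v^p = \<beta> x^2\<close>; so equality of the two suprema
  comes out as uniqueness of a limit, without comparing the functionals directly. The critical value
  is the inverse variance of \<open>rho p\<close>. The Gaussian upper bound and the logarithmic
  lower bound on \<open>psi p\<close> share the second-order coefficient
  \<open>1 / (2 * beta_c p)\<close>, and that makes the threshold sharp.\<close>

lemma Gamma_plus1_pos:
  fixes x :: real
  assumes "0 < x"
  shows "Gamma (x + 1) = x * Gamma x" "Gamma (1 + x) = x * Gamma x"
proof -
  have "x \<notin> \<int>\<^sub>\<le>\<^sub>0" using assms by (auto elim!: nonpos_Ints_cases)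
  then show "Gamma (x + 1) = x * Gamma x" by (rule Gamma_plus1)
  then show "Gamma (1 + x) = x * Gamma x" by (simp add: add.commute)
qed

text \<open>Digamma is increasing, so the logarithmic derivative
  \<open>Digamma (x + a) - Digamma (x + 1)\<close> is nonpositive for \<open>a \<le> 1\<close>. The
  denominator is shifted by 1 because \<open>Gamma (s + 1) = s * Gamma s\<close> then turns the
  quotient, up to the factor \<open>s\<close>, into a ratio of consecutive even moments.\<close>

lemma Gamma_quotient_antimono:
  fixes a s t :: real
  assumes "0 < t" "t \<le> s" "0 < a" "a \<le> 1"
  shows "Gamma (s + a) / Gamma (s + 1) \<le> Gamma (t + a) / Gamma (t + 1)"
proof -
  define h where "h x = ln_Gamma (x + a) - ln_Gamma (x + 1)" for x
  have "h s \<le> h t"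
  proof (rule DERIV_nonpos_imp_nonincreasing[OF assms(2)])
    fix x assume x: "t \<le> x" "x \<le> s"
    have "(h has_real_derivative (Digamma (x + a) - Digamma (x + 1))) (at x)"
      unfolding h_def using x assms by (auto intro!: derivative_eq_intros)
    moreover have "Digamma (x + a) \<le> Digamma (x + 1)"
      using x assms by (intro Polygamma_real_mono) auto
    ultimately show "\<exists>y. (h has_real_derivative y) (at x) \<and> y \<le> 0"
      by (intro exI[of _ "Digamma (x + a) - Digamma (x + 1)"]) auto
  qed
  then have "exp (h s) \<le> exp (h t)" by simp
  then show ?thesis
    using assms by (simp add: h_def exp_diff Gamma_real_pos_exp)
qed

lemma cosh_sums_even: "(\<lambda>k. (x::real) ^ (2 * k) / fact (2 * k)) sums cosh x"
proof -
  have "(\<lambda>n. if even n then x ^ n /\<^sub>R fact n else 0) sums cosh x"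
    by (rule cosh_converges)
  then have "(\<lambda>k. if even (2 * k) then x ^ (2 * k) /\<^sub>R fact (2 * k) else 0) sums cosh x"
    by (subst sums_mono_reindex[of "\<lambda>k. 2 * k"]) (auto simp: strict_mono_def elim!: evenE)
  then show ?thesis by (simp add: divide_inverse mult.commute)
qed

lemma exp_sums_real: "(\<lambda>k. x ^ k / fact k) sums exp (x::real)"
  using exp_converges[of x] by (simp only: real_scaleR_def divide_inverse mult.commute)

lemma cosh_ge: "1 + x\<^sup>2 / 2 \<le> cosh (x::real)"
proof -
  have "(\<Sum>k<2. x ^ (2 * k) / fact (2 * k)) \<le> (\<Sum>k. x ^ (2 * k) / fact (2 * k))"
    using cosh_sums_even[of x] by (intro sum_le_suminf) (auto simp: sums_iff power_mult)
  also have "\<dots> = cosh x" using cosh_sums_even[of x] by (simp add: sums_iff)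
  finally show ?thesis by (simp add: numeral_2_eq_2)
qed

section \<open>The one-dimensional density and its moments\<close>

locale lp_density =
  fixes p :: real
  assumes p_ge_2: "2 \<le> p"
begin

lemma p_pos [simp]: "0 < p" and p_nonneg [simp]: "0 \<le> p" and p_nonzero [simp]: "p \<noteq> 0" and p_abs [simp]: "\<bar>p\<bar> = p"
  using p_ge_2 by auto

text \<open>The absolute moment of order \<open>s\<close> of the density \<open>rho p\<close> in
  closed form, as \<open>abs_moment\<close> establishes.\<close>

definition mom :: "real \<Rightarrow> real" where
  "mom s = p powr (s / p) * Gamma ((s + 1) / p) / Gamma (1 / p)"

lemma c_const_eq: "c_const p = 1 / (2 * p powr (1 / p - 1) * Gamma (1 / p))"
proof -
  have "Gamma (1 + 1 / p) = 1 / p * Gamma (1 / p)"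
    by (rule Gamma_plus1_pos) simp
  moreover have "p powr (1 / p - 1) = p powr (1 / p) / p" "p powr (- 1 / p) = 1 / p powr (1 / p)"
    by (simp_all add: powr_diff powr_minus_divide)
  ultimately show ?thesis by (simp add: c_const_def)
qed

lemma c_const_pos: "0 < c_const p"
  using p_ge_2 by (simp add: c_const_eq)

lemma rho_pos: "0 < rho p x"
  using c_const_pos by (simp add: rho_def)

lemma rho_nonneg [simp]: "0 \<le> rho p x"
  using rho_pos[of x] by simp

lemma rho_even [simp]: "rho p (- x) = rho p x"
  by (simp add: rho_def)

lemma rho_measurable [measurable]: "rho p \<in> borel_measurable borel"
  unfolding rho_def[abs_def] by measurable

lemma powr_inj_pos: "0 < x \<Longrightarrow> 0 < y \<Longrightarrow> x powr p = y powr p \<longleftrightarrow> x = y"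
  using powr_less_mono2[of p x y] powr_less_mono2[of p y x] by (cases x y rule: linorder_cases) auto

text \<open>The substitution \<open>t = x powr p / p\<close>, with derivative
  \<open>x powr (p - 1)\<close>, carries Euler's integral for \<open>Gamma ((s + 1) / p)\<close>
  into this one.\<close>

lemma half_line_moment:
  assumes s: "0 \<le> s"
  shows "((\<lambda>x. x powr s * exp (- (x powr p) / p)) has_integral p powr ((s + 1) / p - 1) * Gamma ((s + 1) / p)) {0<..}"
proof -
  define z where "z = (s + 1) / p"
  have z: "0 < z" using s by (simp add: z_def)
  let ?f = "\<lambda>t::real. t powr (z - 1) / exp t"
  let ?g = "\<lambda>x. x powr p / p"
  have "(?f has_integral Gamma z) {0..}" by (rule Gamma_integral_real[OF z])
  then have f: "(?f has_integral Gamma z) {0<..}"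
    by (subst has_integral_spike_set_eq[where T = "{0..}"]) (auto intro: negligible_subset[of "{0}"])
  have img: "?g ` {0<..} = {0<..}"
  proof (safe)
    fix y :: real assume "0 < y"
    then show "y \<in> ?g ` {0<..}"
      by (intro image_eqI[of _ _ "(p * y) powr (1 / p)"]) (auto simp: powr_powr abs_mult)
  qed auto
  have abs: "?f absolutely_integrable_on {0<..}"
    using f by (intro nonnegative_absolutely_integrable_1) (auto simp: has_integral_integrable)
  have "(\<lambda>x. \<bar>x powr (p - 1)\<bar> * ?f (?g x)) absolutely_integrable_on {0<..} \<and>
           integral {0<..} (\<lambda>x. \<bar>x powr (p - 1)\<bar> * ?f (?g x)) = Gamma z
     \<longleftrightarrow> ?f absolutely_integrable_on (?g ` {0<..}) \<and> integral (?g ` {0<..}) ?f = Gamma z"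
    by (rule has_absolute_integral_change_of_variables_1')
       (auto intro!: derivative_eq_intros inj_onI simp: powr_inj_pos)
  with abs f img have "((\<lambda>x. \<bar>x powr (p - 1)\<bar> * ?f (?g x)) has_integral Gamma z) {0<..}"
    by (auto simp: has_integral_iff absolutely_integrable_on_def)
  \<comment> \<open>The factor \<open>p powr (z - 1)\<close> undoes the division by \<open>p\<close>
    inside \<open>(x powr p / p) powr (z - 1)\<close>.\<close>
  then have "((\<lambda>x. (\<bar>x powr (p - 1)\<bar> * ?f (?g x)) * p powr (z - 1)) has_integral Gamma z * p powr (z - 1)) {0<..}"
    by (rule has_integral_mult_left)
  moreover have "(\<bar>x powr (p - 1)\<bar> * ?f (?g x)) * p powr (z - 1) = x powr s * exp (- (x powr p) / p)"
    if "0 < x" for x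
  proof -
    have "x powr (p - 1) * x powr (p * (z - 1)) = x powr s"
      using that by (simp add: powr_add[symmetric] z_def field_simps)
    then show ?thesis
      using that p_ge_2 by (simp add: powr_divide powr_powr exp_minus field_simps)
  qed
  ultimately show ?thesis
    unfolding z_def by (subst has_integral_cong[where g = "\<lambda>x. (\<bar>x powr (p - 1)\<bar> * ?f (?g x)) * p powr (z - 1)"])
      (auto simp: mult.commute z_def)
qed

lemma abs_moment:
  assumes s: "0 \<le> s"
  shows "has_bochner_integral lborel (\<lambda>x. \<bar>x\<bar> powr s * rho p x) (mom s)"
proof -
  let ?f = "\<lambda>x. x powr s * exp (- (x powr p) / p)"
  let ?r = "p powr ((s + 1) / p - 1) * Gamma ((s + 1) / p)"
  have r: "0 \<le> ?r" using s by simp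
  have "((\<lambda>x. ?f x * c_const p) has_integral ?r * c_const p) {0<..}"
    by (rule has_integral_mult_left[OF half_line_moment[OF s]])
  then have "((\<lambda>x. ?f x * c_const p) has_integral ?r * c_const p) {0..}"
    by (subst has_integral_spike_set_eq[where T = "{0<..}"]) (auto intro: negligible_subset[of "{0}"])
  from nn_integral_has_integral_lebesgue[OF _ this] 
  have nn: "(\<integral>\<^sup>+x. ennreal (indicator {0..} x * (?f x * c_const p)) \<partial>lborel) = ennreal (?r * c_const p)"
    using c_const_pos by simp
  have "has_bochner_integral lborel (\<lambda>x. indicator {0..} x *\<^sub>R (?f x * c_const p)) (?r * c_const p)"
    using nn r c_const_pos by (intro has_bochner_integral_nn_integral) (auto simp: less_imp_le)
  also have "(\<lambda>x. indicator {0..} x *\<^sub>R (?f x * c_const p)) = (\<lambda>x. indicator {0..} x *\<^sub>R (\<bar>x\<bar> powr s * rho p x))"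
    by (auto simp: fun_eq_iff rho_def indicator_def)
  finally have "has_bochner_integral lborel (\<lambda>x. \<bar>x\<bar> powr s * rho p x) (2 *\<^sub>R (?r * c_const p))"
    by (rule has_bochner_integral_even_function) simp
  \<comment> \<open>The 2 from the two half-lines cancels the 2 in the denominator of
    \<open>c_const\<close>.\<close>
  also have "2 *\<^sub>R (?r * c_const p) = mom s"
  proof -
    have "p powr ((s + 1) / p - 1) = p powr (s / p) * p powr (1 / p - 1)"
      by (simp add: powr_add[symmetric] field_simps)
    then show ?thesis by (simp add: c_const_eq mom_def)
  qed
  finally show ?thesis .
qed

lemma mom_nonneg: "0 \<le> s \<Longrightarrow> 0 \<le> mom s"
  by (simp add: mom_def)

lemma mom_0: "mom 0 = 1"
  using Gamma_real_pos[of "1 / p"] by (simp add: mom_def del: Gamma_real_pos)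

text \<open>This is what the factor \<open>1 / p\<close> in the exponent of \<open>rho\<close> is
  for: with \<open>E |X|^p = 1\<close> the radius concentrates at 1.\<close>

lemma mom_p: "mom p = 1"
proof -
  have "Gamma (1 + 1 / p) = 1 / p * Gamma (1 / p)"
    by (rule Gamma_plus1_pos) simp
  moreover have "(p + 1) / p = 1 + 1 / p" by (simp add: add_divide_distrib)
  moreover have "Gamma (1 / p) \<noteq> 0" using Gamma_real_pos[of "1 / p"] by (simp del: Gamma_real_pos)
  ultimately show ?thesis by (simp add: mom_def)
qed

lemma beta_c_pos: "0 < beta_c p"
proof -
  have "0 < Gamma (1 + 1 / p)" "0 < Gamma (1 + 3 / p)"
    by (auto intro!: Gamma_real_pos add_pos_pos)
  then show ?thesis using p_ge_2 by (simp add: beta_c_def del: Gamma_real_pos)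
qed

text \<open>Identifies the critical inverse temperature as the inverse variance; the Gamma quotient
  defining \<open>beta_c\<close> is not unfolded after this.\<close>

lemma mom_2: "mom 2 = 1 / beta_c p"
proof -
  have "Gamma (1 + 1 / p) = 1 / p * Gamma (1 / p)" "Gamma (1 + 3 / p) = 3 / p * Gamma (3 / p)"
    by (rule Gamma_plus1_pos; simp)+
  moreover have "Gamma (1 / p) \<noteq> 0" "Gamma (3 / p) \<noteq> 0"
    using Gamma_real_pos[of "1 / p"] Gamma_real_pos[of "3 / p"] by (auto simp del: Gamma_real_pos)
  ultimately show ?thesis by (simp add: mom_def beta_c_def)
qed

text \<open>Even moments grow no faster than those of a Gaussian. This is where \<open>p \<ge> 2\<close> enters.\<close>

lemma mom_even_step: "mom (2 * real k + 2) \<le> (2 * real k + 1) * mom 2 * mom (2 * real k)"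
proof -
  \<comment> \<open>\<open>t\<close> and \<open>s\<close> are the Gamma arguments belonging to the
    moments of order 0 and \<open>2 * k\<close>; adding \<open>a = 2 / p\<close> raises the order by
    two, and \<open>a \<le> 1\<close> is the condition \<open>2 \<le> p\<close>.\<close>
  define t s a where "t = 1 / p" and "s = (2 * real k + 1) / p" and "a = 2 / p"
  have pos: "0 < t" "0 < s" "t \<le> s" "0 < a" "a \<le> 1"
    using p_ge_2 by (auto simp: t_def s_def a_def divide_right_mono)
  have G: "Gamma (s + 1) = s * Gamma s" "Gamma (t + 1) = t * Gamma t"
    using pos by (auto intro!: Gamma_plus1_pos)
  have Gpos: "0 < Gamma s" "0 < Gamma t" using pos by auto
  have "Gamma (s + a) / Gamma (s + 1) \<le> Gamma (t + a) / Gamma (t + 1)"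
    by (rule Gamma_quotient_antimono[OF pos(1,3,4,5)])
  then have "Gamma (s + a) \<le> (s / t) * Gamma (t + a) / Gamma t * Gamma s"
    using pos Gpos by (simp add: G divide_simps mult_ac del: Gamma_real_pos)
  also have "s / t = 2 * real k + 1" by (simp add: s_def t_def)
  finally have *: "Gamma (s + a) \<le> (2 * real k + 1) * Gamma (t + a) / Gamma t * Gamma s" .
  have e: "(2 * real k + 2 + 1) / p = s + a" "(2 + 1) / p = t + a" "(2 * real k + 1) / p = s" "1 / p = t"
    unfolding s_def t_def a_def add_divide_distrib[symmetric] by (simp_all add: add.commute)
  have pw: "p powr ((2 * real k + 2) / p) = p powr (2 / p) * p powr (2 * real k / p)"
    by (simp add: powr_add[symmetric] add_divide_distrib add.commute)
  have "mom (2 * real k + 2) = (p powr (2 / p) * p powr (2 * real k / p) / Gamma t) * Gamma (s + a)"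
    unfolding mom_def e pw by simp
  also have "\<dots> \<le> (p powr (2 / p) * p powr (2 * real k / p) / Gamma t) *
      ((2 * real k + 1) * Gamma (t + a) / Gamma t * Gamma s)"
    using Gpos by (intro mult_left_mono *) auto
  also have "\<dots> = (2 * real k + 1) * mom 2 * mom (2 * real k)"
    unfolding mom_def e by simp
  finally show ?thesis .
qed

text \<open>Iterating the step compares with the moments \<open>(2k)! / (2^k k!) * (mom 2)^k\<close>
  of the centred Gaussian of the same variance. Divided by \<open>(2k)!\<close> they are the
  coefficients of \<open>exp (t^2 * mom 2 / 2)\<close>.\<close>

lemma mom_even_le: "mom (2 * real k) / fact (2 * k) \<le> (mom 2 / 2) ^ k / fact k"
proof (induction k)
  case 0
  then show ?case by (simp add: mom_0)
next
  case (Suc k)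
  have f: "fact (2 * Suc k) = (2 * real k + 2) * (2 * real k + 1) * fact (2 * k)"
    by (simp add: algebra_simps)
  have "mom (2 * real (Suc k)) / fact (2 * Suc k)
      \<le> ((2 * real k + 1) * mom 2 * mom (2 * real k)) / fact (2 * Suc k)"
    using mom_even_step[of k] by (intro divide_right_mono) (auto simp: algebra_simps)
  also have "\<dots> = mom 2 / (2 * real k + 2) * (mom (2 * real k) / fact (2 * k))"
    unfolding f by (simp add: divide_simps)
  also have "\<dots> \<le> mom 2 / (2 * real k + 2) * ((mom 2 / 2) ^ k / fact k)"
    using mom_nonneg[of 2] by (intro mult_left_mono Suc) auto
  also have "\<dots> = (mom 2 / 2) ^ Suc k / fact (Suc k)"
    by (simp add: field_simps)
  finally show ?case .
qed

lemma even_term_le: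
  "(\<integral>\<^sup>+x. ennreal ((t * x) ^ (2 * k) / fact (2 * k) * rho p x) \<partial>lborel)
     \<le> ennreal ((t\<^sup>2 * mom 2 / 2) ^ k / fact k)"
proof -
  define c where "c = t ^ (2 * k) / fact (2 * k)"
  have c: "0 \<le> c" unfolding c_def by (intro divide_nonneg_pos zero_le_even_power) auto
  \<comment> \<open>At the origin the two kinds of power disagree for \<open>k = 0\<close>:
    \<open>0 powr 0 = 0\<close> but \<open>0 ^ 0 = 1\<close>. The point is a null set and is
    discarded below.\<close>
  have a: "(t * x) ^ (2 * k) / fact (2 * k) * rho p x = c * (\<bar>x\<bar> powr (2 * real k) * rho p x)"
    if "x \<noteq> 0" for x
  proof -
    have "\<bar>x\<bar> powr (2 * real k) = \<bar>x\<bar> powr real (2 * k)" by simp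
    also have "\<dots> = x ^ (2 * k)"
      using that by (subst powr_realpow) (simp_all add: power_even_abs)
    finally show ?thesis unfolding power_mult_distrib c_def by (simp only: times_divide_eq_left mult.assoc)
  qed
  have m: "(\<integral>\<^sup>+x. ennreal (\<bar>x\<bar> powr (2 * real k) * rho p x) \<partial>lborel) = ennreal (mom (2 * real k))"
    using abs_moment[of "2 * real k"] by (subst nn_integral_eq_integral) (auto simp: has_bochner_integral_iff)
  have [measurable]: "(\<lambda>x. ennreal (\<bar>x\<bar> powr (2 * real k) * rho p x)) \<in> borel_measurable lborel"
    by measurable
  have "(\<integral>\<^sup>+x. ennreal ((t * x) ^ (2 * k) / fact (2 * k) * rho p x) \<partial>lborel)
      = (\<integral>\<^sup>+x. ennreal c * ennreal (\<bar>x\<bar> powr (2 * real k) * rho p x) \<partial>lborel)"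
  proof (rule nn_integral_cong_AE, rule eventually_mono[OF AE_lborel_singleton[of 0]])
    fix x :: real assume "x \<noteq> 0"
    show "ennreal ((t * x) ^ (2 * k) / fact (2 * k) * rho p x)
        = ennreal c * ennreal (\<bar>x\<bar> powr (2 * real k) * rho p x)"
      unfolding a[OF \<open>x \<noteq> 0\<close>] by (rule ennreal_mult'[OF c])
  qed
  also have "\<dots> = ennreal c * ennreal (mom (2 * real k))"
    by (simp only: nn_integral_cmult[OF \<open>_ \<in> borel_measurable lborel\<close>] m)
  also have "\<dots> = ennreal (c * mom (2 * real k))"
    by (rule ennreal_mult'[symmetric, OF c])
  also have "\<dots> \<le> ennreal ((t\<^sup>2 * mom 2 / 2) ^ k / fact k)"
  proof (rule ennreal_leI)
    have "c * mom (2 * real k) = (t\<^sup>2) ^ k * (mom (2 * real k) / fact (2 * k))"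
      by (simp add: c_def power_mult)
    also have "\<dots> \<le> (t\<^sup>2) ^ k * ((mom 2 / 2) ^ k / fact k)"
      by (rule mult_left_mono[OF mom_even_le]) simp
    also have "\<dots> = (t\<^sup>2 * mom 2 / 2) ^ k / fact k"
      by (simp add: power_mult_distrib power_divide)
    finally show "c * mom (2 * real k) \<le> (t\<^sup>2 * mom 2 / 2) ^ k / fact k" .
  qed
  finally show ?thesis .
qed

text \<open>Termwise comparison of the \<open>cosh\<close> series with the Gaussian one. All terms
  are nonnegative, so sum and integral may be exchanged before integrability is known; integrability
  is then read off from the finite bound.\<close>

lemma nn_cosh_le: "(\<integral>\<^sup>+x. ennreal (cosh (t * x) * rho p x) \<partial>lborel) \<le> ennreal (exp (t\<^sup>2 * mom 2 / 2))"
proof -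
  have "(\<integral>\<^sup>+x. ennreal (cosh (t * x) * rho p x) \<partial>lborel)
      = (\<integral>\<^sup>+x. (\<Sum>k. ennreal ((t * x) ^ (2 * k) / fact (2 * k) * rho p x)) \<partial>lborel)"
  proof (rule nn_integral_cong)
    fix x
    have "0 \<le> (t * x) ^ (2 * k) / fact (2 * k) * rho p x" for k
      by (intro mult_nonneg_nonneg divide_nonneg_pos zero_le_even_power) auto
    then show "ennreal (cosh (t * x) * rho p x) = (\<Sum>k. ennreal ((t * x) ^ (2 * k) / fact (2 * k) * rho p x))"
      by (rule suminf_ennreal_eq[OF _ sums_mult2[OF cosh_sums_even], symmetric])
  qed
  also have "\<dots> = (\<Sum>k. \<integral>\<^sup>+x. ennreal ((t * x) ^ (2 * k) / fact (2 * k) * rho p x) \<partial>lborel)"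
    by (rule nn_integral_suminf) measurable
  also have "\<dots> \<le> (\<Sum>k. ennreal ((t\<^sup>2 * mom 2 / 2) ^ k / fact k))"
    by (rule suminf_le[OF even_term_le summableI summableI])
  also have "(\<Sum>k. ennreal ((t\<^sup>2 * mom 2 / 2) ^ k / fact k)) = ennreal (exp (t\<^sup>2 * mom 2 / 2))"
  proof (rule suminf_ennreal_eq)
    show "(\<lambda>k. (t\<^sup>2 * mom 2 / 2) ^ k / fact k) sums exp (t\<^sup>2 * mom 2 / 2)"
      by (rule exp_sums_real)
    show "0 \<le> (t\<^sup>2 * mom 2 / 2) ^ k / fact k" for k
      using mom_nonneg[of 2] by (intro divide_nonneg_pos zero_le_power mult_nonneg_nonneg zero_le_power2) auto
  qed
  finally show ?thesis .
qed

section \<open>The moment generating function and its logarithm\<close>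

lemma integrable_cosh: "integrable lborel (\<lambda>x. cosh (t * x) * rho p x)"
proof (rule integrableI_bounded)
  have "(\<integral>\<^sup>+x. ennreal (norm (cosh (t * x) * rho p x)) \<partial>lborel)
      = (\<integral>\<^sup>+x. ennreal (cosh (t * x) * rho p x) \<partial>lborel)"
    by (intro nn_integral_cong) (simp add: abs_mult)
  also have "\<dots> < \<infinity>"
    using le_less_trans[OF nn_cosh_le[of t] ennreal_less_top] by simp
  finally show "(\<integral>\<^sup>+x. ennreal (norm (cosh (t * x) * rho p x)) \<partial>lborel) < \<infinity>" .
qed (simp add: cosh_def)

lemma integrable_exp: "integrable lborel (\<lambda>x. exp (t * x) * rho p x)"
proof (rule Bochner_Integration.integrable_bound)
  show "integrable lborel (\<lambda>x. 2 * (cosh (t * x) * rho p x))"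
    using integrable_cosh by (rule integrable_mult_right)
  have "exp y \<le> 2 * cosh y" for y :: real by (simp add: cosh_def)
  then show "AE x in lborel. norm (exp (t * x) * rho p x) \<le> norm (2 * (cosh (t * x) * rho p x))"
    by (auto intro!: AE_I2 mult_right_mono simp: abs_mult mult.assoc[symmetric])
qed measurable

definition mgf :: "real \<Rightarrow> real" where
  "mgf t = (\<integral>x. exp (t * x) * rho p x \<partial>lborel)"

lemma mgf_even: "mgf (- t) = mgf t"
  unfolding mgf_def
  by (subst lborel_integral_real_affine[where c = "-1" and t = 0]) auto

lemma mgf_cosh: "mgf t = (\<integral>x. cosh (t * x) * rho p x \<partial>lborel)"
proof -
  have "(\<integral>x. cosh (t * x) * rho p x \<partial>lborel)
      = (\<integral>x. (exp (t * x) * rho p x + exp (- t * x) * rho p x) / 2 \<partial>lborel)"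
    by (simp add: cosh_def field_simps)
  also have "\<dots> = (mgf t + mgf (- t)) / 2"
    using integrable_exp[of t] integrable_exp[of "- t"] by (simp add: mgf_def)
  finally show ?thesis by (simp add: mgf_even)
qed

lemma mgf_le: "mgf t \<le> exp (t\<^sup>2 / (2 * beta_c p))"
proof -
  have "ennreal (mgf t) = (\<integral>\<^sup>+x. ennreal (cosh (t * x) * rho p x) \<partial>lborel)"
    unfolding mgf_cosh by (intro nn_integral_eq_integral[symmetric] integrable_cosh) auto
  also have "\<dots> \<le> ennreal (exp (t\<^sup>2 * mom 2 / 2))" by (rule nn_cosh_le)
  finally show ?thesis by (simp add: mom_2 mult.commute)
qed

lemma integral_rho: "(\<integral>x. rho p x \<partial>lborel) = 1" "integrable lborel (rho p)"
proof -
  have "mgf 0 = 1"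
  proof (rule antisym)
    show "mgf 0 \<le> 1" using mgf_le[of 0] by simp
    \<comment> \<open>Only an inequality pointwise, since \<open>0 powr 0 = 0\<close>; together with
      the upper bound at \<open>t = 0\<close> it pins the mass to 1.\<close>
    have "(\<integral>x. \<bar>x\<bar> powr 0 * rho p x \<partial>lborel) \<le> (\<integral>x. rho p x \<partial>lborel)"
      using integrable_exp[of 0] abs_moment[of 0] by (intro integral_mono) (auto simp: has_bochner_integral_iff)
    then show "1 \<le> mgf 0" using abs_moment[of 0] by (simp add: mgf_def has_bochner_integral_iff mom_0)
  qed
  then show "(\<integral>x. rho p x \<partial>lborel) = 1" by (simp add: mgf_def)
  show "integrable lborel (rho p)" using integrable_exp[of 0] by simp
qed

lemma second_moment: "has_bochner_integral lborel (\<lambda>x. x\<^sup>2 * rho p x) (1 / beta_c p)"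
  using abs_moment[of 2] by (simp add: mom_2)

text \<open>Integrate \<open>cosh y \<ge> 1 + y^2 / 2\<close>, the odd part having dropped out by
  symmetry. It serves above the threshold, where \<open>psi\<close> has to be bounded below with the
  exact second-order coefficient.\<close>

lemma mgf_ge: "1 + t\<^sup>2 / (2 * beta_c p) \<le> mgf t"
proof -
  have "(\<integral>x. rho p x + t\<^sup>2 / 2 * (x\<^sup>2 * rho p x) \<partial>lborel) \<le> mgf t"
    unfolding mgf_cosh
  proof (rule integral_mono[OF _ integrable_cosh])
    show "integrable lborel (\<lambda>x. rho p x + t\<^sup>2 / 2 * (x\<^sup>2 * rho p x))"
      using integral_rho second_moment by (auto simp: has_bochner_integral_iff)
    fix x
    have "(1 + (t * x)\<^sup>2 / 2) * rho p x \<le> cosh (t * x) * rho p x"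
      by (intro mult_right_mono cosh_ge) auto
    then show "rho p x + t\<^sup>2 / 2 * (x\<^sup>2 * rho p x) \<le> cosh (t * x) * rho p x"
      by (simp add: algebra_simps power_mult_distrib)
  qed
  also have "(\<integral>x. rho p x + t\<^sup>2 / 2 * (x\<^sup>2 * rho p x) \<partial>lborel) = 1 + t\<^sup>2 / (2 * beta_c p)"
    using integral_rho second_moment by (simp add: has_bochner_integral_iff)
  finally show ?thesis .
qed

lemma mgf_ge_1: "1 \<le> mgf t"
  using mgf_ge[of t] beta_c_pos by (smt (verit) divide_nonneg_pos zero_le_power2 mult_pos_pos)

lemma mgf_pos: "0 < mgf t"
  using mgf_ge_1[of t] by simp

lemma exp_psi: "exp (psi p t) = mgf t"
  using mgf_pos[of t] by (simp add: psi_def mgf_def)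

lemma psi_le: "psi p t \<le> t\<^sup>2 / (2 * beta_c p)"
  using mgf_le[of t] by (simp flip: exp_psi)

lemma psi_ge: "ln (1 + t\<^sup>2 / (2 * beta_c p)) \<le> psi p t"
proof -
  have "0 < 1 + t\<^sup>2 / (2 * beta_c p)"
    using beta_c_pos by (intro add_pos_nonneg) auto
  then show ?thesis
    using mgf_ge[of t] by (simp add: psi_def mgf_def[symmetric])
qed

lemma psi_nonneg: "0 \<le> psi p t"
  using mgf_ge_1[of t] by (simp flip: exp_psi)

lemma psi_0: "psi p 0 = 0"
  using psi_le[of 0] psi_nonneg[of 0] by simp

text \<open>Convexity passes from \<open>exp\<close> through the integral, and a finite convex
  function on the line is continuous.\<close>

lemma continuous_mgf: "continuous_on UNIV mgf"
proof (rule convex_on_continuous)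
  show "convex_on UNIV mgf"
  proof (rule convex_onI)
    fix l x y :: real assume l: "0 < l" "l < 1"
    have "mgf ((1 - l) *\<^sub>R x + l *\<^sub>R y)
       \<le> (\<integral>z. (1 - l) * (exp (x * z) * rho p z) + l * (exp (y * z) * rho p z) \<partial>lborel)"
      unfolding mgf_def
    proof (rule integral_mono[OF integrable_exp])
      fix z
      have "exp ((1 - l) *\<^sub>R (x * z) + l *\<^sub>R (y * z)) \<le> (1 - l) * exp (x * z) + l * exp (y * z)"
        using l exp_convex by (intro convex_onD[of UNIV]) auto
      then have "exp ((1 - l) *\<^sub>R (x * z) + l *\<^sub>R (y * z)) * rho p z \<le> ((1 - l) * exp (x * z) + l * exp (y * z)) * rho p z"
        by (intro mult_right_mono) auto
      then show "exp (((1 - l) *\<^sub>R x + l *\<^sub>R y) * z) * rho p z \<le> (1 - l) * (exp (x * z) * rho p z) + l * (exp (y * z) * rho p z)"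
        by (simp add: algebra_simps)
    qed (use integrable_exp in auto)
    also have "\<dots> = (1 - l) * mgf x + l * mgf y"
      using integrable_exp by (simp add: mgf_def)
    finally show "mgf ((1 - l) *\<^sub>R x + l *\<^sub>R y) \<le> (1 - l) * mgf x + l * mgf y" .
  qed auto
qed auto

lemma continuous_psi: "continuous_on UNIV (psi p)"
  unfolding psi_def mgf_def[symmetric]
  using mgf_pos by (intro continuous_on_ln continuous_mgf) (metis less_irrefl)

section \<open>The law of one coordinate and the product measure\<close>

lemma sets_rho_measure [measurable_cong, simp]: "sets (rho_measure p) = sets borel"
  by (simp add: rho_measure_def)

lemma space_rho_measure [simp]: "space (rho_measure p) = UNIV"
  by (simp add: rho_measure_def)

lemma nn_integral_rho:
  "f \<in> borel_measurable borel \<Longrightarrow>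
    (\<integral>\<^sup>+x. f x \<partial>rho_measure p) = (\<integral>\<^sup>+x. ennreal (rho p x) * f x \<partial>lborel)"
  unfolding rho_measure_def by (subst nn_integral_density) auto

lemma integral_rho_measure:
  fixes f :: "real \<Rightarrow> real"
  shows "f \<in> borel_measurable borel \<Longrightarrow> (\<integral>x. f x \<partial>rho_measure p) = (\<integral>x. f x * rho p x \<partial>lborel)"
  unfolding rho_measure_def by (subst integral_density) (auto simp: mult.commute)

lemma integrable_rho_measure:
  fixes f :: "real \<Rightarrow> real"
  shows "f \<in> borel_measurable borel \<Longrightarrow> integrable (rho_measure p) f \<longleftrightarrow> integrable lborel (\<lambda>x. f x * rho p x)"
  unfolding rho_measure_def by (subst integrable_density) (auto simp: mult.commute)

lemma prob_space_rho: "prob_space (rho_measure p)"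
proof
  have "emeasure (rho_measure p) (space (rho_measure p)) = (\<integral>\<^sup>+x. 1 \<partial>rho_measure p)" by simp
  also have "\<dots> = (\<integral>\<^sup>+x. ennreal (rho p x) \<partial>lborel)" by (subst nn_integral_rho) auto
  also have "\<dots> = 1" using integral_rho by (subst nn_integral_eq_integral) auto
  finally show "emeasure (rho_measure p) (space (rho_measure p)) = 1" .
qed

sublocale rho: prob_space "rho_measure p"
  by (rule prob_space_rho)

sublocale pr: product_prob_space "\<lambda>_::nat. rho_measure p" UNIV
  by standard

definition P :: "nat \<Rightarrow> (nat \<Rightarrow> real) measure" where
  "P n = PiM {..<n} (\<lambda>_. rho_measure p)"

lemma sets_P [measurable_cong]: "sets (P n) = sets (PiM {..<n} (\<lambda>_. borel))"
  unfolding P_def by (intro sets_PiM_cong) auto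

lemma space_P: "space (P n) = PiE {..<n} (\<lambda>_. UNIV)"
  by (simp add: P_def space_PiM)

sublocale P: prob_space "P n" for n
  unfolding P_def by (rule prob_space_PiM) (rule prob_space_rho)

subsection \<open>Rescaling the product measure\<close>

text \<open>The restriction to \<open>{..<n}\<close> keeps the image in the extensional product
  space underlying \<open>P n\<close>.\<close>

definition dilate :: "nat \<Rightarrow> real \<Rightarrow> (nat \<Rightarrow> real) \<Rightarrow> nat \<Rightarrow> real" where
  "dilate n l x = (\<lambda>i\<in>{..<n}. l * x i)"

lemma dilate_measurable [measurable]: "dilate n l \<in> measurable (P n) (P n)"
  unfolding dilate_def[abs_def] P_def by measurable

text \<open>This is \<open>n R^p\<close>. It is preferred to \<open>R\<close> because dilating the
  product density changes its exponent by a multiple of \<open>W\<close>.\<close>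

definition W :: "nat \<Rightarrow> (nat \<Rightarrow> real) \<Rightarrow> real" where
  "W n x = (\<Sum>i<n. \<bar>x i\<bar> powr p)"

lemma W_measurable [measurable]: "W n \<in> borel_measurable (P n)"
  unfolding W_def[abs_def] by measurable

lemma W_nonneg [simp]: "0 \<le> W n x"
  by (simp add: W_def sum_nonneg)

text \<open>The factor is the quotient \<open>rho p (x / l) / (l * rho p x)\<close>. As
  \<open>\<bar>x\<bar> powr p\<close> is homogeneous, the two exponents differ by a multiple of
  \<open>\<bar>x\<bar> powr p\<close>, so the dilated law is an exponential tilt of the original
  one.\<close>

lemma distr_rho_mult:
  assumes l: "0 < l"
  shows "distr (rho_measure p) borel (\<lambda>x. l * x)
    = density (rho_measure p) (\<lambda>x. ennreal (exp ((1 - l powr (- p)) * \<bar>x\<bar> powr p / p) / l))"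
proof (rule measure_eqI)
  fix A assume "A \<in> sets (distr (rho_measure p) borel (\<lambda>x. l * x))"
  then have A [measurable]: "A \<in> sets borel" by simp
  have "emeasure (distr (rho_measure p) borel (\<lambda>x. l * x)) A = (\<integral>\<^sup>+x. indicator A x \<partial>distr (rho_measure p) borel (\<lambda>x. l * x))"
    by simp
  also have "\<dots> = (\<integral>\<^sup>+x. ennreal (rho p x) * indicator A (l * x) \<partial>lborel)"
    by (subst nn_integral_distr, measurable) (subst nn_integral_rho, auto)
  also have "\<dots> = (\<integral>\<^sup>+x. ennreal \<bar>1 / l\<bar> * (ennreal (rho p (x / l)) * indicator A x) \<partial>lborel)"
    using l by (subst nn_integral_real_affine[where c = "1 / l" and t = 0]) (auto simp: nn_integral_cmult)
  also have "\<dots> = (\<integral>\<^sup>+x. ennreal (rho p x) * (ennreal (exp ((1 - l powr (- p)) * \<bar>x\<bar> powr p / p) / l) * indicator A x) \<partial>lborel)"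
  proof (rule nn_integral_cong)
    fix x
    have "\<bar>x / l\<bar> powr p = \<bar>x\<bar> powr p * l powr (- p)"
      using l by (simp add: powr_divide powr_minus_divide)
    then have "- (\<bar>x / l\<bar> powr p) / p = - (\<bar>x\<bar> powr p) / p + (1 - l powr (- p)) * \<bar>x\<bar> powr p / p"
      by (simp add: field_simps)
    then have e: "exp (- (\<bar>x / l\<bar> powr p) / p) = exp (- (\<bar>x\<bar> powr p) / p) * exp ((1 - l powr (- p)) * \<bar>x\<bar> powr p / p)"
      by (simp only: exp_add)
    have "1 / l * rho p (x / l) = rho p x * (exp ((1 - l powr (- p)) * \<bar>x\<bar> powr p / p) / l)"
      unfolding rho_def e by (simp only: mult_1 times_divide_eq_left times_divide_eq_right mult.assoc)
    then show "ennreal \<bar>1 / l\<bar> * (ennreal (rho p (x / l)) * indicator A x)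
        = ennreal (rho p x) * (ennreal (exp ((1 - l powr (- p)) * \<bar>x\<bar> powr p / p) / l) * indicator A x)"
      using l by (simp add: mult.assoc[symmetric] ennreal_mult[symmetric])
  qed
  also have "\<dots> = emeasure (density (rho_measure p) (\<lambda>x. ennreal (exp ((1 - l powr (- p)) * \<bar>x\<bar> powr p / p) / l))) A"
    by (subst emeasure_density, simp, simp, subst nn_integral_rho, auto)
  finally show "emeasure (distr (rho_measure p) borel (\<lambda>x. l * x)) A = emeasure (density (rho_measure p) (\<lambda>x. ennreal (exp ((1 - l powr (- p)) * \<bar>x\<bar> powr p / p) / l))) A" .
qed simp

text \<open>Both sides are identified with the product of the dilated one-dimensional laws, by their
  values on boxes.\<close>

lemma distr_P_dilate:
  assumes l: "0 < l"
  shows "distr (P n) (P n) (dilate n l)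
    = density (P n) (\<lambda>x. ennreal (exp ((1 - l powr (- p)) * W n x / p) / l ^ n))"
proof -
  define w where "w x = ennreal (exp ((1 - l powr (- p)) * \<bar>x\<bar> powr p / p) / l)" for x
  define D where "D = density (rho_measure p) w"
  have D: "distr (rho_measure p) borel (\<lambda>x. l * x) = D"
    unfolding D_def w_def[abs_def] by (rule distr_rho_mult[OF l])
  have [measurable]: "w \<in> borel_measurable borel" unfolding w_def[abs_def] by measurable
  have "prob_space D" unfolding D[symmetric] by (rule rho.prob_space_distr) simp
  then interpret D: product_prob_space "\<lambda>_::nat. D" UNIV
    by (intro product_prob_spaceI)
  have [measurable_cong, simp]: "sets D = sets borel" by (simp add: D_def)
  have sets_PiM_D: "sets (PiM {..<n} (\<lambda>_. D)) = sets (P n)"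
    unfolding P_def by (intro sets_PiM_cong) auto
  have 1: "distr (P n) (P n) (dilate n l) = PiM {..<n} (\<lambda>_. D)"
  proof (rule D.PiM_eqI)
    fix A assume A: "\<And>i. i \<in> {..<n} \<Longrightarrow> A i \<in> sets D"
    have "emeasure (distr (P n) (P n) (dilate n l)) (Pi\<^sub>E {..<n} A) = emeasure (P n) (dilate n l -` Pi\<^sub>E {..<n} A \<inter> space (P n))"
      using A by (intro emeasure_distr dilate_measurable) (auto simp: P_def intro!: sets_PiM_I_finite)
    also have "dilate n l -` Pi\<^sub>E {..<n} A \<inter> space (P n) = Pi\<^sub>E {..<n} (\<lambda>i. (\<lambda>x. l * x) -` A i)"
      by (auto simp: dilate_def space_P PiE_iff)
    also have "emeasure (P n) \<dots> = (\<Prod>i<n. emeasure (rho_measure p) ((\<lambda>x. l * x) -` A i))"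
      unfolding P_def using A by (intro pr.emeasure_PiM) (auto intro!: measurable_sets_borel[of _ borel])
    also have "\<dots> = (\<Prod>i<n. emeasure D (A i))"
      using A by (intro prod.cong refl) (auto simp: D[symmetric] emeasure_distr)
    finally show "emeasure (distr (P n) (P n) (dilate n l)) (Pi\<^sub>E {..<n} A) = (\<Prod>i<n. emeasure D (A i))" .
  qed (auto simp: sets_PiM_D)
  have 2: "density (P n) (\<lambda>x. \<Prod>i<n. w (x i)) = PiM {..<n} (\<lambda>_. D)"
  proof (rule D.PiM_eqI)
    fix A assume A: "\<And>i. i \<in> {..<n} \<Longrightarrow> A i \<in> sets D"
    have [measurable]: "Pi\<^sub>E {..<n} A \<in> sets (P n)"
      using A by (auto simp: P_def intro!: sets_PiM_I_finite)
    have "emeasure (density (P n) (\<lambda>x. \<Prod>i<n. w (x i))) (Pi\<^sub>E {..<n} A)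
        = (\<integral>\<^sup>+x. (\<Prod>i<n. w (x i)) * indicator (Pi\<^sub>E {..<n} A) x \<partial>P n)"
      by (rule emeasure_density) measurable
    also have "\<dots> = (\<integral>\<^sup>+x. (\<Prod>i<n. w (x i) * indicator (A i) (x i)) \<partial>P n)"
    proof (rule nn_integral_cong)
      fix x assume "x \<in> space (P n)"
      then have "indicator (Pi\<^sub>E {..<n} A) x = (\<Prod>i<n. indicator (A i) (x i) :: ennreal)"
        by (auto simp: space_P PiE_iff indicator_def prod_zero_iff)
      then show "(\<Prod>i<n. w (x i)) * indicator (Pi\<^sub>E {..<n} A) x = (\<Prod>i<n. w (x i) * indicator (A i) (x i))"
        by (simp add: prod.distrib)
    qed
    also have "\<dots> = (\<Prod>i<n. \<integral>\<^sup>+x. w x * indicator (A i) x \<partial>rho_measure p)"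
      unfolding P_def using A by (intro pr.product_nn_integral_prod) auto
    also have "\<dots> = (\<Prod>i<n. emeasure D (A i))"
      using A by (intro prod.cong refl) (auto simp: D_def emeasure_density)
    finally show "emeasure (density (P n) (\<lambda>x. \<Prod>i<n. w (x i))) (Pi\<^sub>E {..<n} A) = (\<Prod>i<n. emeasure D (A i))" .
  qed (auto simp: sets_PiM_D)
  have "(\<Prod>i<n. w (x i)) = ennreal (exp ((1 - l powr (- p)) * W n x / p) / l ^ n)" for x
  proof -
    have "(\<Prod>i<n. w (x i)) = ennreal (\<Prod>i<n. exp ((1 - l powr (- p)) * \<bar>x i\<bar> powr p / p) / l)"
      unfolding w_def using l by (intro prod_ennreal) auto
    also have "(\<Prod>i<n. exp ((1 - l powr (- p)) * \<bar>x i\<bar> powr p / p) / l)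
        = exp (\<Sum>i<n. (1 - l powr (- p)) * \<bar>x i\<bar> powr p / p) / l ^ n"
      by (simp add: prod_dividef exp_sum)
    also have "(\<Sum>i<n. (1 - l powr (- p)) * \<bar>x i\<bar> powr p / p) = (1 - l powr (- p)) * W n x / p"
      by (simp add: W_def sum_distrib_left sum_divide_distrib)
    finally show ?thesis .
  qed
  with 1 2 show ?thesis by simp
qed

lemma nn_integral_dilate:
  assumes l: "0 < l" and f [measurable]: "f \<in> borel_measurable (P n)"
  shows "(\<integral>\<^sup>+x. f (dilate n l x) \<partial>P n)
    = (\<integral>\<^sup>+x. ennreal (exp ((1 - l powr (- p)) * W n x / p) / l ^ n) * f x \<partial>P n)"
  using distr_P_dilate[OF l, of n]
  by (subst nn_integral_density[symmetric]) (auto simp: nn_integral_distr dest!: sym[of "distr _ _ _"])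

definition homog :: "nat \<Rightarrow> ((nat \<Rightarrow> real) \<Rightarrow> 'a) \<Rightarrow> bool" where
  "homog n f \<longleftrightarrow> (\<forall>l>0. \<forall>x. f (dilate n l x) = f x)"

text \<open>Tilting by \<open>exp (\<theta> W / p)\<close> is a rescaling, which a homogeneous function does not see.\<close>

lemma nn_integral_tilt:
  assumes th: "\<theta> < 1" and f [measurable]: "f \<in> borel_measurable (P n)" and h: "homog n f"
  shows "(\<integral>\<^sup>+x. ennreal (exp (\<theta> * W n x / p)) * f x \<partial>P n)
    = ennreal ((1 - \<theta>) powr (- real n / p)) * (\<integral>\<^sup>+x. f x \<partial>P n)"
proof -
  define l where "l = (1 - \<theta>) powr (- 1 / p)"
  have l: "0 < l" using th by (simp add: l_def)
  have lp: "1 - l powr (- p) = \<theta>" using th by (simp add: l_def powr_powr)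
  have ln: "l ^ n = (1 - \<theta>) powr (- real n / p)"
    using l by (simp add: powr_realpow[symmetric] l_def powr_powr)
  have "(\<integral>\<^sup>+x. f x \<partial>P n) = (\<integral>\<^sup>+x. f (dilate n l x) \<partial>P n)"
    using h l by (simp add: homog_def)
  also have "\<dots> = (\<integral>\<^sup>+x. ennreal (exp (\<theta> * W n x / p) / l ^ n) * f x \<partial>P n)"
    using nn_integral_dilate[OF l f] by (simp add: lp)
  finally have "(\<integral>\<^sup>+x. f x \<partial>P n) = (\<integral>\<^sup>+x. ennreal (exp (\<theta> * W n x / p) / l ^ n) * f x \<partial>P n)" .
  then have "ennreal (l ^ n) * (\<integral>\<^sup>+x. f x \<partial>P n)
      = (\<integral>\<^sup>+x. ennreal (l ^ n) * (ennreal (exp (\<theta> * W n x / p) / l ^ n) * f x) \<partial>P n)"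
    by (subst nn_integral_cmult) auto
  also have "\<dots> = (\<integral>\<^sup>+x. ennreal (exp (\<theta> * W n x / p)) * f x \<partial>P n)"
    using l by (intro nn_integral_cong) (simp add: mult.assoc[symmetric] ennreal_mult[symmetric])
  finally show ?thesis by (simp add: ln)
qed

text \<open>One statement for both tails: the sign of \<open>s\<close> decides whether the event is
  \<open>W / n \<ge> 1 + s\<close> or \<open>W / n \<le> 1 + s\<close>. The tilt identity evaluates
  the exponential moment of \<open>W\<close> under any homogeneous weight, and the rate is that of a
  Gamma variable of shape \<open>n / p\<close>.\<close>

lemma chernoff:
  assumes s: "0 < 1 + s" and n: "0 < n" and f [measurable]: "f \<in> borel_measurable (P n)" and h: "homog n f"
  shows "(\<integral>\<^sup>+x. f x * indicator {x. 0 \<le> s * (W n x - real n * (1 + s))} x \<partial>P n)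
    \<le> ennreal (exp (- (real n / p) * (s - ln (1 + s)))) * (\<integral>\<^sup>+x. f x \<partial>P n)"
proof -
  \<comment> \<open>The minimiser of \<open>- \<theta> * (1 + s) - ln (1 - \<theta>)\<close>, the
    exponent of the Chernoff bound per \<open>n / p\<close>.\<close>
  define \<theta> where "\<theta> = s / (1 + s)"
  have th: "\<theta> < 1" "1 - \<theta> = 1 / (1 + s)" using s by (auto simp: \<theta>_def field_simps)
  have "(\<integral>\<^sup>+x. f x * indicator {x. 0 \<le> s * (W n x - real n * (1 + s))} x \<partial>P n)
     \<le> (\<integral>\<^sup>+x. ennreal (exp (- \<theta> * real n * (1 + s) / p)) * (ennreal (exp (\<theta> * W n x / p)) * f x) \<partial>P n)"
  proof (rule nn_integral_mono)
    fix x
    have "1 \<le> exp (- \<theta> * real n * (1 + s) / p) * exp (\<theta> * W n x / p)" if "0 \<le> s * (W n x - real n * (1 + s))"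
    proof -
      have "0 \<le> (s * (W n x - real n * (1 + s))) / (1 + s) / p" using that s by simp
      also have "\<dots> = - \<theta> * real n * (1 + s) / p + \<theta> * W n x / p"
        using s by (simp add: \<theta>_def right_diff_distrib diff_divide_distrib)
      finally show ?thesis by (simp add: exp_add[symmetric])
    qed
    then have "1 * f x \<le> ennreal (exp (- \<theta> * real n * (1 + s) / p) * exp (\<theta> * W n x / p)) * f x"
      if "0 \<le> s * (W n x - real n * (1 + s))" using that by (intro mult_right_mono) auto
    then show "f x * indicator {x. 0 \<le> s * (W n x - real n * (1 + s))} x
      \<le> ennreal (exp (- \<theta> * real n * (1 + s) / p)) * (ennreal (exp (\<theta> * W n x / p)) * f x)"
      unfolding ennreal_mult[OF exp_ge_zero exp_ge_zero] mult.assoc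
      by (cases "0 \<le> s * (W n x - real n * (1 + s))") simp_all
  qed
  also have "\<dots> = ennreal (exp (- \<theta> * real n * (1 + s) / p)) * (ennreal ((1 - \<theta>) powr (- real n / p)) * (\<integral>\<^sup>+x. f x \<partial>P n))"
    by (subst nn_integral_cmult, measurable) (subst nn_integral_tilt[OF th(1) f h], simp)
  also have "\<dots> = ennreal (exp (- \<theta> * real n * (1 + s) / p) * (1 - \<theta>) powr (- real n / p)) * (\<integral>\<^sup>+x. f x \<partial>P n)"
    by (simp add: ennreal_mult mult.assoc)
  also have "exp (- \<theta> * real n * (1 + s) / p) * (1 - \<theta>) powr (- real n / p) = exp (- (real n / p) * (s - ln (1 + s)))"
  proof -
    have "(1 - \<theta>) powr (- real n / p) = exp ((real n / p) * ln (1 + s))"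
      using s by (simp add: th powr_def ln_div)
    moreover have "- \<theta> * real n * (1 + s) / p = - (real n / p) * s"
      using s by (simp add: \<theta>_def)
    ultimately show ?thesis by (simp add: exp_add[symmetric] algebra_simps)
  qed
  finally show ?thesis .
qed

text \<open>Each tail carries at most a quarter of the weight, so the shell keeps at least half. The
  quantifier over \<open>f\<close> stands inside: the threshold for \<open>n\<close> depends on
  \<open>d\<close> alone, so \<open>f\<close> may be a Gibbs weight that grows exponentially with
  \<open>n\<close>.\<close>

lemma concentration:
  assumes d: "0 < d" "d < 1"
  shows "\<forall>\<^sub>F n in sequentially. \<forall>f. f \<in> borel_measurable (P n) \<longrightarrow> homog n f \<longrightarrow> (\<integral>\<^sup>+x. f x \<partial>P n) < \<infinity> \<longrightarrow>
     (\<integral>\<^sup>+x. f x \<partial>P n) \<le> 2 * (\<integral>\<^sup>+x. f x * indicator {x. \<bar>W n x - real n\<bar> \<le> real n * d} x \<partial>P n)"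
proof -
  have small: "\<forall>\<^sub>F n in sequentially. exp (- (real n / p) * (s - ln (1 + s))) \<le> 1 / 4"
    if s: "0 < 1 + s" "s \<noteq> 0" for s
  proof -
    have "ln (1 + s) < s" using s ln_le_minus_one[of "1 + s"] ln_eq_minus_one[of "1 + s"] by fastforce
    then have c: "0 < (s - ln (1 + s)) / p" by simp
    have "((\<lambda>n. exp (- ((s - ln (1 + s)) / p * real n))) \<longlongrightarrow> 0) sequentially"
      using c by (intro filterlim_compose[OF exp_at_bot] filterlim_compose[OF filterlim_uminus_at_bot_at_top]
          filterlim_tendsto_pos_mult_at_top[OF tendsto_const _ filterlim_real_sequentially])
    then have "\<forall>\<^sub>F n in sequentially. exp (- ((s - ln (1 + s)) / p * real n)) < 1 / 4"
      by (rule order_tendstoD) simp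
    then show ?thesis by eventually_elim (simp add: mult_ac)
  qed
  have "\<forall>\<^sub>F n in sequentially. exp (- (real n / p) * (d - ln (1 + d))) \<le> 1 / 4"
       "\<forall>\<^sub>F n in sequentially. exp (- (real n / p) * (- d - ln (1 + - d))) \<le> 1 / 4"
    using d by (intro small; simp)+
  moreover have "\<forall>\<^sub>F n in sequentially. (0::nat) < n" by (rule eventually_gt_at_top)
  ultimately show ?thesis
  proof eventually_elim
    case (elim n)
    show ?case
    proof (intro allI impI)
      fix f :: "(nat \<Rightarrow> real) \<Rightarrow> ennreal"
      assume f [measurable]: "f \<in> borel_measurable (P n)" and h: "homog n f" and fin: "(\<integral>\<^sup>+x. f x \<partial>P n) < \<infinity>"
      let ?E = "\<integral>\<^sup>+x. f x \<partial>P n"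
      let ?G = "{x. \<bar>W n x - real n\<bar> \<le> real n * d}"
      have q: "(\<integral>\<^sup>+x. f x * indicator {x. 0 \<le> s * (W n x - real n * (1 + s))} x \<partial>P n) \<le> ennreal (1 / 4) * ?E"
        if "0 < 1 + s" "exp (- (real n / p) * (s - ln (1 + s))) \<le> 1 / 4" for s
        by (rule order_trans[OF chernoff[OF that(1) elim(3) f h]]) (intro mult_right_mono ennreal_leI that, simp)
      have "?E \<le> (\<integral>\<^sup>+x. f x * indicator ?G x + (f x * indicator {x. 0 \<le> d * (W n x - real n * (1 + d))} x
            + f x * indicator {x. 0 \<le> (- d) * (W n x - real n * (1 + (- d)))} x) \<partial>P n)"
      proof (rule nn_integral_mono)
        fix x
        consider "x \<in> ?G" | "0 \<le> d * (W n x - real n * (1 + d))" | "0 \<le> (- d) * (W n x - real n * (1 + (- d)))"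
        proof -
          have "0 \<le> d * (W n x - real n * (1 + d))" if "real n * d < W n x - real n"
            using that d by (intro mult_nonneg_nonneg) (auto simp: algebra_simps)
          moreover have "0 \<le> (- d) * (W n x - real n * (1 + (- d)))" if "W n x - real n < - (real n * d)"
            using that d by (intro mult_nonpos_nonpos) (auto simp: algebra_simps)
          ultimately show ?thesis using that by (auto simp: abs_le_iff) (smt (verit))
        qed
        then show "f x \<le> f x * indicator ?G x + (f x * indicator {x. 0 \<le> d * (W n x - real n * (1 + d))} x
            + f x * indicator {x. 0 \<le> (- d) * (W n x - real n * (1 + (- d)))} x)"
          by cases (auto simp: indicator_def add_increasing add_increasing2)
      qed
      also have "\<dots> = (\<integral>\<^sup>+x. f x * indicator ?G x \<partial>P n) +
         ((\<integral>\<^sup>+x. f x * indicator {x. 0 \<le> d * (W n x - real n * (1 + d))} x \<partial>P n) +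
          (\<integral>\<^sup>+x. f x * indicator {x. 0 \<le> (- d) * (W n x - real n * (1 + (- d)))} x \<partial>P n))"
        by (simp add: nn_integral_add)
      also have "\<dots> \<le> (\<integral>\<^sup>+x. f x * indicator ?G x \<partial>P n) + (ennreal (1 / 4) * ?E + ennreal (1 / 4) * ?E)"
        using elim d by (intro add_left_mono add_mono q) auto
      finally have *: "?E \<le> (\<integral>\<^sup>+x. f x * indicator ?G x \<partial>P n) + (ennreal (1 / 4) * ?E + ennreal (1 / 4) * ?E)" .
      \<comment> \<open>Finiteness allows the two quarters of \<open>?E\<close> to be moved to the
        left-hand side.\<close>
      obtain e where e: "?E = ennreal e" "0 \<le> e" using fin by (cases ?E) auto
      show "?E \<le> 2 * (\<integral>\<^sup>+x. f x * indicator ?G x \<partial>P n)"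
      proof (cases "\<integral>\<^sup>+x. f x * indicator ?G x \<partial>P n")
        case (real g)
        have "ennreal e \<le> ennreal (g + (e / 4 + e / 4))"
          using * real e by (simp add: ennreal_mult[symmetric] ennreal_plus[symmetric] del: ennreal_plus)
        then have "e \<le> g + (e / 4 + e / 4)"
          using real e by (subst (asm) ennreal_le_iff) auto
        then have "e \<le> 2 * g" by simp
        then have "ennreal e \<le> ennreal (2 * g)" by (rule ennreal_leI)
        then show ?thesis using real e by (simp add: ennreal_mult)
      qed (simp add: ennreal_mult_top)
    qed
  qed
qed

end

text \<open>Convexity of \<open>exp\<close> on the segment from 0 to \<open>ln t\<close>. The
  right-hand side is the tangent at \<open>t = 1\<close>, where a typical coordinate average sits on
  the sphere.\<close>

lemma powr_le_affine:
  fixes t a :: real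
  assumes "0 \<le> t" "0 \<le> a" "a \<le> 1"
  shows "t powr a \<le> a * t + (1 - a)"
proof (cases "t = 0")
  case False
  then have t: "0 < t" using assms by simp
  have "exp ((1 - a) *\<^sub>R 0 + a *\<^sub>R ln t) \<le> (1 - a) * exp 0 + a * exp (ln t)"
    using assms exp_convex by (intro convex_onD[of UNIV]) auto
  then show ?thesis using t by (simp add: powr_def)
qed (use assms in simp)

context lp_density
begin

subsection \<open>Magnetization as a homogeneous function\<close>

lemma norm_np_W: "norm_np n p x = (W n x / real n) powr (1 / p)"
  by (simp add: norm_np_def W_def)

definition mag :: "nat \<Rightarrow> (nat \<Rightarrow> real) \<Rightarrow> real" where
  "mag n x = (\<Sum>i<n. x i / norm_np n p x) / real n"

text \<open>The diagonal part of the squared sum: the Hamiltonian on the sphere is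
  \<open>(n * mag^2 - ms) / 2\<close>. Since \<open>ms\<close> lies between 0 and 1, dropping it
  changes Boltzmann factors by a bounded amount only.\<close>

definition ms :: "nat \<Rightarrow> (nat \<Rightarrow> real) \<Rightarrow> real" where
  "ms n x = (\<Sum>i<n. (x i / norm_np n p x)\<^sup>2) / real n"

lemma norm_np_measurable [measurable]: "norm_np n p \<in> borel_measurable (P n)"
  unfolding norm_np_W[abs_def] by measurable

lemma mag_measurable [measurable]: "mag n \<in> borel_measurable (P n)"
  unfolding mag_def[abs_def] by measurable

lemma ms_measurable [measurable]: "ms n \<in> borel_measurable (P n)"
  unfolding ms_def[abs_def] by measurable

lemma sum_measurable [measurable]: "(\<lambda>x. \<Sum>i<n. x i) \<in> borel_measurable (P n)"
  by measurable

lemma W_dilate: "0 < l \<Longrightarrow> W n (dilate n l x) = l powr p * W n x"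
  by (simp add: W_def dilate_def abs_mult powr_mult sum_distrib_left)

lemma norm_dilate:
  assumes "0 < l"
  shows "norm_np n p (dilate n l x) = l * norm_np n p x"
proof -
  have "W n (dilate n l x) / real n = l powr p * (W n x / real n)"
    using assms by (simp add: W_dilate)
  then show ?thesis
    using assms by (simp only: norm_np_W) (subst powr_mult, auto simp: powr_powr)
qed

lemma mag_dilate: "0 < l \<Longrightarrow> mag n (dilate n l x) = mag n x"
  by (simp add: mag_def norm_dilate) (simp add: dilate_def)

lemma norm_np_nonneg [simp]: "0 \<le> norm_np n p x"
  by (simp add: norm_np_W)

lemma norm_np_powr: "0 < n \<Longrightarrow> real n * norm_np n p x powr p = W n x"
  by (simp add: norm_np_W powr_powr)

lemma W_eq_0: "W n x = 0 \<Longrightarrow> i < n \<Longrightarrow> x i = 0"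
  unfolding W_def by (subst (asm) sum_nonneg_eq_0_iff) auto

text \<open>If \<open>R = 0\<close>, all coordinates vanish, so with \<open>x / 0 = 0\<close> the
  identity holds at every point and not just almost everywhere.\<close>

lemma sum_eq_mag:
  assumes n: "0 < n"
  shows "(\<Sum>i<n. x i) = real n * (mag n x * norm_np n p x)"
proof (cases "norm_np n p x = 0")
  case True
  then have "W n x = 0" using norm_np_powr[OF n, of x] by simp
  then have "(\<Sum>i<n. x i) = 0" by (intro sum.neutral) (auto dest: W_eq_0)
  then show ?thesis using True by simp
next
  case False
  then show ?thesis using n by (simp add: mag_def sum_divide_distrib[symmetric])
qed

text \<open>Equality except at the origin, where the projection is 0 by the convention for
  division.\<close>

lemma sphere_sum_le: "(\<Sum>i<n. \<bar>x i / norm_np n p x\<bar> powr p) \<le> real n"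
proof (cases "norm_np n p x = 0 \<or> n = 0")
  case False
  then have n: "0 < n" and N: "norm_np n p x \<noteq> 0" by auto
  have "(\<Sum>i<n. \<bar>x i / norm_np n p x\<bar> powr p) = W n x / norm_np n p x powr p"
    by (simp add: W_def powr_divide sum_divide_distrib)
  also have "\<dots> = real n" using N by (simp flip: norm_np_powr[OF n])
  finally show ?thesis by simp
qed auto

text \<open>The power-mean inequality on the sphere, by replacing \<open>t powr (s / p)\<close> with
  its tangent at 1. The orders \<open>s = 2\<close> and \<open>s = 1\<close> bound \<open>ms\<close>
  and \<open>mag\<close>.\<close>

lemma sphere_moment_le:
  assumes s: "0 \<le> s" "s \<le> p"
  shows "(\<Sum>i<n. (\<bar>x i / norm_np n p x\<bar> powr p) powr (s / p)) \<le> real n"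
proof -
  have "(\<Sum>i<n. (\<bar>x i / norm_np n p x\<bar> powr p) powr (s / p))
      \<le> (\<Sum>i<n. s / p * \<bar>x i / norm_np n p x\<bar> powr p + (1 - s / p))"
    using s by (intro sum_mono powr_le_affine) auto
  also have "\<dots> = s / p * (\<Sum>i<n. \<bar>x i / norm_np n p x\<bar> powr p) + real n * (1 - s / p)"
    by (simp add: sum.distrib sum_distrib_left)
  also have "\<dots> \<le> s / p * real n + real n * (1 - s / p)"
    using s by (intro add_right_mono mult_left_mono sphere_sum_le) auto
  finally show ?thesis by (simp add: algebra_simps)
qed

lemma ms_le_1: "ms n x \<le> 1" and ms_nonneg: "0 \<le> ms n x"
proof -
  have "(\<Sum>i<n. (x i / norm_np n p x)\<^sup>2) = (\<Sum>i<n. (\<bar>x i / norm_np n p x\<bar> powr p) powr (2 / p))"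
    by (intro sum.cong refl) (simp add: powr_powr power_divide)
  then show "ms n x \<le> 1"
    using sphere_moment_le[of 2 x n] p_ge_2 by (cases "n = 0") (simp_all add: ms_def divide_le_eq_1)
  show "0 \<le> ms n x" by (simp add: ms_def sum_nonneg)
qed

lemma abs_mag_le_1: "\<bar>mag n x\<bar> \<le> 1"
proof -
  have "\<bar>\<Sum>i<n. x i / norm_np n p x\<bar> \<le> (\<Sum>i<n. \<bar>x i / norm_np n p x\<bar>)" by (rule sum_abs)
  also have "\<dots> = (\<Sum>i<n. (\<bar>x i / norm_np n p x\<bar> powr p) powr (1 / p))"
    by (intro sum.cong refl) (simp add: powr_powr)
  also have "\<dots> \<le> real n" using sphere_moment_le[of 1 x n] p_ge_2 by simp
  finally show ?thesis by (cases "n = 0") (simp_all add: mag_def divide_le_eq_1)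
qed

lemma mag_sq_le_1: "(mag n x)\<^sup>2 \<le> 1"
  using abs_mag_le_1[of n x] by (simp add: abs_square_le_1)

subsection \<open>The simplified partition function\<close>

definition A :: "nat \<Rightarrow> real \<Rightarrow> real" where
  "A n \<beta> = (\<integral>x. exp (real n * \<beta> * (mag n x)\<^sup>2 / 2) \<partial>P n)"

lemma weight_le: "0 \<le> \<beta> \<Longrightarrow> exp (real n * \<beta> * (mag n x)\<^sup>2 / 2) \<le> exp (real n * \<beta> / 2)"
  using mag_sq_le_1[of n x] by (simp add: mult_left_le)

lemma integrable_weight: "0 \<le> \<beta> \<Longrightarrow> integrable (P n) (\<lambda>x. exp (real n * \<beta> * (mag n x)\<^sup>2 / 2))"
  using weight_le by (intro P.integrable_const_bound[where B = "exp (real n * \<beta> / 2)"]) auto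

lemma nn_A: "0 \<le> \<beta> \<Longrightarrow> (\<integral>\<^sup>+x. ennreal (exp (real n * \<beta> * (mag n x)\<^sup>2 / 2)) \<partial>P n) = ennreal (A n \<beta>)"
  unfolding A_def by (intro nn_integral_eq_integral integrable_weight) auto

lemma A_ge_1: "0 \<le> \<beta> \<Longrightarrow> 1 \<le> A n \<beta>"
  unfolding A_def using integrable_weight[of \<beta> n] by (intro P.integral_ge_const) auto

lemma A_le: "0 \<le> \<beta> \<Longrightarrow> A n \<beta> \<le> exp (real n * \<beta> / 2)"
  unfolding A_def using integrable_weight[of \<beta> n] weight_le by (intro P.integral_le_const) auto

lemma nn_exp_sum: "(\<integral>\<^sup>+x. ennreal (exp (a * (\<Sum>i<n. x i))) \<partial>P n) = ennreal (mgf a ^ n)"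
proof -
  have "(\<integral>\<^sup>+x. ennreal (exp (a * (\<Sum>i<n. x i))) \<partial>P n) = (\<integral>\<^sup>+x. (\<Prod>i<n. ennreal (exp (a * x i))) \<partial>P n)"
    by (intro nn_integral_cong) (simp add: prod_ennreal sum_distrib_left exp_sum)
  also have "\<dots> = (\<Prod>i<n. \<integral>\<^sup>+x. ennreal (exp (a * x)) \<partial>rho_measure p)"
    unfolding P_def by (intro pr.product_nn_integral_prod) auto
  also have "(\<integral>\<^sup>+x. ennreal (exp (a * x)) \<partial>rho_measure p) = ennreal (mgf a)"
  proof -
    have "(\<integral>\<^sup>+x. ennreal (exp (a * x)) \<partial>rho_measure p) = (\<integral>\<^sup>+x. ennreal (exp (a * x) * rho p x) \<partial>lborel)"
      by (subst nn_integral_rho) (auto simp: ennreal_mult mult.commute)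
    also have "\<dots> = ennreal (mgf a)"
      unfolding mgf_def by (intro nn_integral_eq_integral integrable_exp) auto
    finally show ?thesis .
  qed
  also have "(\<Prod>i<n. ennreal (mgf a)) = ennreal (mgf a ^ n)"
    using mgf_pos[of a] by (simp add: ennreal_power)
  finally show ?thesis .
qed

text \<open>Lower bound: decouple \<open>a S = n (\<surd>\<beta> m) (w u R)\<close> by the inequality of arithmetic and geometric
  means, and absorb the factor depending on the radius \<open>R\<close> by a tilt.\<close>

lemma free_energy_lower:
  assumes b: "0 \<le> \<beta>" and u: "0 \<le> u" "u < 1" and n: "0 < n"
    and k: "\<And>y. 0 \<le> y \<Longrightarrow> (w * y)\<^sup>2 / 2 \<le> y powr p / p + k"
  shows "psi p (sqrt \<beta> * u * w) + (1 / p) * ln (1 - u powr p) - k \<le> ln (A n \<beta>) / real n"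
proof -
  let ?a = "sqrt \<beta> * u * w"
  have up: "u powr p < 1" using u powr_less_mono2[of p u 1] by simp
  have pt: "?a * (\<Sum>i<n. x i) \<le> real n * k + (u powr p * W n x / p + real n * \<beta> * (mag n x)\<^sup>2 / 2)" for x
  proof -
    let ?R = "norm_np n p x"
    have "(w * (u * ?R))\<^sup>2 / 2 \<le> (u * ?R) powr p / p + k"
      using u by (intro k) simp
    moreover have "0 \<le> (sqrt \<beta> * mag n x - w * (u * ?R))\<^sup>2" by simp
    ultimately have "(sqrt \<beta> * mag n x) * (w * (u * ?R)) \<le> (sqrt \<beta> * mag n x)\<^sup>2 / 2 + ((u * ?R) powr p / p + k)"
      unfolding power2_diff by linarith
    then have "real n * ((sqrt \<beta> * mag n x) * (w * (u * ?R)))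
        \<le> real n * ((sqrt \<beta> * mag n x)\<^sup>2 / 2 + ((u * ?R) powr p / p + k))"
      by (intro mult_left_mono) auto
    moreover have "real n * ((u * ?R) powr p / p) = u powr p * W n x / p"
      using u by (simp add: powr_mult flip: norm_np_powr[OF n])
    ultimately show ?thesis
      using b by (simp add: sum_eq_mag[OF n] power_mult_distrib algebra_simps)
  qed
  have "ennreal (mgf ?a ^ n) = (\<integral>\<^sup>+x. ennreal (exp (?a * (\<Sum>i<n. x i))) \<partial>P n)"
    by (rule nn_exp_sum[symmetric])
  also have "\<dots> \<le> (\<integral>\<^sup>+x. ennreal (exp (real n * k)) * (ennreal (exp (u powr p * W n x / p)) * ennreal (exp (real n * \<beta> * (mag n x)\<^sup>2 / 2))) \<partial>P n)"
    using pt by (intro nn_integral_mono) (simp add: ennreal_mult[symmetric] exp_add[symmetric])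
  \<comment> \<open>The radius appears as the tilt \<open>\<theta> = u powr p\<close>, and its cost
    \<open>(1 - u powr p) powr (- n / p)\<close> is the logarithmic term of the variational
    formulas.\<close>
  also have "\<dots> = ennreal (exp (real n * k)) * (ennreal ((1 - u powr p) powr (- real n / p)) * ennreal (A n \<beta>))"
    using b by (subst nn_integral_cmult, measurable)
      (subst nn_integral_tilt[OF up], auto simp: homog_def mag_dilate nn_A)
  also have "\<dots> = ennreal (exp (real n * k) * ((1 - u powr p) powr (- real n / p) * A n \<beta>))"
    using A_ge_1[OF b, of n] by (simp add: ennreal_mult)
  finally have "mgf ?a ^ n \<le> exp (real n * k) * ((1 - u powr p) powr (- real n / p) * A n \<beta>)"
    using A_ge_1[OF b, of n] by (subst (asm) ennreal_le_iff) auto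
  then have "ln (mgf ?a ^ n) \<le> ln (exp (real n * k) * ((1 - u powr p) powr (- real n / p) * A n \<beta>))"
    using mgf_pos[of ?a] by (intro ln_mono) auto
  moreover have "ln (mgf ?a ^ n) = real n * psi p ?a"
    using mgf_pos[of ?a] by (simp add: ln_realpow psi_def mgf_def)
  moreover have "ln (exp (real n * k) * ((1 - u powr p) powr (- real n / p) * A n \<beta>))
      = real n * k - real n / p * ln (1 - u powr p) + ln (A n \<beta>)"
    using A_ge_1[OF b, of n] up by (simp add: ln_mult ln_powr)
  ultimately have "real n * (psi p ?a + (1 / p) * ln (1 - u powr p) - k) \<le> ln (A n \<beta>)"
    by (simp add: algebra_simps)
  then show ?thesis using n by (simp add: pos_le_divide_eq mult.commute)
qed

text \<open>The first functional at \<open>z^p = \<beta> x^2\<close>,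
  \<open>w = z powr ((p - 2) / 2)\<close>, and also the second at the corresponding \<open>u\<close>
  and \<open>v = z\<close>. As a function of the magnetization \<open>x\<close> it is the
  exponential rate bounding the contribution of \<open>\<bar>mag\<bar>\<close> near
  \<open>x\<close>.\<close>

definition G :: "real \<Rightarrow> real \<Rightarrow> real" where
  "G \<beta> x = psi p (\<beta> * x / (1 + \<beta> * x\<^sup>2) powr (1 / p)) - (1 / p) * ln (1 + \<beta> * x\<^sup>2) - (p - 2) / (2 * p) * (\<beta> * x\<^sup>2)"

text \<open>Upper bound: at magnetization \<open>x\<close> the optimal tilt makes the radius \<open>r\<close> typical, where \<open>r\<^sup>p = 1 + \<beta> x\<^sup>2\<close>;
  conditioning on a typical radius costs only a factor 2 by concentration, and then \<open>\<bar>mag\<bar> \<ge> x\<close> is a half-space event.\<close>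

lemma cell_upper:
  assumes b: "0 \<le> \<beta>" and d: "0 < d" "d < 1"
  shows "\<forall>\<^sub>F n in sequentially. \<forall>x\<in>{0..1}.
    (\<integral>\<^sup>+\<sigma>. ennreal (exp (real n * \<beta> * (mag n \<sigma>)\<^sup>2 / 2)) * indicator {\<sigma>. \<bar>\<bar>mag n \<sigma>\<bar> - x\<bar> \<le> d} \<sigma> \<partial>P n)
     \<le> ennreal (4 * exp (real n * (G \<beta> x + 4 * \<beta> * d)))"
  using concentration[OF d] eventually_gt_at_top[of "0::nat"]
proof eventually_elim
  case (elim n)
  note n = elim(2)
  show ?case
  proof
    fix x :: real assume "x \<in> {0..1}"
    then have x: "0 \<le> x" "x \<le> 1" by auto
    define r where "r = (1 + \<beta> * x\<^sup>2) powr (1 / p)"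
    have bx: "1 \<le> 1 + \<beta> * x\<^sup>2" using b by simp
    have r: "1 \<le> r" using bx by (simp add: r_def ge_one_powr_ge_zero)
    then have r0: "0 < r" by simp
    have rp: "r powr p = 1 + \<beta> * x\<^sup>2" using bx by (simp add: r_def powr_powr)
    \<comment> \<open>The derivative in \<open>S\<close> of the exponent
      \<open>n * \<beta> * (S / (n * r))^2 / 2\<close> at \<open>S = n * x * r\<close>: the sum is
      tilted along the tangent of the weight.\<close>
    define a where "a = \<beta> * x / r"
    have a: "0 \<le> a" using b x r by (simp add: a_def)
    have ar: "a * r = \<beta> * x" using r by (simp add: a_def)
    define f where "f \<sigma> = (indicator {\<sigma>. \<bar>\<bar>mag n \<sigma>\<bar> - x\<bar> \<le> d} \<sigma> :: ennreal)" for \<sigma>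
    have f [measurable]: "f \<in> borel_measurable (P n)" unfolding f_def[abs_def] by measurable
    have hom: "homog n f" by (simp add: homog_def f_def indicator_def mag_dilate)
    have "(\<integral>\<^sup>+\<sigma>. f \<sigma> \<partial>P n) \<le> (\<integral>\<^sup>+\<sigma>. 1 \<partial>P n)"
      by (intro nn_integral_mono) (simp add: f_def indicator_def)
    also have "\<dots> < \<infinity>" by (simp add: P.emeasure_space_1)
    finally have fin: "(\<integral>\<^sup>+\<sigma>. f \<sigma> \<partial>P n) < \<infinity>" .
    define c where "c = exp (real n * (\<beta> * x\<^sup>2 * (1 + d) / p)) / r ^ n * exp (- (real n * (\<beta> * x * (x - d) * (1 - d))))"
    have c: "0 \<le> c" using r0 by (simp add: c_def)
    \<comment> \<open>The shell at radius \<open>r\<close>. Pulled back by the dilation it is the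
      typical shell at radius 1, to which \<open>concentration\<close> applies; the change of
      measure supplies the remaining factor.\<close>
    define F where "F \<sigma> = f \<sigma> * indicator {\<sigma>. \<bar>W n \<sigma> - real n * r powr p\<bar> \<le> real n * r powr p * d} \<sigma>" for \<sigma>
    have [measurable]: "F \<in> borel_measurable (P n)" unfolding F_def[abs_def] by measurable
    have F: "F (dilate n r \<sigma>) = f \<sigma> * indicator {\<sigma>. \<bar>W n \<sigma> - real n\<bar> \<le> real n * d} \<sigma>" for \<sigma>
    proof -
      have "\<bar>r powr p * W n \<sigma> - real n * r powr p\<bar> = r powr p * \<bar>W n \<sigma> - real n\<bar>"
        by (simp add: right_diff_distrib[symmetric] abs_mult mult.commute[of "real n"])
      moreover have "r powr p * \<bar>W n \<sigma> - real n\<bar> \<le> real n * r powr p * d \<longleftrightarrow> \<bar>W n \<sigma> - real n\<bar> \<le> real n * d"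
        using r0 mult_le_cancel_left_pos[of "r powr p" "\<bar>W n \<sigma> - real n\<bar>" "real n * d"] by (simp add: mult_ac)
      ultimately show ?thesis
        using hom r0 by (simp add: F_def homog_def W_dilate indicator_def)
    qed
    have pt: "ennreal (exp ((1 - r powr (- p)) * W n \<sigma> / p) / r ^ n) * F \<sigma>
        \<le> ennreal c * (ennreal (exp (a * (\<Sum>i<n. \<sigma> i))) + ennreal (exp ((- a) * (\<Sum>i<n. \<sigma> i))))" for \<sigma>
    proof (cases "\<bar>\<bar>mag n \<sigma>\<bar> - x\<bar> \<le> d \<and> \<bar>W n \<sigma> - real n * r powr p\<bar> \<le> real n * r powr p * d")
      case True
      then have Wu: "W n \<sigma> \<le> real n * r powr p * (1 + d)" and Wl: "real n * r powr p * (1 - d) \<le> W n \<sigma>"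
        and m: "x - d \<le> \<bar>mag n \<sigma>\<bar>" by (auto simp: abs_le_iff algebra_simps)
      have "(1 - r powr (- p)) * W n \<sigma> / p \<le> (1 - r powr (- p)) * (real n * r powr p * (1 + d)) / p"
        using r by (intro divide_right_mono mult_left_mono Wu) (auto simp: powr_minus_divide divide_le_eq_1 ge_one_powr_ge_zero)
      also have "\<dots> = real n * (\<beta> * x\<^sup>2 * (1 + d) / p)"
      proof -
        have "(1 - r powr (- p)) * r powr p = \<beta> * x\<^sup>2"
          using r0 rp[symmetric] by (simp add: powr_minus_divide left_diff_distrib)
        then show ?thesis by (simp add: mult_ac)
      qed
      finally have e1: "exp ((1 - r powr (- p)) * W n \<sigma> / p) \<le> exp (real n * (\<beta> * x\<^sup>2 * (1 + d) / p))" by simp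
      have "r * (1 - d) \<le> norm_np n p \<sigma>"
      proof -
        have "(r * (1 - d)) powr p \<le> W n \<sigma> / real n"
        proof -
          have "(1 - d) powr p \<le> (1 - d) powr 1" using d p_ge_2 by (intro powr_mono') auto
          then have "(r * (1 - d)) powr p \<le> r powr p * (1 - d)"
            using d r0 by (simp add: powr_mult mult_left_mono)
          also have "\<dots> \<le> W n \<sigma> / real n" using Wl n by (simp add: pos_le_divide_eq mult_ac)
          finally show ?thesis .
        qed
        then have "((r * (1 - d)) powr p) powr (1 / p) \<le> (W n \<sigma> / real n) powr (1 / p)"
          by (intro powr_mono2) auto
        then show ?thesis using r0 d by (simp add: norm_np_W powr_powr)
      qed
      \<comment> \<open>For \<open>x < d\<close> the left-hand side is nonpositive and there is
        nothing to show; otherwise the bounds on \<open>mag\<close> and on the radius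
        multiply.\<close>
      then have "(x - d) * (r * (1 - d)) \<le> \<bar>mag n \<sigma>\<bar> * norm_np n p \<sigma>"
        using m d r0 by (cases "0 \<le> x - d") (auto intro!: mult_mono intro: order_trans[OF mult_nonpos_nonneg])
      then have "a * real n * ((x - d) * (r * (1 - d))) \<le> a * real n * (\<bar>mag n \<sigma>\<bar> * norm_np n p \<sigma>)"
        using a by (intro mult_left_mono) auto
      also have "\<dots> = a * \<bar>\<Sum>i<n. \<sigma> i\<bar>"
        by (simp add: sum_eq_mag[OF n] abs_mult)
      also have "a * real n * ((x - d) * (r * (1 - d))) = real n * (\<beta> * x * (x - d) * (1 - d))"
        by (simp add: ar[symmetric] mult_ac)
      finally have "0 \<le> - (real n * (\<beta> * x * (x - d) * (1 - d))) + a * \<bar>\<Sum>i<n. \<sigma> i\<bar>" by simp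
      then have "1 \<le> exp (- (real n * (\<beta> * x * (x - d) * (1 - d)))) * exp (a * \<bar>\<Sum>i<n. \<sigma> i\<bar>)"
        by (simp add: exp_add[symmetric])
      also have "exp (a * \<bar>\<Sum>i<n. \<sigma> i\<bar>) \<le> exp (a * (\<Sum>i<n. \<sigma> i)) + exp ((- a) * (\<Sum>i<n. \<sigma> i))"
        by (simp add: abs_if)
      finally have e2: "1 \<le> exp (- (real n * (\<beta> * x * (x - d) * (1 - d)))) * (exp (a * (\<Sum>i<n. \<sigma> i)) + exp ((- a) * (\<Sum>i<n. \<sigma> i)))"
        by (simp add: mult_left_mono)
      have "exp ((1 - r powr (- p)) * W n \<sigma> / p) / r ^ n * 1 \<le> (exp (real n * (\<beta> * x\<^sup>2 * (1 + d) / p)) / r ^ n) *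
         (exp (- (real n * (\<beta> * x * (x - d) * (1 - d)))) * (exp (a * (\<Sum>i<n. \<sigma> i)) + exp ((- a) * (\<Sum>i<n. \<sigma> i))))"
        using e1 e2 r0 by (intro mult_mono divide_right_mono) auto
      then have "exp ((1 - r powr (- p)) * W n \<sigma> / p) / r ^ n \<le> c * (exp (a * (\<Sum>i<n. \<sigma> i)) + exp ((- a) * (\<Sum>i<n. \<sigma> i)))"
        by (simp only: c_def mult.assoc mult_1_right)
      then have "ennreal (exp ((1 - r powr (- p)) * W n \<sigma> / p) / r ^ n) \<le> ennreal (c * (exp (a * (\<Sum>i<n. \<sigma> i)) + exp ((- a) * (\<Sum>i<n. \<sigma> i))))"
        by (rule ennreal_leI)
      also have "\<dots> = ennreal c * (ennreal (exp (a * (\<Sum>i<n. \<sigma> i))) + ennreal (exp ((- a) * (\<Sum>i<n. \<sigma> i))))"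
        using c by (simp add: ennreal_mult ennreal_plus)
      finally show ?thesis using True by (simp add: F_def f_def)
    qed (auto simp: F_def f_def)
    have "(\<integral>\<^sup>+\<sigma>. f \<sigma> \<partial>P n) \<le> 2 * (\<integral>\<^sup>+\<sigma>. F (dilate n r \<sigma>) \<partial>P n)"
      using elim(1) f hom fin by (simp add: F)
    also have "(\<integral>\<^sup>+\<sigma>. F (dilate n r \<sigma>) \<partial>P n)
        = (\<integral>\<^sup>+\<sigma>. ennreal (exp ((1 - r powr (- p)) * W n \<sigma> / p) / r ^ n) * F \<sigma> \<partial>P n)"
      by (rule nn_integral_dilate[OF r0]) measurable
    also have "\<dots> \<le> (\<integral>\<^sup>+\<sigma>. ennreal c * (ennreal (exp (a * (\<Sum>i<n. \<sigma> i))) + ennreal (exp ((- a) * (\<Sum>i<n. \<sigma> i)))) \<partial>P n)"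
      by (intro nn_integral_mono pt)
    also have "\<dots> = ennreal c * (ennreal (mgf a ^ n) + ennreal (mgf (- a) ^ n))"
      by (subst nn_integral_cmult, measurable) (subst nn_integral_add, measurable, simp only: nn_exp_sum)
    \<comment> \<open>The 4 is a factor 2 from \<open>concentration\<close> times a factor 2 from
      the two signs of the sum, which contribute equally because \<open>mgf\<close> is even.\<close>
    also have "2 * \<dots> = ennreal (4 * c * mgf a ^ n)"
    proof -
      define q where "q = mgf a ^ n"
      have q: "0 \<le> q" using mgf_pos[of a] by (simp add: q_def)
      have "2 * (ennreal c * (ennreal q + ennreal q)) = ennreal 2 * (ennreal c * ennreal (q + q))"
        by (simp only: ennreal_plus[OF q q] ennreal_numeral)
      also have "\<dots> = ennreal (2 * (c * (q + q)))"
        by (simp only: ennreal_mult'[OF c] ennreal_mult'[of 2] zero_le_numeral)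
      also have "2 * (c * (q + q)) = 4 * c * q" by simp
      finally show ?thesis by (simp only: mgf_even q_def)
    qed
    finally have fle: "(\<integral>\<^sup>+\<sigma>. f \<sigma> \<partial>P n) \<le> ennreal (4 * c * mgf a ^ n)" by (simp add: mult_left_mono)
    have "(\<integral>\<^sup>+\<sigma>. ennreal (exp (real n * \<beta> * (mag n \<sigma>)\<^sup>2 / 2)) * f \<sigma> \<partial>P n)
        \<le> (\<integral>\<^sup>+\<sigma>. ennreal (exp (real n * (\<beta> * (x + d)\<^sup>2 / 2))) * f \<sigma> \<partial>P n)"
    proof (rule nn_integral_mono)
      fix \<sigma>
      have "(mag n \<sigma>)\<^sup>2 \<le> (x + d)\<^sup>2" if "\<bar>\<bar>mag n \<sigma>\<bar> - x\<bar> \<le> d"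
      proof -
        have "\<bar>mag n \<sigma>\<bar> \<le> x + d" using that by linarith
        from power_mono[OF this, of 2] show ?thesis by simp
      qed
      then have "exp (real n * \<beta> * (mag n \<sigma>)\<^sup>2 / 2) \<le> exp (real n * (\<beta> * (x + d)\<^sup>2 / 2))" if "\<bar>\<bar>mag n \<sigma>\<bar> - x\<bar> \<le> d"
        using that b by (simp add: mult.assoc mult_left_mono)
      then show "ennreal (exp (real n * \<beta> * (mag n \<sigma>)\<^sup>2 / 2)) * f \<sigma> \<le> ennreal (exp (real n * (\<beta> * (x + d)\<^sup>2 / 2))) * f \<sigma>"
        by (auto simp: f_def indicator_def intro!: ennreal_leI)
    qed
    also have "\<dots> = ennreal (exp (real n * (\<beta> * (x + d)\<^sup>2 / 2))) * (\<integral>\<^sup>+\<sigma>. f \<sigma> \<partial>P n)"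
      by (rule nn_integral_cmult) measurable
    also have "\<dots> \<le> ennreal (exp (real n * (\<beta> * (x + d)\<^sup>2 / 2))) * ennreal (4 * c * mgf a ^ n)"
      by (intro mult_left_mono fle) simp
    also have "\<dots> = ennreal (exp (real n * (\<beta> * (x + d)\<^sup>2 / 2)) * (4 * c * mgf a ^ n))"
      by (rule ennreal_mult'[symmetric]) simp
    also have "\<dots> \<le> ennreal (4 * exp (real n * (G \<beta> x + 4 * \<beta> * d)))"
    proof (rule ennreal_leI)
      have rn: "r ^ n = exp (real n * ((1 / p) * ln (1 + \<beta> * x\<^sup>2)))"
        using bx r0 by (simp add: r_def powr_def exp_of_nat_mult[symmetric])
      have mn: "mgf a ^ n = exp (real n * psi p a)" by (simp add: exp_of_nat_mult exp_psi)
      define E where "E = \<beta> * (x + d)\<^sup>2 / 2 + \<beta> * x\<^sup>2 * (1 + d) / p - (1 / p) * ln (1 + \<beta> * x\<^sup>2) - \<beta> * x * (x - d) * (1 - d) + psi p a"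
      have "exp (real n * (\<beta> * (x + d)\<^sup>2 / 2)) * (4 * c * mgf a ^ n) = 4 * exp (real n * E)"
      proof -
        have gen: "exp b0 * (4 * (exp b1 / exp b2 * exp (- b3)) * exp b4) = 4 * exp (b0 + b1 - b2 - b3 + b4)" for b0 b1 b2 b3 b4 :: real
          by (simp add: exp_add exp_diff exp_minus divide_inverse)
        show ?thesis
          unfolding c_def rn mn E_def gen by (simp only: ring_distribs)
      qed
      also have "\<dots> \<le> 4 * exp (real n * (G \<beta> x + 4 * \<beta> * d))"
      proof -
        \<comment> \<open>At \<open>d = 0\<close> the quadratic terms are
          \<open>\<beta> * x^2 * (1/2 + 1/p - 1)\<close>, the last term of \<open>G\<close>;
          everything left over is of order \<open>d\<close>.\<close>
        have "E = G \<beta> x + \<beta> * (x\<^sup>2 * d / p + (x * d + d\<^sup>2 / 2) + (x * d + x\<^sup>2 * d - x * d\<^sup>2))"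
          unfolding E_def G_def a_def r_def by (simp add: field_simps power2_eq_square)
        also have "\<dots> \<le> G \<beta> x + \<beta> * (4 * d)"
        proof (intro add_left_mono mult_left_mono b)
          have x2: "x\<^sup>2 \<le> 1" using x by (simp add: power_le_one)
          have "x\<^sup>2 * d \<le> 1 * d" "x * d \<le> 1 * d" "d\<^sup>2 \<le> d" "0 \<le> x * d\<^sup>2"
            using x2 x d by (auto intro!: mult_right_mono simp: power2_eq_square mult_left_le)
          moreover have "x\<^sup>2 * d / p \<le> 1 * d / 2"
            using x2 x d p_ge_2 by (intro frac_le mult_right_mono) auto
          ultimately show "x\<^sup>2 * d / p + (x * d + d\<^sup>2 / 2) + (x * d + x\<^sup>2 * d - x * d\<^sup>2) \<le> 4 * d"
            by linarith
        qed
        also have "\<beta> * (4 * d) = 4 * \<beta> * d" by simp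
        finally have "real n * E \<le> real n * (G \<beta> x + 4 * \<beta> * d)" by (rule mult_left_mono) simp
        then show ?thesis by simp
      qed
      finally show "exp (real n * (\<beta> * (x + d)\<^sup>2 / 2)) * (4 * c * mgf a ^ n) \<le> 4 * exp (real n * (G \<beta> x + 4 * \<beta> * d))" .
    qed
    finally show "(\<integral>\<^sup>+\<sigma>. ennreal (exp (real n * \<beta> * (mag n \<sigma>)\<^sup>2 / 2)) * indicator {\<sigma>. \<bar>\<bar>mag n \<sigma>\<bar> - x\<bar> \<le> d} \<sigma> \<partial>P n)
       \<le> ennreal (4 * exp (real n * (G \<beta> x + 4 * \<beta> * d)))"
      unfolding f_def .
  qed
qed

subsection \<open>The limiting free energy\<close>

text \<open>A Laplace-type bound: finitely many cells cover \<open>C\<close>. Half of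
  \<open>\<eta>\<close> pays for the error within a cell, the other half for the number of
  cells.\<close>

lemma upper_compact:
  assumes b: "0 \<le> \<beta>" and C: "compact C" "C \<subseteq> {0..1}" and g: "\<And>x. x \<in> C \<Longrightarrow> G \<beta> x \<le> g" and eta: "0 < \<eta>"
  shows "\<forall>\<^sub>F n in sequentially.
    (\<integral>\<^sup>+\<sigma>. ennreal (exp (real n * \<beta> * (mag n \<sigma>)\<^sup>2 / 2)) * indicator {\<sigma>. \<bar>mag n \<sigma>\<bar> \<in> C} \<sigma> \<partial>P n)
     \<le> ennreal (exp (real n * (g + \<eta>)))"
proof -
  \<comment> \<open>Makes the cell error \<open>4 * \<beta> * d\<close> at most
    \<open>\<eta> / 2\<close>; the \<open>+ 1\<close> covers \<open>\<beta> = 0\<close>.\<close>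
  define d where "d = min (1 / 2) (\<eta> / (8 * (\<beta> + 1)))"
  have d: "0 < d" "d < 1" using b eta by (auto simp: d_def)
  have "4 * \<beta> * d \<le> 4 * (\<beta> + 1) * d" using d by simp
  also have "\<dots> \<le> 4 * (\<beta> + 1) * (\<eta> / (8 * (\<beta> + 1)))"
    using b by (intro mult_left_mono) (auto simp: d_def)
  also have "\<dots> = \<eta> / 2" using b by (simp add: divide_simps)
  finally have bd: "4 * \<beta> * d \<le> \<eta> / 2" .
  obtain F where F: "finite F" "F \<subseteq> C" "C \<subseteq> (\<Union>x\<in>F. ball x d)"
    using seq_compact_imp_totally_bounded[of C] C(1) d(1) by (metis compact_imp_seq_compact)
  have "filterlim (\<lambda>n. exp (\<eta> / 2 * real n)) at_top sequentially"
    using eta by (intro filterlim_compose[OF exp_at_top]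
        filterlim_tendsto_pos_mult_at_top[OF tendsto_const _ filterlim_real_sequentially]) auto
  then have "\<forall>\<^sub>F n in sequentially. real (card F) * 4 \<le> exp (\<eta> / 2 * real n)"
    by (simp add: filterlim_at_top)
  with cell_upper[OF b d] show ?thesis
  proof eventually_elim
    case (elim n)
    let ?w = "\<lambda>\<sigma>. ennreal (exp (real n * \<beta> * (mag n \<sigma>)\<^sup>2 / 2))"
    have "(\<integral>\<^sup>+\<sigma>. ?w \<sigma> * indicator {\<sigma>. \<bar>mag n \<sigma>\<bar> \<in> C} \<sigma> \<partial>P n)
        \<le> (\<integral>\<^sup>+\<sigma>. (\<Sum>x\<in>F. ?w \<sigma> * indicator {\<sigma>. \<bar>\<bar>mag n \<sigma>\<bar> - x\<bar> \<le> d} \<sigma>) \<partial>P n)"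
    proof (rule nn_integral_mono)
      fix \<sigma>
      show "?w \<sigma> * indicator {\<sigma>. \<bar>mag n \<sigma>\<bar> \<in> C} \<sigma> \<le> (\<Sum>x\<in>F. ?w \<sigma> * indicator {\<sigma>. \<bar>\<bar>mag n \<sigma>\<bar> - x\<bar> \<le> d} \<sigma>)"
      proof (cases "\<bar>mag n \<sigma>\<bar> \<in> C")
        case True
        then obtain x where x: "x \<in> F" "\<bar>mag n \<sigma>\<bar> \<in> ball x d" using F by auto
        then have "\<bar>\<bar>mag n \<sigma>\<bar> - x\<bar> \<le> d" by (auto simp: dist_real_def)
        then have "?w \<sigma> * indicator {\<sigma>. \<bar>mag n \<sigma>\<bar> \<in> C} \<sigma> = ?w \<sigma> * indicator {\<sigma>. \<bar>\<bar>mag n \<sigma>\<bar> - x\<bar> \<le> d} \<sigma>"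
          using True by simp
        also have "\<dots> \<le> (\<Sum>x\<in>F. ?w \<sigma> * indicator {\<sigma>. \<bar>\<bar>mag n \<sigma>\<bar> - x\<bar> \<le> d} \<sigma>)"
          using F(1) x(1) by (intro member_le_sum) auto
        finally show ?thesis .
      qed simp
    qed
    also have "\<dots> = (\<Sum>x\<in>F. \<integral>\<^sup>+\<sigma>. ?w \<sigma> * indicator {\<sigma>. \<bar>\<bar>mag n \<sigma>\<bar> - x\<bar> \<le> d} \<sigma> \<partial>P n)"
      by (rule nn_integral_sum) measurable
    also have "\<dots> \<le> (\<Sum>x\<in>F. ennreal (4 * exp (real n * (g + \<eta> / 2))))"
    proof (rule sum_mono)
      fix x assume "x \<in> F"
      then have x: "x \<in> C" "x \<in> {0..1}" using F C by auto
      have "(\<integral>\<^sup>+\<sigma>. ?w \<sigma> * indicator {\<sigma>. \<bar>\<bar>mag n \<sigma>\<bar> - x\<bar> \<le> d} \<sigma> \<partial>P n) \<le> ennreal (4 * exp (real n * (G \<beta> x + 4 * \<beta> * d)))"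
        using elim(1) x(2) by blast
      also have "\<dots> \<le> ennreal (4 * exp (real n * (g + \<eta> / 2)))"
        using g[OF x(1)] bd by (intro ennreal_leI) (simp add: mult_left_mono)
      finally show "(\<integral>\<^sup>+\<sigma>. ?w \<sigma> * indicator {\<sigma>. \<bar>\<bar>mag n \<sigma>\<bar> - x\<bar> \<le> d} \<sigma> \<partial>P n) \<le> ennreal (4 * exp (real n * (g + \<eta> / 2)))" .
    qed
    also have "\<dots> = ennreal (real (card F) * (4 * exp (real n * (g + \<eta> / 2))))"
      by (subst sum_ennreal) auto
    also have "\<dots> \<le> ennreal (exp (real n * (g + \<eta>)))"
    proof (rule ennreal_leI)
      have "(real (card F) * 4) * exp (real n * (g + \<eta> / 2)) \<le> exp (\<eta> / 2 * real n) * exp (real n * (g + \<eta> / 2))"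
        by (intro mult_right_mono elim) simp
      also have "\<dots> = exp (real n * (g + \<eta>))"
        by (simp add: exp_add[symmetric] algebra_simps)
      finally show "real (card F) * (4 * exp (real n * (g + \<eta> / 2))) \<le> exp (real n * (g + \<eta>))" by simp
    qed
    finally show ?case .
  qed
qed

text \<open>Abstract in the value set \<open>X\<close> so that one argument serves both formulas:
  all of \<open>X\<close> must lie below the finite-size free energies, and \<open>X\<close> must
  contain the values of \<open>G\<close>. The case \<open>n = 1\<close> already bounds
  \<open>X\<close>.\<close>

lemma free_energy_limit:
  assumes b: "0 \<le> \<beta>" and lower: "\<And>v n. v \<in> X \<Longrightarrow> 0 < n \<Longrightarrow> v \<le> ln (A n \<beta>) / real n"
    and G: "\<And>x. x \<in> {0..1} \<Longrightarrow> G \<beta> x \<in> X"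
  shows "(\<lambda>n. ln (A n \<beta>) / real n) \<longlonglongrightarrow> Sup X" "bdd_above X"
proof -
  show bdd: "bdd_above X" using lower[of _ 1] by (intro bdd_aboveI) auto
  have ne: "X \<noteq> {}" using G[of 0] by auto
  show "(\<lambda>n. ln (A n \<beta>) / real n) \<longlonglongrightarrow> Sup X"
  proof (rule order_tendstoI)
    fix y assume "y < Sup X"
    then obtain v where v: "v \<in> X" "y < v" using less_cSup_iff[OF ne bdd] by auto
    show "\<forall>\<^sub>F n in sequentially. y < ln (A n \<beta>) / real n"
    proof (rule eventually_mono[OF eventually_gt_at_top[of "0::nat"]])
      fix n :: nat assume "0 < n"
      from lower[OF v(1) this] v(2) show "y < ln (A n \<beta>) / real n" by linarith
    qed
  next
    fix y assume y: "Sup X < y"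
    define \<eta> where "\<eta> = (y - Sup X) / 2"
    have eta: "0 < \<eta>" using y by (simp add: \<eta>_def)
    have "\<forall>\<^sub>F n in sequentially. (\<integral>\<^sup>+\<sigma>. ennreal (exp (real n * \<beta> * (mag n \<sigma>)\<^sup>2 / 2)) * indicator {\<sigma>. \<bar>mag n \<sigma>\<bar> \<in> {0..1}} \<sigma> \<partial>P n)
     \<le> ennreal (exp (real n * (Sup X + \<eta>)))"
      by (intro upper_compact b eta cSup_upper G bdd) auto
    with eventually_gt_at_top[of "0::nat"]
    show "\<forall>\<^sub>F n in sequentially. ln (A n \<beta>) / real n < y"
    proof eventually_elim
      case (elim n)
      have "ennreal (A n \<beta>) \<le> ennreal (exp (real n * (Sup X + \<eta>)))"
        using elim(2) abs_mag_le_1 by (simp add: nn_A[OF b] indicator_def)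
      then have "A n \<beta> \<le> exp (real n * (Sup X + \<eta>))" by (subst (asm) ennreal_le_iff) auto
      then have "ln (A n \<beta>) \<le> ln (exp (real n * (Sup X + \<eta>)))"
        using A_ge_1[OF b, of n] by (intro ln_mono) auto
      then have "ln (A n \<beta>) / real n \<le> Sup X + \<eta>" using elim(1) by (simp add: divide_le_eq mult.commute)
      also have "\<dots> < y" using y by (simp add: \<eta>_def field_simps)
      finally show ?case .
    qed
  qed
qed

subsection \<open>The two variational formulas\<close>

text \<open>Young's inequality for \<open>y^2\<close> and \<open>w^2\<close> with conjugate
  exponents \<open>p / 2\<close> and \<open>p / (p - 2)\<close>. At \<open>p = 2\<close> the second
  exponent is infinite: the last term vanishes, and the constraint \<open>w \<le> 1\<close> takes
  its place.\<close>

lemma young: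
  assumes w: "0 \<le> w" "p = 2 \<longrightarrow> w \<le> 1" and y: "0 \<le> y"
  shows "(w * y)\<^sup>2 / 2 \<le> y powr p / p + (p - 2) / (2 * p) * w powr (2 * p / (p - 2))"
proof (cases "p = 2")
  case True
  have "w\<^sup>2 \<le> 1" using w True by (simp add: power_le_one)
  then have "w\<^sup>2 * y\<^sup>2 \<le> 1 * y\<^sup>2" by (intro mult_right_mono) auto
  then show ?thesis using True y by (simp add: power_mult_distrib)
next
  case False
  then have p: "2 < p" using p_ge_2 by simp
  have "y\<^sup>2 * w\<^sup>2 \<le> (y\<^sup>2) powr (p / 2) / (p / 2) + (w\<^sup>2) powr (p / (p - 2)) / (p / (p - 2))"
    using p by (intro Youngs_inequality) (auto simp: field_simps)
  moreover have "(y\<^sup>2) powr (p / 2) = y powr p" "(w\<^sup>2) powr (p / (p - 2)) = w powr (2 * p / (p - 2))"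
    using y w by (simp_all add: powr_powr flip: powr_numeral)
  ultimately have "(w * y)\<^sup>2 \<le> y powr p / (p / 2) + w powr (2 * p / (p - 2)) / (p / (p - 2))"
    by (simp add: power_mult_distrib mult.commute)
  then show ?thesis by (simp add: field_simps)
qed

lemma sqrt_mult_self_sq: "0 \<le> \<beta> \<Longrightarrow> 0 \<le> x \<Longrightarrow> sqrt \<beta> * sqrt (\<beta> * x\<^sup>2) = \<beta> * x"
  by (simp add: real_sqrt_mult mult.assoc[symmetric])

lemma limit_var_formula1:
  assumes b: "0 \<le> \<beta>"
  shows "(\<lambda>n. ln (A n \<beta>) / real n) \<longlonglongrightarrow> var_formula1 p \<beta>" "x \<in> {0..1} \<Longrightarrow> G \<beta> x \<le> var_formula1 p \<beta>"
proof -
  define X where "X = (\<lambda>zw. case zw of (z, w) \<Rightarrow>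
          psi p (sqrt \<beta> * (z * w) / (1 + z powr p) powr (1/p))
          - (1/p) * ln (1 + z powr p)
          - (p - 2) / (2 * p) * w powr (2 * p / (p - 2))) ` {(z, w). z \<ge> 0 \<and> w \<ge> 0 \<and> (p = 2 \<longrightarrow> w \<le> 1)}"
  have v: "var_formula1 p \<beta> = Sup X" by (simp add: var_formula1_def X_def)
  have lower: "v \<le> ln (A n \<beta>) / real n" if vX: "v \<in> X" and n: "0 < n" for v n
  proof -
    obtain z w where zw: "0 \<le> z" "0 \<le> w" "p = 2 \<longrightarrow> w \<le> 1" and
      v: "v = psi p (sqrt \<beta> * (z * w) / (1 + z powr p) powr (1/p))
          - (1/p) * ln (1 + z powr p) - (p - 2) / (2 * p) * w powr (2 * p / (p - 2))"
      using vX unfolding X_def by auto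
    \<comment> \<open>With this \<open>u\<close>, \<open>1 - u powr p = 1 / (1 + z powr p)\<close>,
      so the lower bound in \<open>u\<close> and \<open>w\<close> becomes the first functional in
      \<open>z\<close> and \<open>w\<close>.\<close>
    define u where "u = z / (1 + z powr p) powr (1 / p)"
    have pos: "0 < 1 + z powr p" by (simp add: add_pos_nonneg)
    have up: "u powr p = z powr p / (1 + z powr p)"
      using zw pos by (simp add: u_def powr_divide powr_powr)
    have u: "0 \<le> u" using zw by (simp add: u_def)
    have "u < 1"
    proof (rule ccontr)
      assume "\<not> u < 1"
      then have "1 \<le> u powr p" by (simp add: ge_one_powr_ge_zero)
      then show False using pos by (simp add: up)
    qed
    from free_energy_lower[OF b u this n young[OF zw(2,3)]]
    have "psi p (sqrt \<beta> * u * w) + 1 / p * ln (1 - u powr p) - (p - 2) / (2 * p) * w powr (2 * p / (p - 2)) \<le> ln (A n \<beta>) / real n" .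
    moreover have "1 - u powr p = 1 / (1 + z powr p)" using pos by (simp add: up field_simps)
    moreover have "sqrt \<beta> * u * w = sqrt \<beta> * (z * w) / (1 + z powr p) powr (1/p)" by (simp add: u_def)
    ultimately show ?thesis using pos by (simp add: v ln_div)
  qed
  have G: "G \<beta> x \<in> X" if x: "x \<in> {0..1}" for x
  proof (cases "\<beta> * x = 0")
    case True
    then have "G \<beta> x = 0" by (auto simp: G_def psi_0)
    then show ?thesis unfolding X_def by (intro image_eqI[of _ _ "(0, 0)"]) (auto simp: psi_0)
  next
    case False
    define t where "t = \<beta> * x\<^sup>2"
    have t: "0 < t" using False b x by (simp add: t_def)
    \<comment> \<open>Forces \<open>z powr p = \<beta> * x^2\<close> and
      \<open>z * w = sqrt (\<beta> * x^2)\<close>, so \<open>1 + z powr p\<close> is the optimal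
      \<open>r powr p\<close> of the cell at \<open>x\<close>. For \<open>p = 2\<close> this gives
      \<open>w = 1\<close>, which is admissible.\<close>
    define z w where "z = t powr (1 / p)" and "w = t powr ((p - 2) / (2 * p))"
    have zp: "z powr p = t" using t by (simp add: z_def powr_powr)
    have "z * w = t powr (1 / p + (p - 2) / (2 * p))" by (simp add: z_def w_def powr_add)
    also have "1 / p + (p - 2) / (2 * p) = 1 / 2" by (simp add: divide_simps)
    also have "t powr (1 / 2) = sqrt t" using t by (simp add: powr_half_sqrt)
    finally have eq1: "sqrt \<beta> * (z * w) = \<beta> * x" using b x by (simp add: t_def sqrt_mult_self_sq)
    have eq2: "(p - 2) / (2 * p) * w powr (2 * p / (p - 2)) = (p - 2) / (2 * p) * t"
      using t by (cases "p = 2") (simp_all add: w_def powr_powr)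
    have "G \<beta> x = psi p (sqrt \<beta> * (z * w) / (1 + z powr p) powr (1/p))
        - (1/p) * ln (1 + z powr p) - (p - 2) / (2 * p) * w powr (2 * p / (p - 2))"
      unfolding G_def t_def[symmetric] zp eq1 eq2 ..
    moreover have "0 \<le> z" "0 \<le> w" "p = 2 \<longrightarrow> w \<le> 1"
      using t by (auto simp: z_def w_def)
    ultimately show ?thesis unfolding X_def
      by (intro image_eqI[of _ _ "(z, w)"]) (simp_all only: prod.case mem_Collect_eq simp_thms)
  qed
  show "(\<lambda>n. ln (A n \<beta>) / real n) \<longlonglongrightarrow> var_formula1 p \<beta>"
    unfolding v by (rule free_energy_limit[OF b lower G])
  show "G \<beta> x \<le> var_formula1 p \<beta>" if "x \<in> {0..1}"
    unfolding v by (intro cSup_upper G that free_energy_limit(2)[OF b lower G])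
qed

lemma limit_var_formula2:
  assumes b: "0 \<le> \<beta>"
  shows "(\<lambda>n. ln (A n \<beta>) / real n) \<longlonglongrightarrow> var_formula2 p \<beta>"
proof -
  define X where "X = (\<lambda>uv. case uv of (u, v) \<Rightarrow>
          psi p (sqrt (\<beta> * u\<^sup>2 * v powr (p - 2)))
          + (1/p) * ln (1 - u powr p)
          - (p - 2) / (2 * p) * v powr p) ` {(u, v). 0 \<le> u \<and> u < 1 \<and> v \<ge> 0}"
  have v: "var_formula2 p \<beta> = Sup X" by (simp add: var_formula2_def X_def)
  have lower: "v \<le> ln (A n \<beta>) / real n" if vX: "v \<in> X" and n: "0 < n" for v n
  proof -
    obtain u y where uv: "0 \<le> u" "u < 1" "0 \<le> y" and
      v: "v = psi p (sqrt (\<beta> * u\<^sup>2 * y powr (p - 2))) + (1/p) * ln (1 - u powr p) - (p - 2) / (2 * p) * y powr p"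
      using vX unfolding X_def by auto
    \<comment> \<open>Matches the argument of \<open>psi\<close> in both formulas and turns the
      conjugate power of \<open>w\<close> into \<open>y powr p\<close>. For \<open>p = 2\<close> it
      is at most 1 by itself, being 1 or, at \<open>y = 0\<close>, 0.\<close>
    define w where "w = sqrt (y powr (p - 2))"
    have w: "0 \<le> w" "p = 2 \<longrightarrow> w \<le> 1" by (auto simp: w_def powr_def)
    have "w = y powr ((p - 2) / 2)" by (simp add: w_def powr_half_sqrt[symmetric] powr_powr)
    then have "(p - 2) / (2 * p) * w powr (2 * p / (p - 2)) = (p - 2) / (2 * p) * y powr p"
      by (cases "p = 2") (simp_all add: powr_powr)
    moreover have "sqrt \<beta> * u * w = sqrt (\<beta> * u\<^sup>2 * y powr (p - 2))"
      using uv by (simp add: w_def real_sqrt_mult)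
    ultimately show ?thesis
      using free_energy_lower[OF b uv(1,2) n young[OF w]] unfolding v by (simp only:)
  qed
  have G: "G \<beta> x \<in> X" if x: "x \<in> {0..1}" for x
  proof (cases "\<beta> * x = 0")
    case True
    then have "G \<beta> x = 0" by (auto simp: G_def psi_0)
    then show ?thesis unfolding X_def by (intro image_eqI[of _ _ "(0, 0)"]) (auto simp: psi_0)
  next
    case False
    define t where "t = \<beta> * x\<^sup>2"
    have t: "0 < t" using False b x by (simp add: t_def)
    \<comment> \<open>The curve of the first formula in the coordinates of the second:
      \<open>v\<close> is the former \<open>z\<close>, and \<open>u\<close> is
      \<open>z / (1 + z powr p) powr (1 / p)\<close>.\<close>
    define v u where "v = t powr (1 / p)" and "u = v / (1 + t) powr (1 / p)"
    have vp: "v powr p = t" using t by (simp add: v_def powr_powr)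
    have up: "u powr p = t / (1 + t)" using t by (simp add: u_def powr_divide vp) (simp add: powr_powr)
    have "1 - u powr p = 1 / (1 + t)" using t by (simp add: up field_simps)
    then have l: "ln (1 - u powr p) = - ln (1 + t)" using t by (simp add: ln_div)
    have u: "0 \<le> u" by (simp add: u_def v_def)
    have u1: "u < 1"
    proof (rule ccontr)
      assume "\<not> u < 1"
      then have "1 \<le> u powr p" by (simp add: ge_one_powr_ge_zero)
      then show False using t by (simp add: up)
    qed
    have "v\<^sup>2 * v powr (p - 2) = v powr (2 + (p - 2))"
      using t by (subst powr_add) (simp add: v_def)
    then have "v\<^sup>2 * v powr (p - 2) = t" by (simp add: vp)
    then have "\<beta> * u\<^sup>2 * v powr (p - 2) = (\<beta> * t) / ((1 + t) powr (1 / p))\<^sup>2"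
      by (simp add: u_def power_divide)
    also have "\<beta> * t = (\<beta> * x)\<^sup>2" by (simp add: t_def power_mult_distrib power2_eq_square)
    finally have "sqrt (\<beta> * u\<^sup>2 * v powr (p - 2)) = \<beta> * x / (1 + t) powr (1 / p)"
      using b x by (simp add: power_divide[symmetric] del: power_divide)
    then have "G \<beta> x = psi p (sqrt (\<beta> * u\<^sup>2 * v powr (p - 2)))
        + (1/p) * ln (1 - u powr p) - (p - 2) / (2 * p) * v powr p"
      unfolding G_def t_def[symmetric] l vp by simp
    moreover have "0 \<le> v" by (simp add: v_def)
    ultimately show ?thesis unfolding X_def
      using u u1 by (intro image_eqI[of _ _ "(u, v)"]) (simp_all only: prod.case mem_Collect_eq simp_thms)
  qed
  show "(\<lambda>n. ln (A n \<beta>) / real n) \<longlonglongrightarrow> var_formula2 p \<beta>"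
    unfolding v by (rule free_energy_limit[OF b lower G])
qed

lemma var_formulas_eq: "0 \<le> \<beta> \<Longrightarrow> var_formula1 p \<beta> = var_formula2 p \<beta>"
  by (rule LIMSEQ_unique[OF limit_var_formula1(1) limit_var_formula2])

lemma continuous_G: "0 \<le> \<beta> \<Longrightarrow> continuous_on UNIV (G \<beta>)"
proof -
  assume b: "0 \<le> \<beta>"
  have pos: "1 + \<beta> * x\<^sup>2 \<noteq> 0" "0 < 1 + \<beta> * x\<^sup>2" for x
    using b by (auto intro: add_pos_nonneg simp: add_nonneg_eq_0_iff)
  have "continuous_on UNIV (\<lambda>x. psi p (\<beta> * x / (1 + \<beta> * x\<^sup>2) powr (1 / p)))"
    using pos by (intro continuous_on_compose2[OF continuous_psi] continuous_intros) auto
  then show ?thesis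
    unfolding G_def[abs_def] using pos by (intro continuous_intros) auto
qed

lemma G_0: "G \<beta> 0 = 0"
  by (simp add: G_def psi_0)

text \<open>For small \<open>t = \<beta> * x^2\<close> the gain \<open>psi\<close> is about
  \<open>\<kappa> * t / 2\<close> with \<open>\<kappa> = \<beta> / beta_c p\<close>, while the two
  subtracted terms total at most \<open>t / 2\<close>, because
  \<open>1 / p + (p - 2) / (2 * p) = 1 / 2\<close>. So \<open>\<kappa> > 1\<close> wins.\<close>

lemma G_pos:
  assumes "beta_c p < \<beta>"
  shows "\<exists>x\<in>{0..1}. 0 < G \<beta> x"
proof -
  define \<kappa> where "\<kappa> = \<beta> / beta_c p"
  have b: "0 < \<beta>" using assms beta_c_pos by linarith
  have kap: "1 < \<kappa>" using assms beta_c_pos by (simp add: \<kappa>_def)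
  \<comment> \<open>The first bound keeps \<open>x \<le> 1\<close>; the second gives
    \<open>t * (2 + \<kappa>) < 2 * (\<kappa> - 1)\<close>, which is
    \<open>t / 2 < s / (1 + s)\<close> for the \<open>s\<close> below.\<close>
  define t where "t = min \<beta> ((\<kappa> - 1) / (2 + \<kappa>))"
  have t: "0 < t" "t \<le> \<beta>" using b kap by (auto simp: t_def)
  have "t \<le> (\<kappa> - 1) / (2 + \<kappa>)" by (simp add: t_def)
  then have "t * (2 + \<kappa>) \<le> \<kappa> - 1" using kap by (simp only: pos_le_divide_eq)
  also have "\<kappa> - 1 < 2 * (\<kappa> - 1)" using kap by simp
  finally have t2: "t * (2 + \<kappa>) < 2 * (\<kappa> - 1)" .
  define x where "x = sqrt (t / \<beta>)"
  have x: "x \<in> {0..1}" using t b by (auto simp: x_def)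
  have bx: "\<beta> * x\<^sup>2 = t" using t b by (simp add: x_def)
  \<comment> \<open>A lower bound for the squared argument of \<open>psi\<close> over
    \<open>2 * beta_c p\<close>, obtained from
    \<open>(1 + t) powr (2 / p) \<le> 1 + t\<close>.\<close>
  define s where "s = \<kappa> * t / (2 * (1 + t))"
  have s: "0 < s" using t kap by (simp add: s_def)
  have "t / 2 < s / (1 + s)"
  proof -
    have "s / (1 + s) = \<kappa> * t / (2 * (1 + t) + \<kappa> * t)"
      using t kap s by (simp add: s_def divide_simps)
    moreover have "t / 2 * (2 * (1 + t) + \<kappa> * t) < \<kappa> * t"
    proof -
      have "t * (t * (2 + \<kappa>)) < t * (2 * (\<kappa> - 1))" using t t2 by (intro mult_strict_left_mono) auto
      then show ?thesis by (simp add: algebra_simps)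
    qed
    moreover have "0 < 2 * (1 + t) + \<kappa> * t" using t kap by (simp add: add_pos_pos)
    ultimately show ?thesis by (simp add: pos_less_divide_eq)
  qed
  also have "s / (1 + s) \<le> ln (1 + s)"
  proof -
    have "ln (1 / (1 + s)) \<le> 1 / (1 + s) - 1" using s by (intro ln_le_minus_one) auto
    then show ?thesis using s by (simp add: ln_div field_simps)
  qed
  also have "ln (1 + s) \<le> psi p (\<beta> * x / (1 + t) powr (1 / p))"
  proof -
    have "s \<le> (\<beta> * x / (1 + t) powr (1 / p))\<^sup>2 / (2 * beta_c p)"
    proof -
      have "((1 + t) powr (1 / p))\<^sup>2 = (1 + t) powr (2 / p)"
        using t by (simp add: power2_eq_square powr_add[symmetric])
      also have "\<dots> \<le> (1 + t) powr 1" using t p_ge_2 by (intro powr_mono) auto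
      finally have le: "((1 + t) powr (1 / p))\<^sup>2 \<le> 1 + t" using t by simp
      have "s = \<beta> * t / (1 + t) / (2 * beta_c p)" by (simp add: s_def \<kappa>_def)
      also have "\<dots> \<le> \<beta> * t / ((1 + t) powr (1 / p))\<^sup>2 / (2 * beta_c p)"
        using le t b beta_c_pos by (intro divide_right_mono divide_left_mono) auto
      also have "\<beta> * t = (\<beta> * x)\<^sup>2" using bx by (simp add: power_mult_distrib power2_eq_square[of \<beta>])
      finally show ?thesis by (simp add: power_divide)
    qed
    then have "ln (1 + s) \<le> ln (1 + (\<beta> * x / (1 + t) powr (1 / p))\<^sup>2 / (2 * beta_c p))"
      using s by (intro ln_mono) auto
    also have "\<dots> \<le> psi p (\<beta> * x / (1 + t) powr (1 / p))" by (rule psi_ge)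
    finally show ?thesis .
  qed
  finally have "t / 2 < psi p (\<beta> * x / (1 + t) powr (1 / p))" .
  moreover have "1 / p * ln (1 + t) \<le> 1 / p * t"
    using t by (intro mult_left_mono ln_add_one_self_le_self) auto
  moreover have "t / 2 = 1 / p * t + (p - 2) / (2 * p) * t" by (simp add: field_simps)
  ultimately have "0 < G \<beta> x" by (simp add: G_def bx)
  then show ?thesis using x by blast
qed

end

section \<open>Elementary inequalities for the fluctuation estimates\<close>

lemma abs_mult_le_amgm:
  fixes a b t :: real
  assumes "0 < t"
  shows "\<bar>a\<bar> * \<bar>b\<bar> \<le> 1 / (2 * t) * a\<^sup>2 + t / 2 * b\<^sup>2"
proof -
  have "0 \<le> (\<bar>a\<bar> - t * \<bar>b\<bar>)\<^sup>2" by simp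
  then have "2 * t * (\<bar>a\<bar> * \<bar>b\<bar>) \<le> a\<^sup>2 + t\<^sup>2 * b\<^sup>2"
    by (simp add: power2_diff power_mult_distrib mult_ac)
  then have "\<bar>a\<bar> * \<bar>b\<bar> \<le> (a\<^sup>2 + t\<^sup>2 * b\<^sup>2) / (2 * t)" using assms by (simp add: pos_le_divide_eq mult_ac)
  also have "\<dots> = 1 / (2 * t) * a\<^sup>2 + t / 2 * b\<^sup>2" using assms by (simp add: add_divide_distrib power2_eq_square)
  finally show ?thesis .
qed

text \<open>Both powers lie on the same side of 1, the one with the larger exponent farther out. It
  passes from the deviation of \<open>R powr p\<close>, which is an average of independent terms, to
  those of \<open>R\<close> and \<open>R^2\<close>.\<close>

lemma powr_dist_one_mono:
  assumes "0 \<le> (R::real)" "0 < s" "s \<le> t"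
  shows "\<bar>R powr s - 1\<bar> \<le> \<bar>R powr t - 1\<bar>"
proof (cases "1 \<le> R")
  case True
  then have "1 \<le> R powr s" "R powr s \<le> R powr t" using assms by (auto simp: ge_one_powr_ge_zero intro!: powr_mono)
  then show ?thesis by simp
next
  case False
  then have "R powr t \<le> R powr s" "R powr s \<le> 1" using assms powr_le1 by (auto intro!: powr_mono' powr_le1)
  then show ?thesis by simp
qed

text \<open>Truncating the unbounded weight at \<open>\<bar>y\<bar> \<le> K\<close> costs little, because the weight stays
  integrable for a slightly larger inverse temperature.\<close>

lemma truncation_error:
  fixes y K :: real
  assumes "0 \<le> \<beta>" "\<beta> \<le> \<gamma>" "0 \<le> K"
  shows "\<bar>exp (\<beta> * y\<^sup>2 / 2) - exp (\<beta> * (min \<bar>y\<bar> K)\<^sup>2 / 2)\<bar> \<le> exp (- ((\<gamma> - \<beta>) * K\<^sup>2 / 2)) * exp (\<gamma> * y\<^sup>2 / 2)"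
proof (cases "\<bar>y\<bar> \<le> K")
  case False
  then have y: "K\<^sup>2 \<le> y\<^sup>2" using assms by (metis abs_le_square_iff abs_of_nonneg linear)
  have m: "min \<bar>y\<bar> K = K" using False by simp
  have "\<bar>exp (\<beta> * y\<^sup>2 / 2) - exp (\<beta> * K\<^sup>2 / 2)\<bar> \<le> exp (\<beta> * y\<^sup>2 / 2)"
    using y assms by (simp add: mult_left_mono)
  also have "\<dots> \<le> exp (- ((\<gamma> - \<beta>) * K\<^sup>2 / 2)) * exp (\<gamma> * y\<^sup>2 / 2)"
  proof -
    have "(\<gamma> - \<beta>) / 2 * K\<^sup>2 \<le> (\<gamma> - \<beta>) / 2 * y\<^sup>2"
      using y assms by (intro mult_left_mono) auto
    then have "\<beta> * y\<^sup>2 / 2 \<le> - ((\<gamma> - \<beta>) * K\<^sup>2 / 2) + \<gamma> * y\<^sup>2 / 2"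
      by (simp add: left_diff_distrib diff_divide_distrib)
    then show ?thesis by (simp add: exp_add[symmetric])
  qed
  finally show ?thesis unfolding m .
qed simp

subsection \<open>Gaussian identities\<close>

lemma normal_density_precision:
  "0 < a \<Longrightarrow> normal_density 0 (sqrt (1 / a)) y = sqrt (a / (2 * pi)) * exp (- (a * y\<^sup>2 / 2))"
proof -
  assume a: "0 < a"
  then have 1: "(sqrt (1 / a))\<^sup>2 = 1 / a" by simp
  have 2: "1 / sqrt (2 * pi * (1 / a)) = sqrt (a / (2 * pi))"
    using a by (simp add: real_sqrt_divide)
  show ?thesis
    unfolding normal_density_def 1 2 using a by (simp add: mult.commute)
qed

text \<open>In terms of precision a quadratic tilt is a subtraction. With
  \<open>a = beta_c p\<close> and \<open>b = \<beta>\<close> this is the origin of the limiting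
  variance \<open>1 / (beta_c p - \<beta>)\<close>.\<close>

lemma normal_density_tilt:
  assumes "0 < a" "b < a"
  shows "normal_density 0 (sqrt (1 / a)) y * exp (b * y\<^sup>2 / 2)
    = sqrt (a / (a - b)) * normal_density 0 (sqrt (1 / (a - b))) y"
proof -
  have "sqrt (a / (2 * pi)) = sqrt (a / (a - b)) * sqrt ((a - b) / (2 * pi))"
    using assms by (simp add: real_sqrt_mult[symmetric])
  moreover have "exp (- (a * y\<^sup>2 / 2)) * exp (b * y\<^sup>2 / 2) = exp (- ((a - b) * y\<^sup>2 / 2))"
    by (simp add: exp_add[symmetric] algebra_simps diff_divide_distrib)
  ultimately show ?thesis
    using assms by (simp add: normal_density_precision)
qed

lemma std_normal_exp:
  "std_normal_density g * exp (b * g) = exp (b\<^sup>2 / 2) * normal_density b 1 g"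
proof -
  have "exp (- g\<^sup>2 / 2) * exp (b * g) = exp (b\<^sup>2 / 2) * exp (- (g - b)\<^sup>2 / 2)"
    by (simp add: exp_add[symmetric] power2_diff add_divide_distrib diff_divide_distrib)
  then show ?thesis by (simp add: normal_density_def)
qed

lemma nn_integral_normal_density: "0 < s \<Longrightarrow> (\<integral>\<^sup>+y. ennreal (normal_density m s y) \<partial>lborel) = 1"
  by (subst nn_integral_eq_integral) auto

text \<open>The Hubbard-Stratonovich identity: a Gaussian average makes the exponent linear in the
  sum, and the product measure then factorises.\<close>

lemma exp_square_linearize:
  assumes "0 \<le> c"
  shows "ennreal (exp (c * s\<^sup>2 / 2)) = (\<integral>\<^sup>+g. ennreal (std_normal_density g) * ennreal (exp (sqrt c * g * s)) \<partial>lborel)"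
proof -
  have "(\<integral>\<^sup>+g. ennreal (std_normal_density g) * ennreal (exp (sqrt c * g * s)) \<partial>lborel)
     = (\<integral>\<^sup>+g. ennreal (exp (c * s\<^sup>2 / 2)) * ennreal (normal_density (sqrt c * s) 1 g) \<partial>lborel)"
  proof (rule nn_integral_cong)
    fix g
    have "std_normal_density g * exp (sqrt c * g * s) = exp (c * s\<^sup>2 / 2) * normal_density (sqrt c * s) 1 g"
      using std_normal_exp[of g "sqrt c * s"] assms by (simp add: power_mult_distrib mult_ac)
    then show "ennreal (std_normal_density g) * ennreal (exp (sqrt c * g * s)) = ennreal (exp (c * s\<^sup>2 / 2)) * ennreal (normal_density (sqrt c * s) 1 g)"
      by (simp add: ennreal_mult[symmetric])
  qed
  also have "\<dots> = ennreal (exp (c * s\<^sup>2 / 2))"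
    by (subst nn_integral_cmult) (auto simp: nn_integral_normal_density)
  finally show ?thesis by simp
qed

context lp_density
begin

subsection \<open>Laws of large numbers under the product measure\<close>

lemma rho_prob_UNIV [simp]: "measure (rho_measure p) UNIV = 1"
  using rho.prob_space by simp

lemma product_pair:
  fixes f :: "real \<Rightarrow> real"
  assumes f: "integrable (rho_measure p) f" "integrable (rho_measure p) (\<lambda>y. (f y)\<^sup>2)" "(\<integral>y. f y \<partial>rho_measure p) = 0"
    and ij: "i < n" "j < n"
  shows "integrable (P n) (\<lambda>x. f (x i) * f (x j))"
    and "(\<integral>x. f (x i) * f (x j) \<partial>P n) = (if i = j then \<integral>y. (f y)\<^sup>2 \<partial>rho_measure p else 0)"
proof -
  \<comment> \<open>Writes the pair as a product over all coordinates; for \<open>i = j\<close> the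
    two factors fall on the same coordinate and give the square.\<close>
  define g where "g k y = (if k = i then f y else 1) * (if k = j then f y else 1)" for k :: nat and y
  have gi: "integrable (rho_measure p) (g k)" for k
    unfolding g_def[abs_def] using f by (cases "k = i"; cases "k = j") (auto simp: power2_eq_square)
  have eq: "f (x i) * f (x j) = (\<Prod>k<n. g k (x k))" for x
    using ij by (simp add: g_def prod.distrib prod.delta)
  show "integrable (P n) (\<lambda>x. f (x i) * f (x j))"
    unfolding eq P_def by (intro pr.product_integrable_prod gi) auto
  have "(\<integral>x. f (x i) * f (x j) \<partial>P n) = (\<Prod>k<n. \<integral>y. g k y \<partial>rho_measure p)"
    unfolding eq P_def by (intro pr.product_integral_prod gi) auto
  also have "\<dots> = (if i = j then \<integral>y. (f y)\<^sup>2 \<partial>rho_measure p else 0)"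
  proof (cases "i = j")
    case True
    have "(\<integral>y. g k y \<partial>rho_measure p) = (if k = i then \<integral>y. (f y)\<^sup>2 \<partial>rho_measure p else 1)" for k
      using True by (auto simp: g_def power2_eq_square rho.prob_space)
    then show ?thesis using True ij by (simp add: prod.delta)
  next
    case False
    then have "(\<integral>y. g i y \<partial>rho_measure p) = 0" using f(3) by (simp add: g_def)
    then show ?thesis using False ij by (auto intro!: prod_zero bexI[of _ i])
  qed
  finally show "(\<integral>x. f (x i) * f (x j) \<partial>P n) = (if i = j then \<integral>y. (f y)\<^sup>2 \<partial>rho_measure p else 0)" .
qed

lemma product_variance:
  fixes f :: "real \<Rightarrow> real"
  assumes f: "integrable (rho_measure p) f" "integrable (rho_measure p) (\<lambda>y. (f y)\<^sup>2)" "(\<integral>y. f y \<partial>rho_measure p) = 0"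
  shows "integrable (P n) (\<lambda>x. (\<Sum>i<n. f (x i))\<^sup>2)"
    and "(\<integral>x. (\<Sum>i<n. f (x i))\<^sup>2 \<partial>P n) = real n * (\<integral>y. (f y)\<^sup>2 \<partial>rho_measure p)"
proof -
  have eq: "(\<Sum>i<n. f (x i))\<^sup>2 = (\<Sum>i<n. \<Sum>j<n. f (x i) * f (x j))" for x
    by (simp add: power2_eq_square sum_product)
  show "integrable (P n) (\<lambda>x. (\<Sum>i<n. f (x i))\<^sup>2)"
    unfolding eq by (intro Bochner_Integration.integrable_sum product_pair(1)[OF f]) auto
  have "(\<integral>x. (\<Sum>i<n. f (x i))\<^sup>2 \<partial>P n) = (\<Sum>i<n. \<integral>x. (\<Sum>j<n. f (x i) * f (x j)) \<partial>P n)"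
    unfolding eq
    by (intro Bochner_Integration.integral_sum Bochner_Integration.integrable_sum product_pair(1)[OF f]) auto
  also have "\<dots> = (\<Sum>i<n. \<Sum>j<n. \<integral>x. f (x i) * f (x j) \<partial>P n)"
    by (intro sum.cong refl Bochner_Integration.integral_sum product_pair(1)[OF f]) auto
  also have "\<dots> = (\<Sum>i<n. \<Sum>j<n. if i = j then \<integral>y. (f y)\<^sup>2 \<partial>rho_measure p else 0)"
    by (intro sum.cong refl product_pair(2)[OF f]) auto
  also have "\<dots> = real n * (\<integral>y. (f y)\<^sup>2 \<partial>rho_measure p)" by simp
  finally show "(\<integral>x. (\<Sum>i<n. f (x i))\<^sup>2 \<partial>P n) = real n * (\<integral>y. (f y)\<^sup>2 \<partial>rho_measure p)" .
qed

text \<open>The inequality of arithmetic and geometric means with parameter \<open>sqrt n\<close>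
  balances the constant 1 against the variance of order \<open>1 / n\<close> of the average; both
  contributions become of order \<open>1 / sqrt n\<close>.\<close>

lemma L1_law:
  fixes f :: "real \<Rightarrow> real"
  assumes f: "integrable (rho_measure p) f" "integrable (rho_measure p) (\<lambda>y. (f y)\<^sup>2)" "(\<integral>y. f y \<partial>rho_measure p) = 0"
    and n: "0 < n"
  shows "integrable (P n) (\<lambda>x. \<bar>(\<Sum>i<n. f (x i)) / real n\<bar>)"
    and "(\<integral>x. \<bar>(\<Sum>i<n. f (x i)) / real n\<bar> \<partial>P n) \<le> (1 + (\<integral>y. (f y)\<^sup>2 \<partial>rho_measure p)) / (2 * sqrt (real n))"
proof -
  let ?S = "\<lambda>x. \<Sum>i<n. f (x i)"
  let ?v = "\<integral>y. (f y)\<^sup>2 \<partial>rho_measure p"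
  have [measurable]: "f \<in> borel_measurable borel"
    using f(1) borel_measurable_integrable by fastforce
  have m: "?S \<in> borel_measurable (P n)"
    unfolding P_def by measurable
  have i: "integrable (P n) (\<lambda>x. 1 / (2 * sqrt (real n)) + sqrt (real n) / 2 * (?S x / real n)\<^sup>2)"
    using product_variance(1)[OF f, of n] by (simp add: power_divide)
  have le: "\<bar>?S x / real n\<bar> \<le> 1 / (2 * sqrt (real n)) + sqrt (real n) / 2 * (?S x / real n)\<^sup>2" for x
    using abs_mult_le_amgm[of "sqrt (real n)" 1 "?S x / real n"] n by simp
  show int: "integrable (P n) (\<lambda>x. \<bar>?S x / real n\<bar>)"
  proof (rule Bochner_Integration.integrable_bound[OF i])
    show "AE x in P n. norm \<bar>?S x / real n\<bar> \<le> norm (1 / (2 * sqrt (real n)) + sqrt (real n) / 2 * (?S x / real n)\<^sup>2)"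
      by (intro AE_I2) (simp only: real_norm_def abs_idempotent, rule order_trans[OF le abs_ge_self])
  qed (use m in measurable)
  have "(\<integral>x. \<bar>?S x / real n\<bar> \<partial>P n) \<le> (\<integral>x. 1 / (2 * sqrt (real n)) + sqrt (real n) / 2 * (?S x / real n)\<^sup>2 \<partial>P n)"
    by (intro integral_mono int i le)
  also have "\<dots> = 1 / (2 * sqrt (real n)) + sqrt (real n) / 2 * (real n * ?v / (real n)\<^sup>2)"
    using product_variance[OF f, of n] by (simp add: power_divide P.prob_space)
  also have "\<dots> = (1 + ?v) / (2 * sqrt (real n))"
  proof -
    have "sqrt (real n) / 2 * (real n * ?v / (real n)\<^sup>2) = ?v / (2 * sqrt (real n))"
      using n by (simp add: power2_eq_square field_simps)
    then show ?thesis by (simp only: add_divide_distrib)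
  qed
  finally show "(\<integral>x. \<bar>?S x / real n\<bar> \<partial>P n) \<le> (1 + ?v) / (2 * sqrt (real n))" .
qed

lemma rho_abs_moment:
  assumes "0 \<le> s"
  shows "integrable (rho_measure p) (\<lambda>y. \<bar>y\<bar> powr s)" "(\<integral>y. \<bar>y\<bar> powr s \<partial>rho_measure p) = mom s"
  using abs_moment[OF assms] by (auto simp: integrable_rho_measure integral_rho_measure has_bochner_integral_iff)

text \<open>\<open>vp\<close> and \<open>v2\<close> are the variances of \<open>|X|^p\<close> and
  \<open>X^2\<close>, the constants in the rates below.\<close>

definition vp :: real where "vp = (\<integral>y. (\<bar>y\<bar> powr p - 1)\<^sup>2 \<partial>rho_measure p)"
definition v2 :: real where "v2 = (\<integral>y. (y\<^sup>2 - 1 / beta_c p)\<^sup>2 \<partial>rho_measure p)"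

lemma centered_p: "integrable (rho_measure p) (\<lambda>y. \<bar>y\<bar> powr p - 1)" "integrable (rho_measure p) (\<lambda>y. (\<bar>y\<bar> powr p - 1)\<^sup>2)"
    "(\<integral>y. \<bar>y\<bar> powr p - 1 \<partial>rho_measure p) = 0"
proof -
  have "(\<bar>y\<bar> powr p - 1)\<^sup>2 = \<bar>y\<bar> powr (2 * p) - 2 * \<bar>y\<bar> powr p + 1" for y :: real
  proof -
    have "(\<bar>y\<bar> powr p)\<^sup>2 = \<bar>y\<bar> powr (2 * p)" by (simp add: power2_eq_square powr_add[symmetric])
    then show ?thesis by (simp add: power2_diff)
  qed
  then show "integrable (rho_measure p) (\<lambda>y. (\<bar>y\<bar> powr p - 1)\<^sup>2)"
    using rho_abs_moment(1)[of p] rho_abs_moment(1)[of "2 * p"] by auto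
  show "integrable (rho_measure p) (\<lambda>y. \<bar>y\<bar> powr p - 1)" using rho_abs_moment(1)[of p] by auto
  show "(\<integral>y. \<bar>y\<bar> powr p - 1 \<partial>rho_measure p) = 0"
    using rho_abs_moment[of p] by (simp add: mom_p rho.prob_space)
qed

lemma integrable_sq: "integrable (rho_measure p) (\<lambda>y. y\<^sup>2)" "(\<integral>y. y\<^sup>2 \<partial>rho_measure p) = 1 / beta_c p"
  using rho_abs_moment[of 2] by (simp_all add: mom_2)

lemma centered_2: "integrable (rho_measure p) (\<lambda>y. y\<^sup>2 - 1 / beta_c p)" "integrable (rho_measure p) (\<lambda>y. (y\<^sup>2 - 1 / beta_c p)\<^sup>2)"
    "(\<integral>y. y\<^sup>2 - 1 / beta_c p \<partial>rho_measure p) = 0"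
proof -
  have "integrable (rho_measure p) (\<lambda>y. y ^ 4)"
    using rho_abs_moment(1)[of 4] by simp
  then have "integrable (rho_measure p) (\<lambda>y. y ^ 4 - 2 * (1 / beta_c p) * y\<^sup>2 + (1 / beta_c p)\<^sup>2)"
    using integrable_sq by auto
  moreover have "y ^ 4 - 2 * (1 / beta_c p) * y\<^sup>2 + (1 / beta_c p)\<^sup>2 = (y\<^sup>2 - 1 / beta_c p)\<^sup>2" for y :: real
    by (simp add: power2_diff power_mult[symmetric])
  ultimately show "integrable (rho_measure p) (\<lambda>y. (y\<^sup>2 - 1 / beta_c p)\<^sup>2)" by simp
  show "integrable (rho_measure p) (\<lambda>y. y\<^sup>2 - 1 / beta_c p)" using integrable_sq by auto
  show "(\<integral>y. y\<^sup>2 - 1 / beta_c p \<partial>rho_measure p) = 0"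
    using integrable_sq by (simp add: rho.prob_space)
qed

lemma W_dev: "0 < n \<Longrightarrow> norm_np n p x powr p - 1 = (\<Sum>i<n. \<bar>x i\<bar> powr p - 1) / real n"
  using norm_np_powr[of n x] by (simp add: W_def sum_subtractf field_simps)

lemma radius_dev:
  assumes n: "0 < n"
  shows "\<bar>norm_np n p x - 1\<bar> \<le> \<bar>(\<Sum>i<n. \<bar>x i\<bar> powr p - 1) / real n\<bar>"
    and "\<bar>(norm_np n p x)\<^sup>2 - 1\<bar> \<le> \<bar>(\<Sum>i<n. \<bar>x i\<bar> powr p - 1) / real n\<bar>"
  using powr_dist_one_mono[of "norm_np n p x" 1 p] powr_dist_one_mono[of "norm_np n p x" 2 p] p_ge_2
  by (simp_all add: W_dev[OF n, symmetric])

text \<open>\<open>ms * R^2\<close> is the plain average of the squares, and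
  \<open>ms \<le> 1\<close>, so replacing \<open>R^2\<close> by 1 costs no more than the deviation
  of the radius.\<close>

lemma ms_dev:
  assumes n: "0 < n"
  shows "\<bar>ms n x - 1 / beta_c p\<bar> \<le> \<bar>(\<Sum>i<n. \<bar>x i\<bar> powr p - 1) / real n\<bar> + \<bar>(\<Sum>i<n. (x i)\<^sup>2 - 1 / beta_c p) / real n\<bar>"
proof -
  let ?R = "norm_np n p x"
  have "ms n x * ?R\<^sup>2 = (\<Sum>i<n. (x i)\<^sup>2) / real n"
  proof (cases "?R = 0")
    case True
    then have "W n x = 0" using norm_np_powr[OF n, of x] by simp
    then have "(\<Sum>i<n. (x i)\<^sup>2) = 0" by (intro sum.neutral) (auto dest: W_eq_0)
    then show ?thesis using True by simp
  next
    case False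
    then show ?thesis by (simp add: ms_def power_divide sum_divide_distrib[symmetric])
  qed
  then have T: "ms n x * ?R\<^sup>2 - 1 / beta_c p = (\<Sum>i<n. (x i)\<^sup>2 - 1 / beta_c p) / real n"
    using n by (simp add: sum_subtractf diff_divide_distrib)
  have "\<bar>ms n x * (?R\<^sup>2 - 1)\<bar> \<le> 1 * \<bar>(\<Sum>i<n. \<bar>x i\<bar> powr p - 1) / real n\<bar>"
    unfolding abs_mult using ms_le_1[of n x] ms_nonneg[of n x] radius_dev(2)[OF n, of x] by (intro mult_mono) auto
  moreover have "ms n x - 1 / beta_c p = (ms n x * ?R\<^sup>2 - 1 / beta_c p) - ms n x * (?R\<^sup>2 - 1)"
    by (simp add: algebra_simps)
  ultimately show ?thesis unfolding T by linarith
qed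

subsection \<open>Uniform boundedness below the critical point\<close>

text \<open>After linearisation the sub-Gaussian bound on \<open>mgf\<close> leaves the integral of
  \<open>exp (\<kappa> * g^2 / 2)\<close> against a standard Gaussian, finite for
  \<open>\<kappa> < 1\<close> and depending on \<open>n\<close> only through
  \<open>\<kappa>\<close>.\<close>

lemma nn_exp_square_le:
  assumes c: "0 \<le> c" and k: "real n * c / beta_c p = \<kappa>" "\<kappa> < 1"
  shows "(\<integral>\<^sup>+x. ennreal (exp (c * (\<Sum>i<n. x i)\<^sup>2 / 2)) \<partial>P n) \<le> ennreal (sqrt (1 / (1 - \<kappa>)))"
proof -
  interpret pair: pair_sigma_finite "P n" lborel by standard
  have "(\<integral>\<^sup>+x. ennreal (exp (c * (\<Sum>i<n. x i)\<^sup>2 / 2)) \<partial>P n)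
      = (\<integral>\<^sup>+x. (\<integral>\<^sup>+g. ennreal (std_normal_density g) * ennreal (exp (sqrt c * g * (\<Sum>i<n. x i))) \<partial>lborel) \<partial>P n)"
    using c by (simp only: exp_square_linearize)
  also have "\<dots> = (\<integral>\<^sup>+g. (\<integral>\<^sup>+x. ennreal (std_normal_density g) * ennreal (exp (sqrt c * g * (\<Sum>i<n. x i))) \<partial>P n) \<partial>lborel)"
    by (rule pair.Fubini'[symmetric]) measurable
  also have "\<dots> = (\<integral>\<^sup>+g. ennreal (std_normal_density g) * ennreal (mgf (sqrt c * g) ^ n) \<partial>lborel)"
    by (intro nn_integral_cong) (subst nn_integral_cmult, measurable, simp only: nn_exp_sum)
  also have "\<dots> \<le> (\<integral>\<^sup>+g. ennreal (sqrt (1 / (1 - \<kappa>))) * ennreal (normal_density 0 (sqrt (1 / (1 - \<kappa>))) g) \<partial>lborel)"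
  proof (rule nn_integral_mono)
    fix g
    have "mgf (sqrt c * g) ^ n \<le> exp ((sqrt c * g)\<^sup>2 / (2 * beta_c p)) ^ n"
      using mgf_pos[of "sqrt c * g"] by (intro power_mono mgf_le) auto
    also have "\<dots> = exp (\<kappa> * g\<^sup>2 / 2)"
      using c by (simp add: exp_of_nat_mult[symmetric] power_mult_distrib k(1)[symmetric])
    finally have "std_normal_density g * mgf (sqrt c * g) ^ n \<le> std_normal_density g * exp (\<kappa> * g\<^sup>2 / 2)"
      by (intro mult_left_mono) auto
    also have "\<dots> = sqrt (1 / (1 - \<kappa>)) * normal_density 0 (sqrt (1 / (1 - \<kappa>))) g"
      using normal_density_tilt[of 1 \<kappa> g] k(2) by simp
    finally have "ennreal (std_normal_density g * mgf (sqrt c * g) ^ n) \<le> ennreal (sqrt (1 / (1 - \<kappa>)) * normal_density 0 (sqrt (1 / (1 - \<kappa>))) g)"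
      by (rule ennreal_leI)
    then show "ennreal (std_normal_density g) * ennreal (mgf (sqrt c * g) ^ n)
        \<le> ennreal (sqrt (1 / (1 - \<kappa>))) * ennreal (normal_density 0 (sqrt (1 / (1 - \<kappa>))) g)"
      using mgf_pos[of "sqrt c * g"] k(2) by (subst (asm) (1 2) ennreal_mult) auto
  qed
  also have "\<dots> = ennreal (sqrt (1 / (1 - \<kappa>)))"
    using k(2) by (subst nn_integral_cmult) (auto simp: nn_integral_normal_density)
  finally show ?thesis .
qed

text \<open>On the typical shell \<open>R \<ge> 1 - d\<close>, so \<open>mag\<close> may be replaced
  by \<open>S / n\<close> at the price of raising the coupling from \<open>\<beta>\<close> to
  \<open>\<beta> / (1 - d)^2\<close>. The distance to \<open>beta_c p\<close> leaves room for
  this.\<close>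

lemma A_bounded:
  assumes b: "0 \<le> \<beta>" "\<beta> < beta_c p"
  shows "\<exists>B. \<forall>n. A n \<beta> \<le> B"
proof -
  define q where "q = sqrt (\<beta> / beta_c p)"
  have q: "0 \<le> q" "q < 1" "q\<^sup>2 = \<beta> / beta_c p" using b beta_c_pos by (auto simp: q_def)
  \<comment> \<open>Then \<open>1 - d = (1 + q) / 2\<close> lies strictly between \<open>q\<close>
    and 1, whence \<open>\<kappa> < 1\<close>.\<close>
  define d where "d = (1 - q) / 2"
  have d: "0 < d" "d < 1" using q by (auto simp: d_def)
  define \<kappa> where "\<kappa> = q\<^sup>2 / (1 - d)\<^sup>2"
  have "q < 1 - d" using q by (simp add: d_def field_simps)
  then have "q\<^sup>2 < (1 - d)\<^sup>2" using q by (intro power_strict_mono) auto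
  then have k: "\<kappa> < 1" using d by (simp add: \<kappa>_def)
  define C where "C = 2 * sqrt (1 / (1 - \<kappa>))"
  have "\<forall>\<^sub>F n in sequentially. A n \<beta> \<le> C"
    using concentration[OF d] eventually_gt_at_top[of "0::nat"]
  proof eventually_elim
    case (elim n)
    note n = elim(2)
    define c where "c = \<beta> / (real n * (1 - d)\<^sup>2)"
    have c: "0 \<le> c" using b by (simp add: c_def)
    have ck: "real n * c / beta_c p = \<kappa>" using n by (simp add: c_def \<kappa>_def q)
    let ?w = "\<lambda>x. ennreal (exp (real n * \<beta> * (mag n x)\<^sup>2 / 2))"
    have "ennreal (A n \<beta>) = (\<integral>\<^sup>+x. ?w x \<partial>P n)" by (rule nn_A[OF b(1), symmetric])
    also have "\<dots> \<le> 2 * (\<integral>\<^sup>+x. ?w x * indicator {x. \<bar>W n x - real n\<bar> \<le> real n * d} x \<partial>P n)"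
    proof (rule elim(1)[rule_format])
      show "homog n ?w" by (simp add: homog_def mag_dilate)
      show "(\<integral>\<^sup>+x. ?w x \<partial>P n) < \<infinity>" by (simp add: nn_A[OF b(1)])
    qed measurable
    also have "(\<integral>\<^sup>+x. ?w x * indicator {x. \<bar>W n x - real n\<bar> \<le> real n * d} x \<partial>P n)
        \<le> (\<integral>\<^sup>+x. ennreal (exp (c * (\<Sum>i<n. x i)\<^sup>2 / 2)) \<partial>P n)"
    proof (rule nn_integral_mono)
      fix x
      have "?w x \<le> ennreal (exp (c * (\<Sum>i<n. x i)\<^sup>2 / 2))" if "\<bar>W n x - real n\<bar> \<le> real n * d"
      proof -
        have "1 - d \<le> W n x / real n" using that n by (simp add: abs_le_iff pos_le_divide_eq) (simp add: algebra_simps)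
        have "1 - d \<le> norm_np n p x"
        proof -
          have "1 - d = (1 - d) powr 1" using d by simp
          also have "\<dots> \<le> (1 - d) powr (1 / p)" using d p_ge_2 by (intro powr_mono') auto
          also have "\<dots> \<le> norm_np n p x"
            unfolding norm_np_W using d \<open>1 - d \<le> W n x / real n\<close> by (intro powr_mono2) auto
          finally show ?thesis .
        qed
        then have "(1 - d)\<^sup>2 \<le> (norm_np n p x)\<^sup>2" using d by (intro power_mono) auto
        then have "real n * \<beta> * (mag n x)\<^sup>2 * (1 - d)\<^sup>2 \<le> real n * \<beta> * (mag n x)\<^sup>2 * (norm_np n p x)\<^sup>2"
          using b by (intro mult_left_mono) auto
        then have "real n * \<beta> * (mag n x)\<^sup>2 \<le> real n * \<beta> * (mag n x)\<^sup>2 * (norm_np n p x)\<^sup>2 / (1 - d)\<^sup>2"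
          using d by (simp add: pos_le_divide_eq)
        also have "\<dots> = c * (\<Sum>i<n. x i)\<^sup>2"
          unfolding sum_eq_mag[OF n] c_def using n by (simp add: power_mult_distrib power2_eq_square[of "real n"])
        finally show ?thesis by (intro ennreal_leI) simp
      qed
      then show "?w x * indicator {x. \<bar>W n x - real n\<bar> \<le> real n * d} x \<le> ennreal (exp (c * (\<Sum>i<n. x i)\<^sup>2 / 2))"
        by (auto simp: indicator_def)
    qed
    also have "\<dots> \<le> ennreal (sqrt (1 / (1 - \<kappa>)))" by (rule nn_exp_square_le[OF c ck k])
    finally have "ennreal (A n \<beta>) \<le> 2 * ennreal (sqrt (1 / (1 - \<kappa>)))" by (simp add: mult_left_mono)
    also have "\<dots> = ennreal C" by (simp add: C_def ennreal_mult')
    finally show "A n \<beta> \<le> C" using k by (subst (asm) ennreal_le_iff) (auto simp: C_def)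
  qed
  then obtain N where N: "A n \<beta> \<le> C" if "N \<le> n" for n by (auto simp: eventually_sequentially)
  \<comment> \<open>The finitely many \<open>n\<close> below the threshold are covered by the
    trivial bound from \<open>\<bar>mag\<bar> \<le> 1\<close>.\<close>
  have "A n \<beta> \<le> max C (exp (real N * \<beta> / 2))" for n
  proof (cases "N \<le> n")
    case False
    then have "real n * \<beta> / 2 \<le> real N * \<beta> / 2" using b by (intro divide_right_mono mult_right_mono) auto
    then have "exp (real n * \<beta> / 2) \<le> exp (real N * \<beta> / 2)" by simp
    then show ?thesis using A_le[OF b(1), of n] by linarith
  qed (use N in force)
  then show ?thesis by blast
qed

subsection \<open>The central limit theorem for the unnormalised sum\<close>

text \<open>The central limit theorem concerns one sequence on one space, whereas each
  \<open>P n\<close> lives on its own space. The coordinates of the infinite product provide the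
  sequence, and restriction to \<open>{..<n}\<close> carries the laws back.\<close>

lemma weak_conv_sum:
  "weak_conv_m (\<lambda>n. distr (P n) borel (\<lambda>x. (\<Sum>i<n. x i) / sqrt (real n * (1 / beta_c p)))) std_normal_distribution"
proof -
  let ?M = "PiM UNIV (\<lambda>_::nat. rho_measure p)"
  have M: "prob_space ?M" by (rule prob_space_PiM) (rule prob_space_rho)
  have comp: "distr ?M borel (\<lambda>\<omega>. \<omega> i) = rho_measure p" for i
  proof -
    have "distr ?M borel (\<lambda>\<omega>. \<omega> i) = distr ?M (rho_measure p) (\<lambda>\<omega>. \<omega> i)"
      by (rule distr_cong) auto
    then show ?thesis using pr.PiM_component[of i] by simp
  qed
  have [measurable]: "(\<lambda>\<omega>. \<omega> i) \<in> borel_measurable ?M" for i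
    by measurable
  have int: "(\<integral>\<omega>. f (\<omega> i) \<partial>?M) = (\<integral>y. f y \<partial>rho_measure p)" "integrable ?M (\<lambda>\<omega>. f (\<omega> i)) \<longleftrightarrow> integrable (rho_measure p) f"
    if "f \<in> borel_measurable borel" for f :: "real \<Rightarrow> real" and i
  proof -
    have "(\<integral>\<omega>. f (\<omega> i) \<partial>?M) = (\<integral>y. f y \<partial>distr ?M borel (\<lambda>\<omega>. \<omega> i))"
      using that by (subst integral_distr) auto
    then show "(\<integral>\<omega>. f (\<omega> i) \<partial>?M) = (\<integral>y. f y \<partial>rho_measure p)" unfolding comp .
    have "integrable (distr ?M borel (\<lambda>\<omega>. \<omega> i)) f \<longleftrightarrow> integrable ?M (\<lambda>\<omega>. f (\<omega> i))"
      using that by (subst integrable_distr_eq) auto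
    then show "integrable ?M (\<lambda>\<omega>. f (\<omega> i)) \<longleftrightarrow> integrable (rho_measure p) f" unfolding comp by simp
  qed
  have indep: "prob_space.indep_vars ?M (\<lambda>_. borel) (\<lambda>i \<omega>. \<omega> i) UNIV"
  proof (subst prob_space.indep_vars_iff_distr_eq_PiM[OF M])
    have "distr ?M (PiM UNIV (\<lambda>_. borel)) (\<lambda>x. \<lambda>i\<in>UNIV. x i) = distr ?M ?M (\<lambda>x. x)"
      by (intro distr_cong sets_PiM_cong) auto
    then show "distr ?M (PiM UNIV (\<lambda>_. borel)) (\<lambda>x. \<lambda>i\<in>UNIV. x i) = PiM UNIV (\<lambda>i. distr ?M borel (\<lambda>\<omega>. \<omega> i))"
      by (simp add: comp distr_id2)
  qed auto
  have mean: "(\<integral>y. y \<partial>rho_measure p) = 0"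
  proof -
    have "(\<integral>y. y * rho p y \<partial>lborel) = - (\<integral>y. y * rho p y \<partial>lborel)"
      by (subst lborel_integral_real_affine[where c = "-1" and t = 0]) auto
    then show ?thesis by (simp add: integral_rho_measure)
  qed
  have sq: "(sqrt (1 / beta_c p))\<^sup>2 = 1 / beta_c p" using beta_c_pos by simp
  have "weak_conv_m (\<lambda>n. distr ?M borel (\<lambda>x. (\<Sum>i<n. x i) / sqrt (real n * (sqrt (1 / beta_c p))\<^sup>2))) std_normal_distribution"
  proof (rule prob_space.central_limit_theorem_zero_mean[OF M indep _ _ _ _ comp])
    show "(\<integral>\<omega>. \<omega> n \<partial>?M) = 0" for n using int(1)[of "\<lambda>y. y"] by (simp add: mean)
    show "0 < sqrt (1 / beta_c p)" using beta_c_pos by simp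
    show "integrable ?M (\<lambda>x. (x n)\<^sup>2)" for n using int(2)[of "\<lambda>y. y\<^sup>2"] by (simp add: integrable_sq)
    show "(\<integral>\<omega>. (\<omega> n - (\<integral>\<omega>. \<omega> n \<partial>?M))\<^sup>2 \<partial>?M) = (sqrt (1 / beta_c p))\<^sup>2" for n
      using int(1)[of "\<lambda>y. y" n] int(1)[of "\<lambda>y. y\<^sup>2" n] unfolding sq by (simp add: mean integrable_sq)
  qed
  moreover have "distr ?M borel (\<lambda>x. (\<Sum>i<n. x i) / s) = distr (P n) borel (\<lambda>x. (\<Sum>i<n. x i) / s)" for n and s :: real
  proof -
    have "P n = distr ?M (P n) (\<lambda>x. restrict x {..<n})"
      unfolding P_def by (rule pr.distr_PiM_restrict_finite[symmetric]) auto
    then have "distr (P n) borel (\<lambda>x. (\<Sum>i<n. x i) / s) = distr (distr ?M (P n) (\<lambda>x. restrict x {..<n})) borel (\<lambda>x. (\<Sum>i<n. x i) / s)"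
      by simp
    also have "\<dots> = distr ?M borel ((\<lambda>x. (\<Sum>i<n. x i) / s) \<circ> (\<lambda>x. restrict x {..<n}))"
    proof (rule distr_distr)
      show "(\<lambda>x. restrict x {..<n}) \<in> measurable ?M (P n)"
        unfolding P_def by (rule measurable_restrict_subset) simp
    qed measurable
    also have "\<dots> = distr ?M borel (\<lambda>x. (\<Sum>i<n. x i) / s)"
      by (intro distr_cong) auto
    finally show ?thesis ..
  qed
  ultimately show ?thesis unfolding sq by simp
qed

lemma clt_integral:
  fixes k :: "real \<Rightarrow> real"
  assumes k: "\<And>x. isCont k x" "\<And>x. \<bar>k x\<bar> \<le> B"
  shows "(\<lambda>n. \<integral>x. k ((\<Sum>i<n. x i) / sqrt (real n)) \<partial>P n)
    \<longlonglongrightarrow> (\<integral>y. k y * normal_density 0 (sqrt (1 / beta_c p)) y \<partial>lborel)"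
proof -
  define s where "s = sqrt (1 / beta_c p)"
  have s: "0 < s" using beta_c_pos by (simp add: s_def)
  have kc: "isCont (\<lambda>y. k (s * y)) x" for x
    by (rule isCont_o2[OF _ k(1)]) (intro continuous_intros)
  have "continuous_on UNIV k" using k(1) by (simp add: continuous_at_imp_continuous_on)
  then have [measurable]: "k \<in> borel_measurable borel" by (rule borel_measurable_continuous_onI)
  have "(\<lambda>n. integral\<^sup>L (distr (P n) borel (\<lambda>x. (\<Sum>i<n. x i) / sqrt (real n * (1 / beta_c p)))) (\<lambda>y. k (s * y)))
     \<longlonglongrightarrow> integral\<^sup>L std_normal_distribution (\<lambda>y. k (s * y))"
    by (rule weak_conv_imp_integral_bdd_continuous_conv[OF _ real_dist_normal_dist weak_conv_sum kc])
       (use k(2) in auto)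
  moreover have "integral\<^sup>L (distr (P n) borel (\<lambda>x. (\<Sum>i<n. x i) / sqrt (real n * (1 / beta_c p)))) (\<lambda>y. k (s * y))
     = (\<integral>x. k ((\<Sum>i<n. x i) / sqrt (real n)) \<partial>P n)" for n
  proof -
    have "s * (r / sqrt (real n * (1 / beta_c p))) = r / sqrt (real n)" for r
      using s unfolding real_sqrt_mult s_def[symmetric] by simp
    then show ?thesis by (subst integral_distr) auto
  qed
  moreover have "integral\<^sup>L std_normal_distribution (\<lambda>y. k (s * y)) = (\<integral>y. k y * normal_density 0 s y \<partial>lborel)"
  proof -
    have "s * normal_density 0 s (s * y) = std_normal_density y" for y
      using s by (simp add: normal_density_def real_sqrt_mult power_mult_distrib)
    then have eq: "s * (k (s * y) * normal_density 0 s (s * y)) = k (s * y) * std_normal_density y" for y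
      by (metis mult.left_commute)
    have "(\<integral>y. k y * normal_density 0 s y \<partial>lborel) = (\<integral>y. s * (k (s * y) * normal_density 0 s (s * y)) \<partial>lborel)"
      using s by (subst lborel_integral_real_affine[where c = s and t = 0]) auto
    then have "(\<integral>y. k y * normal_density 0 s y \<partial>lborel) = (\<integral>y. k (s * y) * std_normal_density y \<partial>lborel)"
      unfolding eq .
    then show ?thesis by (subst integral_density) (auto simp: mult.commute)
  qed
  ultimately show ?thesis by (simp add: s_def)
qed

end

section \<open>Lipschitz bounds for truncated weights and test functions\<close>

lemma exp_lipschitz:
  fixes a b C :: real
  assumes "a \<le> C" "b \<le> C"
  shows "\<bar>exp a - exp b\<bar> \<le> exp C * \<bar>a - b\<bar>"
proof -
  have *: "exp a - exp b \<le> exp C * (a - b)" if "b \<le> a" "a \<le> C" for a b :: real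
  proof -
    have "exp a - exp b = exp a * (1 - exp (b - a))" by (simp add: exp_diff right_diff_distrib)
    also have "\<dots> \<le> exp a * (a - b)"
    proof (rule mult_left_mono)
      show "1 - exp (b - a) \<le> a - b" using exp_ge_add_one_self[of "b - a"] by linarith
    qed simp
    also have "\<dots> \<le> exp C * (a - b)" using that by (intro mult_right_mono) auto
    finally show ?thesis .
  qed
  show ?thesis
  proof (cases "b \<le> a")
    case True
    then show ?thesis using *[OF True assms(1)] by simp
  next
    case False
    then show ?thesis using *[of a b] assms(2) by (simp add: abs_minus_commute[of "exp a"])
  qed
qed

lemma clamp_square_lipschitz:
  fixes y z K :: real
  assumes "0 \<le> K"
  shows "\<bar>(min \<bar>y\<bar> K)\<^sup>2 - (min \<bar>z\<bar> K)\<^sup>2\<bar> \<le> 2 * K * \<bar>y - z\<bar>"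
proof -
  have "\<bar>(min \<bar>y\<bar> K)\<^sup>2 - (min \<bar>z\<bar> K)\<^sup>2\<bar> = \<bar>min \<bar>y\<bar> K + min \<bar>z\<bar> K\<bar> * \<bar>min \<bar>y\<bar> K - min \<bar>z\<bar> K\<bar>"
    by (simp add: abs_mult[symmetric] power2_eq_square algebra_simps)
  also have "\<dots> \<le> (2 * K) * \<bar>y - z\<bar>"
    using assms by (intro mult_mono) (auto simp: min_def abs_if)
  finally show ?thesis .
qed

text \<open>\<open>cts_step\<close> is an affine function clamped to \<open>[0, 1]\<close>, and
  clamping contracts distances. These functions determine weak convergence, and being Lipschitz lets
  an L1 error in the argument pass to the integral.\<close>

lemma cts_step_lipschitz:
  assumes "a < b"
  shows "\<bar>cts_step a b y - cts_step a b z\<bar> \<le> 1 / (b - a) * \<bar>y - z\<bar>"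
proof -
  have eq: "cts_step a b x = max 0 (min 1 ((b - x) / (b - a)))" for x
    using assms by (auto simp: cts_step_def max_def min_def field_simps)
  have "\<bar>max 0 (min 1 u) - max 0 (min 1 v)\<bar> \<le> \<bar>u - v\<bar>" for u v :: real
    by (auto simp: max_def min_def)
  then have "\<bar>cts_step a b y - cts_step a b z\<bar> \<le> \<bar>(b - y) / (b - a) - (b - z) / (b - a)\<bar>"
    unfolding eq .
  also have "(b - y) / (b - a) - (b - z) / (b - a) = - ((y - z) / (b - a))"
    by (simp add: diff_divide_distrib[symmetric] minus_divide_left)
  also have "\<bar>- ((y - z) / (b - a))\<bar> = 1 / (b - a) * \<bar>y - z\<bar>"
    using assms by (simp add: abs_divide)
  finally show ?thesis .
qed

lemma lipschitz_isCont:
  fixes k :: "real \<Rightarrow> real"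
  assumes "\<And>y z. \<bar>k y - k z\<bar> \<le> L * \<bar>y - z\<bar>"
  shows "isCont k x"
proof -
  have "(k \<longlongrightarrow> k x) (at x)"
  proof (rule Lim_null_comparison[where g = "\<lambda>y. L * \<bar>y - x\<bar>", THEN LIM_zero_cancel])
    show "\<forall>\<^sub>F y in at x. norm (k y - k x) \<le> L * \<bar>y - x\<bar>" using assms by simp
    show "(\<lambda>y. L * \<bar>y - x\<bar>) \<midarrow>x\<rightarrow> 0"
      by (rule tendsto_eq_intros refl | simp)+
  qed
  then show ?thesis by (simp add: isCont_def)
qed

lemma inverse_sqrt_tendsto_0: "(\<lambda>n. C / sqrt (real n)) \<longlonglongrightarrow> 0"
  by (intro tendsto_divide_0[OF tendsto_const] filterlim_at_top_imp_at_infinity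
      filterlim_compose[OF sqrt_at_top filterlim_real_sequentially])

context lp_density
begin

subsection \<open>The central limit theorem for the weighted magnetization\<close>

text \<open>Boundedness of \<open>A\<close> is an exponential moment bound for
  \<open>n * mag^2\<close>; \<open>y \<le> exp y\<close> extracts the second moment.\<close>

lemma mag_second_moment:
  assumes b: "0 < \<beta>" "\<beta> < beta_c p"
  shows "\<exists>C. \<forall>n. (\<integral>x. (sqrt (real n) * mag n x)\<^sup>2 \<partial>P n) \<le> C"
proof -
  obtain B where B: "\<And>n. A n \<beta> \<le> B" using A_bounded[of \<beta>] b by auto
  have "(\<integral>x. (sqrt (real n) * mag n x)\<^sup>2 \<partial>P n) \<le> 2 / \<beta> * B" for n
  proof -
    have le: "(sqrt (real n) * mag n x)\<^sup>2 \<le> 2 / \<beta> * exp (real n * \<beta> * (mag n x)\<^sup>2 / 2)" for x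
    proof -
      have "\<beta> / 2 * (sqrt (real n) * mag n x)\<^sup>2 \<le> exp (real n * \<beta> * (mag n x)\<^sup>2 / 2)"
      proof -
        have "\<beta> / 2 * (sqrt (real n) * mag n x)\<^sup>2 = real n * \<beta> * (mag n x)\<^sup>2 / 2"
          by (simp add: power_mult_distrib)
        then show ?thesis using exp_ge_add_one_self[of "real n * \<beta> * (mag n x)\<^sup>2 / 2"] by linarith
      qed
      then show ?thesis using b by (simp add: field_simps)
    qed
    have i: "integrable (P n) (\<lambda>x. 2 / \<beta> * exp (real n * \<beta> * (mag n x)\<^sup>2 / 2))"
      using integrable_weight[of \<beta> n] b by auto
    have "integrable (P n) (\<lambda>x. (sqrt (real n) * mag n x)\<^sup>2)"
      by (rule Bochner_Integration.integrable_bound[OF i]) (use le b in \<open>auto intro!: AE_I2 simp del: power_mult_distrib\<close>)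
    then have "(\<integral>x. (sqrt (real n) * mag n x)\<^sup>2 \<partial>P n) \<le> (\<integral>x. 2 / \<beta> * exp (real n * \<beta> * (mag n x)\<^sup>2 / 2) \<partial>P n)"
      by (intro integral_mono i le)
    also have "\<dots> = 2 / \<beta> * A n \<beta>" by (simp add: A_def)
    also have "\<dots> \<le> 2 / \<beta> * B" using b by (intro mult_left_mono B) auto
    finally show ?thesis .
  qed
  then show ?thesis by blast
qed

text \<open>With \<open>Y = sqrt n * mag\<close> the normalised sum is \<open>Y * R\<close>, so the
  difference is \<open>\<bar>Y\<bar> * \<bar>R - 1\<bar>\<close>. Here \<open>Y\<close> is bounded
  in L2 and \<open>R - 1\<close> has L2 norm of order \<open>1 / sqrt n\<close>.\<close>

lemma mag_sum_L1:
  "\<exists>C. \<forall>n>0. integrable (P n) (\<lambda>x. \<bar>sqrt (real n) * mag n x - (\<Sum>i<n. x i) / sqrt (real n)\<bar>) \<and>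
    (\<integral>x. \<bar>sqrt (real n) * mag n x - (\<Sum>i<n. x i) / sqrt (real n)\<bar> \<partial>P n) \<le> C / sqrt (real n)"
proof -
  \<comment> \<open>The bound is about \<open>P n\<close> alone, so any inverse temperature strictly
    between 0 and \<open>beta_c p\<close> serves.\<close>
  obtain C where C: "\<And>n. (\<integral>x. (sqrt (real n) * mag n x)\<^sup>2 \<partial>P n) \<le> C"
    using mag_second_moment[of "beta_c p / 2"] beta_c_pos by auto
  have "integrable (P n) (\<lambda>x. \<bar>sqrt (real n) * mag n x - (\<Sum>i<n. x i) / sqrt (real n)\<bar>) \<and>
    (\<integral>x. \<bar>sqrt (real n) * mag n x - (\<Sum>i<n. x i) / sqrt (real n)\<bar> \<partial>P n) \<le> ((C + vp) / 2) / sqrt (real n)"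
    if n: "0 < n" for n
  proof -
    let ?D = "\<lambda>x. (\<Sum>i<n. \<bar>x i\<bar> powr p - 1) / real n"
    let ?Y = "\<lambda>x. sqrt (real n) * mag n x"
    let ?t = "sqrt (real n)"
    let ?d = "\<lambda>x. \<bar>?Y x - (\<Sum>i<n. x i) / sqrt (real n)\<bar>"
    have t: "0 < ?t" using n by simp
    have le: "?d x \<le> 1 / (2 * ?t) * (?Y x)\<^sup>2 + ?t / 2 * (?D x)\<^sup>2" for x
    proof -
      have "(\<Sum>i<n. x i) / sqrt (real n) = ?Y x * norm_np n p x"
        using n unfolding sum_eq_mag[OF n] by (simp add: field_simps)
      then have "?d x = \<bar>?Y x\<bar> * \<bar>norm_np n p x - 1\<bar>"
        by (simp add: abs_mult[symmetric] algebra_simps abs_minus_commute)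
      also have "\<dots> \<le> \<bar>?Y x\<bar> * \<bar>?D x\<bar>" by (intro mult_left_mono radius_dev n) auto
      also have "\<dots> \<le> 1 / (2 * ?t) * (?Y x)\<^sup>2 + ?t / 2 * (?D x)\<^sup>2"
        by (rule abs_mult_le_amgm[OF t])
      finally show ?thesis .
    qed
    have iY: "integrable (P n) (\<lambda>x. (?Y x)\<^sup>2)"
    proof (rule P.integrable_const_bound[where B = "real n"])
      show "AE x in P n. norm ((?Y x)\<^sup>2) \<le> real n"
        using mag_sq_le_1 n by (auto simp: power_mult_distrib mult_left_le intro!: AE_I2)
    qed measurable
    have iD: "integrable (P n) (\<lambda>x. (?D x)\<^sup>2)"
      using product_variance(1)[OF centered_p, of n] by (simp add: power_divide)
    have D: "(\<integral>x. (?D x)\<^sup>2 \<partial>P n) = vp / real n"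
      using product_variance(2)[OF centered_p, of n] n by (simp add: power_divide vp_def power2_eq_square)
    have i: "integrable (P n) (\<lambda>x. 1 / (2 * ?t) * (?Y x)\<^sup>2 + ?t / 2 * (?D x)\<^sup>2)"
      by (intro Bochner_Integration.integrable_add integrable_mult_right iY iD)
    have int: "integrable (P n) ?d"
    proof (rule Bochner_Integration.integrable_bound[OF i])
      show "AE x in P n. norm (?d x) \<le> norm (1 / (2 * ?t) * (?Y x)\<^sup>2 + ?t / 2 * (?D x)\<^sup>2)"
        by (intro AE_I2) (simp only: real_norm_def abs_idempotent, rule order_trans[OF le abs_ge_self])
    qed measurable
    have "(\<integral>x. ?d x \<partial>P n) \<le> (\<integral>x. 1 / (2 * ?t) * (?Y x)\<^sup>2 + ?t / 2 * (?D x)\<^sup>2 \<partial>P n)"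
      by (intro integral_mono int i le)
    also have "\<dots> = 1 / (2 * ?t) * (\<integral>x. (?Y x)\<^sup>2 \<partial>P n) + ?t / 2 * (vp / real n)"
      using iY iD by (subst Bochner_Integration.integral_add) (simp_all only: integrable_mult_right integral_mult_right_zero D)
    also have "\<dots> \<le> 1 / (2 * ?t) * C + ?t / 2 * (vp / real n)"
      by (intro add_right_mono mult_left_mono C) auto
    also have "?t / 2 * (vp / real n) = vp / 2 / ?t"
    proof -
      have "real n = ?t * ?t" by simp
      then have "?t / 2 * (vp / real n) = ?t / 2 * (vp / (?t * ?t))" by presburger
      also have "\<dots> = vp / 2 / ?t" using t by (simp del: real_sqrt_mult_self)
      finally show ?thesis .
    qed
    also have "1 / (2 * ?t) * C + vp / 2 / ?t = ((C + vp) / 2) / ?t" by (simp add: add_divide_distrib)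
    finally show ?thesis using int by blast
  qed
  then show ?thesis by blast
qed

lemma ms_L1:
  assumes n: "0 < n"
  shows "integrable (P n) (\<lambda>x. \<bar>ms n x - 1 / beta_c p\<bar>)"
    and "(\<integral>x. \<bar>ms n x - 1 / beta_c p\<bar> \<partial>P n) \<le> ((2 + vp + v2) / 2) / sqrt (real n)"
proof -
  note i1 = L1_law[OF centered_p n, folded vp_def] and i2 = L1_law[OF centered_2 n, folded v2_def]
  let ?b = "\<lambda>x. \<bar>(\<Sum>i<n. \<bar>x i\<bar> powr p - 1) / real n\<bar> + \<bar>(\<Sum>i<n. (x i)\<^sup>2 - 1 / beta_c p) / real n\<bar>"
  have i: "integrable (P n) ?b" by (intro Bochner_Integration.integrable_add i1 i2)
  show int: "integrable (P n) (\<lambda>x. \<bar>ms n x - 1 / beta_c p\<bar>)"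
  proof (rule Bochner_Integration.integrable_bound[OF i])
    show "AE x in P n. norm \<bar>ms n x - 1 / beta_c p\<bar> \<le> norm (?b x)"
      by (intro AE_I2) (simp only: real_norm_def abs_idempotent, rule order_trans[OF ms_dev[OF n] abs_ge_self])
  qed measurable
  have "(\<integral>x. \<bar>ms n x - 1 / beta_c p\<bar> \<partial>P n) \<le> (\<integral>x. ?b x \<partial>P n)"
    by (intro integral_mono int i ms_dev n)
  also have "\<dots> = (\<integral>x. \<bar>(\<Sum>i<n. \<bar>x i\<bar> powr p - 1) / real n\<bar> \<partial>P n) + (\<integral>x. \<bar>(\<Sum>i<n. (x i)\<^sup>2 - 1 / beta_c p) / real n\<bar> \<partial>P n)"
    by (rule Bochner_Integration.integral_add[OF i1(1) i2(1)])
  also have "\<dots> \<le> (1 + vp) / (2 * sqrt (real n)) + (1 + v2) / (2 * sqrt (real n))"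
    by (intro add_mono i1 i2)
  also have "\<dots> = ((2 + vp + v2) / 2) / sqrt (real n)"
    by (simp add: add_divide_distrib[symmetric])
  finally show "(\<integral>x. \<bar>ms n x - 1 / beta_c p\<bar> \<partial>P n) \<le> ((2 + vp + v2) / 2) / sqrt (real n)" .
qed

text \<open>A Slutsky argument with rates: \<open>sqrt n * mag\<close> is exchanged for
  \<open>S / sqrt n\<close>, and \<open>ms\<close> for its limit \<open>1 / beta_c p\<close>, each
  with an L1 error of order \<open>1 / sqrt n\<close>. The diagonal weight thereby turns into a
  constant.\<close>

lemma clt_mag:
  fixes k :: "real \<Rightarrow> real"
  assumes b: "0 \<le> \<beta>" and k: "\<And>y z. \<bar>k y - k z\<bar> \<le> L * \<bar>y - z\<bar>" "\<And>y. \<bar>k y\<bar> \<le> B"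
  shows "(\<lambda>n. \<integral>x. k (sqrt (real n) * mag n x) * exp (- (\<beta> * ms n x / 2)) \<partial>P n)
    \<longlonglongrightarrow> exp (- (\<beta> * (1 / beta_c p) / 2)) * (\<integral>y. k y * normal_density 0 (sqrt (1 / beta_c p)) y \<partial>lborel)"
proof -
  let ?q = "1 / beta_c p"
  let ?e = "exp (- (\<beta> * ?q / 2))"
  have kc: "isCont k x" for x by (rule lipschitz_isCont[OF k(1)])
  then have "continuous_on UNIV k" by (simp add: continuous_at_imp_continuous_on)
  then have [measurable]: "k \<in> borel_measurable borel" by (rule borel_measurable_continuous_onI)
  have B: "0 \<le> B" using k(2)[of 0] by linarith
  have L: "0 \<le> L" using k(1)[of 0 1] by simp
  obtain C where C: "\<And>n. 0 < n \<Longrightarrow> integrable (P n) (\<lambda>x. \<bar>sqrt (real n) * mag n x - (\<Sum>i<n. x i) / sqrt (real n)\<bar>)"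
    "\<And>n. 0 < n \<Longrightarrow> (\<integral>x. \<bar>sqrt (real n) * mag n x - (\<Sum>i<n. x i) / sqrt (real n)\<bar> \<partial>P n) \<le> C / sqrt (real n)"
    using mag_sum_L1 by auto
  define D where "D = L * C + B * (\<beta> / 2) * ((2 + vp + v2) / 2)"
  have lim: "(\<lambda>n. ?e * (\<integral>x. k ((\<Sum>i<n. x i) / sqrt (real n)) \<partial>P n))
      \<longlonglongrightarrow> ?e * (\<integral>y. k y * normal_density 0 (sqrt ?q) y \<partial>lborel)"
    by (intro tendsto_mult tendsto_const clt_integral[OF kc k(2)])
  have "(\<lambda>n. (\<integral>x. k (sqrt (real n) * mag n x) * exp (- (\<beta> * ms n x / 2)) \<partial>P n)
      - ?e * (\<integral>x. k ((\<Sum>i<n. x i) / sqrt (real n)) \<partial>P n)) \<longlonglongrightarrow> 0"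
  proof (rule Lim_null_comparison[OF _ inverse_sqrt_tendsto_0[of D]])
    show "\<forall>\<^sub>F n in sequentially. norm ((\<integral>x. k (sqrt (real n) * mag n x) * exp (- (\<beta> * ms n x / 2)) \<partial>P n)
      - ?e * (\<integral>x. k ((\<Sum>i<n. x i) / sqrt (real n)) \<partial>P n)) \<le> D / sqrt (real n)"
      using eventually_gt_at_top[of "0::nat"]
    proof eventually_elim
      case (elim n)
      let ?Y = "\<lambda>x. sqrt (real n) * mag n x" and ?S = "\<lambda>x. (\<Sum>i<n. x i) / sqrt (real n)"
      let ?b = "\<lambda>x. B * (\<beta> / 2) * \<bar>ms n x - ?q\<bar> + L * \<bar>?Y x - ?S x\<bar>"
      have e1: "?e \<le> 1" using b beta_c_pos by simp
      have i1: "integrable (P n) (\<lambda>x. k (?Y x) * exp (- (\<beta> * ms n x / 2)))"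
      proof (rule P.integrable_const_bound[where B = B])
        have "\<bar>k (?Y x)\<bar> * exp (- (\<beta> * ms n x / 2)) \<le> B * 1" for x
          using k(2) b ms_nonneg[of n x] B by (intro mult_mono) auto
        then show "AE x in P n. norm (k (?Y x) * exp (- (\<beta> * ms n x / 2))) \<le> B"
          by (auto intro!: AE_I2 simp: abs_mult)
      qed measurable
      have i2: "integrable (P n) (\<lambda>x. ?e * k (?S x))"
        using k(2) by (intro integrable_mult_right P.integrable_const_bound[where B = B]) auto
      have i3: "integrable (P n) ?b"
        by (intro Bochner_Integration.integrable_add integrable_mult_right ms_L1 C elim)
      have pt: "\<bar>k (?Y x) * exp (- (\<beta> * ms n x / 2)) - ?e * k (?S x)\<bar> \<le> ?b x" for x
      proof -
        have "\<bar>exp (- (\<beta> * ms n x / 2)) - ?e\<bar> \<le> exp 0 * \<bar>- (\<beta> * ms n x / 2) - - (\<beta> * ?q / 2)\<bar>"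
          using b beta_c_pos ms_nonneg[of n x] by (intro exp_lipschitz) auto
        also have "- (\<beta> * ms n x / 2) - - (\<beta> * ?q / 2) = - (\<beta> / 2 * (ms n x - ?q))" by (simp add: field_simps)
        also have "exp 0 * \<bar>- (\<beta> / 2 * (ms n x - ?q))\<bar> = \<beta> / 2 * \<bar>ms n x - ?q\<bar>" using b by (simp add: abs_mult)
        finally have 1: "\<bar>exp (- (\<beta> * ms n x / 2)) - ?e\<bar> \<le> \<beta> / 2 * \<bar>ms n x - ?q\<bar>" .
        have "\<bar>k (?Y x) * exp (- (\<beta> * ms n x / 2)) - ?e * k (?S x)\<bar>
            = \<bar>k (?Y x) * (exp (- (\<beta> * ms n x / 2)) - ?e) + ?e * (k (?Y x) - k (?S x))\<bar>"
          by (simp add: algebra_simps)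
        also have "\<dots> \<le> \<bar>k (?Y x)\<bar> * \<bar>exp (- (\<beta> * ms n x / 2)) - ?e\<bar> + ?e * \<bar>k (?Y x) - k (?S x)\<bar>"
          by (rule order_trans[OF abs_triangle_ineq]) (simp add: abs_mult)
        also have "\<dots> \<le> B * (\<beta> / 2 * \<bar>ms n x - ?q\<bar>) + 1 * (L * \<bar>?Y x - ?S x\<bar>)"
          using B b by (intro add_mono mult_mono k 1 e1) auto
        finally show ?thesis by simp
      qed
      have "\<bar>(\<integral>x. k (?Y x) * exp (- (\<beta> * ms n x / 2)) \<partial>P n) - (\<integral>x. ?e * k (?S x) \<partial>P n)\<bar>
         = \<bar>\<integral>x. k (?Y x) * exp (- (\<beta> * ms n x / 2)) - ?e * k (?S x) \<partial>P n\<bar>"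
        by (simp only: Bochner_Integration.integral_diff[OF i1 i2])
      also have "\<dots> \<le> (\<integral>x. \<bar>k (?Y x) * exp (- (\<beta> * ms n x / 2)) - ?e * k (?S x)\<bar> \<partial>P n)"
        by (rule integral_abs_bound)
      also have "\<dots> \<le> (\<integral>x. ?b x \<partial>P n)"
        by (intro integral_mono i3 pt integrable_abs Bochner_Integration.integrable_diff i1 i2)
      also have "\<dots> = B * (\<beta> / 2) * (\<integral>x. \<bar>ms n x - ?q\<bar> \<partial>P n) + L * (\<integral>x. \<bar>?Y x - ?S x\<bar> \<partial>P n)"
        using ms_L1(1)[OF elim] C(1)[OF elim]
        by (subst Bochner_Integration.integral_add) (simp_all only: integrable_mult_right integral_mult_right_zero)
      also have "\<dots> \<le> B * (\<beta> / 2) * (((2 + vp + v2) / 2) / sqrt (real n)) + L * (C / sqrt (real n))"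
        using B b L by (intro add_mono mult_left_mono ms_L1 C elim) auto
      also have "\<dots> = D / sqrt (real n)"
      proof -
        have "a * (x / t) + l * (c / t) = (l * c + a * x) / t" for a x l c t :: real
          by (simp add: add_divide_distrib)
        then show ?thesis unfolding D_def .
      qed
      finally show ?case by simp
    qed
  qed
  from tendsto_add[OF this lim] show ?thesis by simp
qed

text \<open>The Boltzmann factor \<open>exp (\<beta> * H)\<close> at the projection of
  \<open>x\<close> to the sphere; see \<open>hamiltonian_sph\<close>.\<close>

definition wt :: "nat \<Rightarrow> real \<Rightarrow> (nat \<Rightarrow> real) \<Rightarrow> real" where
  "wt n \<beta> x = exp (real n * \<beta> * (mag n x)\<^sup>2 / 2) * exp (- (\<beta> * ms n x / 2))"

lemma wt_measurable [measurable]: "wt n \<beta> \<in> borel_measurable (P n)"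
  unfolding wt_def[abs_def] by measurable

lemma wt_pos: "0 < wt n \<beta> x"
  by (simp add: wt_def)

lemma wt_le: "0 \<le> \<beta> \<Longrightarrow> wt n \<beta> x \<le> exp (real n * \<beta> * (mag n x)\<^sup>2 / 2)"
  using ms_nonneg[of n x] by (simp add: wt_def)

lemma wt_ge: "0 \<le> \<beta> \<Longrightarrow> exp (- \<beta> / 2) * exp (real n * \<beta> * (mag n x)\<^sup>2 / 2) \<le> wt n \<beta> x"
  using mult_left_mono[OF ms_le_1[of n x], of \<beta>] by (simp add: wt_def mult.commute)

lemma integrable_wt:
  assumes b: "0 \<le> \<beta>" and h: "h \<in> borel_measurable (P n)" "\<And>x. \<bar>h x\<bar> \<le> (C::real)"
  shows "integrable (P n) (\<lambda>x. h x * wt n \<beta> x)"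
proof (rule Bochner_Integration.integrable_bound)
  show "integrable (P n) (\<lambda>x. C * exp (real n * \<beta> * (mag n x)\<^sup>2 / 2))"
    using integrable_weight[OF b] by (rule integrable_mult_right)
  have C: "0 \<le> C" using h(2) abs_ge_zero order_trans by blast
  have "\<bar>h x\<bar> * wt n \<beta> x \<le> C * exp (real n * \<beta> * (mag n x)\<^sup>2 / 2)" for x
    using wt_pos[of n \<beta> x] C by (intro mult_mono h wt_le b) auto
  then show "AE x in P n. norm (h x * wt n \<beta> x) \<le> norm (C * exp (real n * \<beta> * (mag n x)\<^sup>2 / 2))"
    using C wt_pos[of n \<beta>] by (auto intro!: AE_I2 simp: abs_mult abs_of_pos)
qed (use h in measurable)

text \<open>The weight \<open>exp (\<beta> * y^2 / 2)\<close> is unbounded, so weak convergence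
  applies only after truncation at \<open>K\<close>. The error is uniform in \<open>n\<close>
  because \<open>A\<close> stays bounded at some \<open>\<gamma>\<close> strictly between
  \<open>\<beta>\<close> and \<open>beta_c p\<close>; the same \<open>\<gamma>\<close> controls the
  Gaussian side.\<close>

lemma weighted_clt:
  fixes h :: "real \<Rightarrow> real"
  assumes b: "0 \<le> \<beta>" "\<beta> < beta_c p"
    and h: "\<And>y z. \<bar>h y - h z\<bar> \<le> L * \<bar>y - z\<bar>" "\<And>y. 0 \<le> h y" "\<And>y. h y \<le> 1"
  shows "(\<lambda>n. \<integral>x. h (sqrt (real n) * mag n x) * wt n \<beta> x \<partial>P n)
    \<longlonglongrightarrow> exp (- (\<beta> * (1 / beta_c p) / 2)) * (\<integral>y. (h y * exp (\<beta> * y\<^sup>2 / 2)) * normal_density 0 (sqrt (1 / beta_c p)) y \<partial>lborel)"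
    (is "?I \<longlonglongrightarrow> ?e * ?J")
proof (rule LIMSEQ_I)
  define \<gamma> where "\<gamma> = (\<beta> + beta_c p) / 2"
  have g: "\<beta> < \<gamma>" "\<gamma> < beta_c p" "0 \<le> \<gamma>" using b by (auto simp: \<gamma>_def)
  obtain B where B: "\<And>n. A n \<gamma> \<le> B" using A_bounded[OF g(3,2)] by auto
  have L: "0 \<le> L" using h(1)[of 0 1] by simp
  have hc: "isCont h x" for x by (rule lipschitz_isCont[OF h(1)])
  then have "continuous_on UNIV h" by (simp add: continuous_at_imp_continuous_on)
  then have [measurable]: "h \<in> borel_measurable borel" by (rule borel_measurable_continuous_onI)
  let ?nd = "normal_density 0 (sqrt (1 / beta_c p))"
  define B' where "B' = sqrt (beta_c p / (beta_c p - \<gamma>))"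
  have ndint: "has_bochner_integral lborel (\<lambda>y. exp (\<gamma> * y\<^sup>2 / 2) * ?nd y) B'"
  proof -
    have "exp (\<gamma> * y\<^sup>2 / 2) * ?nd y = B' * normal_density 0 (sqrt (1 / (beta_c p - \<gamma>))) y" for y
      using normal_density_tilt[OF beta_c_pos g(2), of y] by (simp only: B'_def mult.commute)
    then show ?thesis
      using g(2) by (simp add: has_bochner_integral_iff)
  qed
  have Bpos: "0 < B" using A_ge_1[OF g(3), of 0] B[of 0] by linarith
  have B'pos: "0 \<le> B'" using g beta_c_pos by (simp add: B'_def)
  fix r :: real assume r: "0 < r"
  define c where "c = (\<gamma> - \<beta>) / 2"
  have c: "0 < c" using g by (simp add: c_def)
  have "filterlim (\<lambda>K::real. c * K\<^sup>2) at_top at_top"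
    using c by (intro filterlim_tendsto_pos_mult_at_top[OF tendsto_const] filterlim_pow_at_top filterlim_ident) auto
  then have "((\<lambda>K::real. exp (- (c * K\<^sup>2)) * (B + ?e * B')) \<longlongrightarrow> 0 * (B + ?e * B')) at_top"
    by (intro tendsto_mult tendsto_const filterlim_compose[OF exp_at_bot] filterlim_compose[OF filterlim_uminus_at_bot_at_top])
  then have "\<forall>\<^sub>F K in at_top. exp (- (c * K\<^sup>2)) * (B + ?e * B') < r / 2"
    using r by (intro order_tendstoD(2)[where y = "0 * (B + ?e * B')"]) auto
  then have "\<forall>\<^sub>F K in at_top. 0 \<le> K \<and> exp (- (c * K\<^sup>2)) * (B + ?e * B') < r / 2"
    using eventually_ge_at_top[of "0::real"] by eventually_elim auto
  \<comment> \<open>\<open>K\<close> is fixed before \<open>n\<close>: the truncation errors at size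
    \<open>n\<close> and in the limit together stay below \<open>r / 2\<close>.\<close>
  then obtain K where K: "0 \<le> K" "exp (- (c * K\<^sup>2)) * (B + ?e * B') < r / 2"
    using eventually_happens'[OF trivial_limit_at_top_linorder] by blast
  \<comment> \<open>Freezing the weight beyond \<open>K\<close> keeps \<open>k\<close> bounded and
    Lipschitz, as \<open>clt_mag\<close> demands.\<close>
  define k where "k y = h y * exp (\<beta> * (min \<bar>y\<bar> K)\<^sup>2 / 2)" for y
  have mK: "\<beta> * (min \<bar>y\<bar> K)\<^sup>2 / 2 \<le> \<beta> * K\<^sup>2 / 2" for y
    using K b by (intro divide_right_mono mult_left_mono power_mono) auto
  define E where "E = exp (\<beta> * K\<^sup>2 / 2)"
  have kL: "\<bar>k y - k z\<bar> \<le> (E * L + E * (\<beta> * K)) * \<bar>y - z\<bar>" for y z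
  proof -
    let ?u = "exp (\<beta> * (min \<bar>y\<bar> K)\<^sup>2 / 2)" and ?v = "exp (\<beta> * (min \<bar>z\<bar> K)\<^sup>2 / 2)"
    have "\<bar>?u - ?v\<bar> \<le> E * \<bar>\<beta> * (min \<bar>y\<bar> K)\<^sup>2 / 2 - \<beta> * (min \<bar>z\<bar> K)\<^sup>2 / 2\<bar>"
      unfolding E_def by (intro exp_lipschitz mK)
    also have "\<beta> * (min \<bar>y\<bar> K)\<^sup>2 / 2 - \<beta> * (min \<bar>z\<bar> K)\<^sup>2 / 2 = \<beta> / 2 * ((min \<bar>y\<bar> K)\<^sup>2 - (min \<bar>z\<bar> K)\<^sup>2)"
      by (simp add: right_diff_distrib)
    also have "E * \<bar>\<dots>\<bar> \<le> E * (\<beta> / 2 * (2 * K * \<bar>y - z\<bar>))"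
      unfolding abs_mult using b clamp_square_lipschitz[OF K(1), of y z] by (intro mult_left_mono mult_mono) (auto simp: E_def)
    finally have uv: "\<bar>?u - ?v\<bar> \<le> E * (\<beta> * K) * \<bar>y - z\<bar>" by simp
    have "\<bar>k y - k z\<bar> = \<bar>(h y - h z) * ?u + h z * (?u - ?v)\<bar>" by (simp add: k_def algebra_simps)
    also have "\<dots> \<le> \<bar>h y - h z\<bar> * ?u + \<bar>h z\<bar> * \<bar>?u - ?v\<bar>"
      by (rule order_trans[OF abs_triangle_ineq]) (simp add: abs_mult)
    also have "\<dots> \<le> (L * \<bar>y - z\<bar>) * E + 1 * (E * (\<beta> * K) * \<bar>y - z\<bar>)"
      using h(2)[of z] h(3)[of z] L mK[of y] by (intro add_mono mult_mono h(1) uv) (auto simp: E_def)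
    finally show ?thesis by (simp add: algebra_simps)
  qed
  have kE: "\<bar>k y\<bar> \<le> E" for y
  proof -
    have "\<bar>h y\<bar> * exp (\<beta> * (min \<bar>y\<bar> K)\<^sup>2 / 2) \<le> 1 * E"
      using h(2,3)[of y] mK[of y] by (intro mult_mono) (auto simp: E_def)
    then show ?thesis by (simp add: k_def abs_mult)
  qed
  have [measurable]: "k \<in> borel_measurable borel" unfolding k_def[abs_def] by measurable
  have err: "\<bar>h y * exp (\<beta> * y\<^sup>2 / 2) - k y\<bar> \<le> exp (- (c * K\<^sup>2)) * exp (\<gamma> * y\<^sup>2 / 2)" for y
  proof -
    have "\<bar>h y * exp (\<beta> * y\<^sup>2 / 2) - k y\<bar> = \<bar>h y\<bar> * \<bar>exp (\<beta> * y\<^sup>2 / 2) - exp (\<beta> * (min \<bar>y\<bar> K)\<^sup>2 / 2)\<bar>"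
      by (simp add: k_def abs_mult[symmetric] right_diff_distrib)
    also have "\<dots> \<le> 1 * (exp (- ((\<gamma> - \<beta>) * K\<^sup>2 / 2)) * exp (\<gamma> * y\<^sup>2 / 2))"
      using h(2,3)[of y] g b K by (intro mult_mono truncation_error) auto
    also have "(\<gamma> - \<beta>) * K\<^sup>2 / 2 = c * K\<^sup>2" by (simp add: c_def)
    finally show ?thesis by simp
  qed
  let ?Ik = "\<lambda>n. \<integral>x. k (sqrt (real n) * mag n x) * exp (- (\<beta> * ms n x / 2)) \<partial>P n"
  let ?Jk = "\<integral>y. k y * ?nd y \<partial>lborel"
  have In: "\<bar>?I n - ?Ik n\<bar> \<le> exp (- (c * K\<^sup>2)) * B" for n
  proof -
    let ?Y = "\<lambda>x. sqrt (real n) * mag n x"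
    have Y2: "exp (real n * \<delta> * (mag n x)\<^sup>2 / 2) = exp (\<delta> * (?Y x)\<^sup>2 / 2)" for \<delta> x
      by (simp add: power_mult_distrib mult_ac)
    have i1: "integrable (P n) (\<lambda>x. h (?Y x) * wt n \<beta> x)"
      using h(2,3) by (intro integrable_wt[OF b(1), where C = 1]) auto
    have i2: "integrable (P n) (\<lambda>x. k (?Y x) * exp (- (\<beta> * ms n x / 2)))"
    proof (rule P.integrable_const_bound[where B = E])
      have "\<bar>k (?Y x)\<bar> * exp (- (\<beta> * ms n x / 2)) \<le> E * 1" for x
        using kE b ms_nonneg[of n x] by (intro mult_mono) (auto simp: E_def)
      then show "AE x in P n. norm (k (?Y x) * exp (- (\<beta> * ms n x / 2))) \<le> E"
        by (auto intro!: AE_I2 simp: abs_mult)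
    qed measurable
    have i3: "integrable (P n) (\<lambda>x. exp (- (c * K\<^sup>2)) * exp (real n * \<gamma> * (mag n x)\<^sup>2 / 2))"
      by (intro integrable_mult_right integrable_weight g)
    have pt: "\<bar>h (?Y x) * wt n \<beta> x - k (?Y x) * exp (- (\<beta> * ms n x / 2))\<bar> \<le> exp (- (c * K\<^sup>2)) * exp (real n * \<gamma> * (mag n x)\<^sup>2 / 2)" for x
    proof -
      have "h (?Y x) * wt n \<beta> x - k (?Y x) * exp (- (\<beta> * ms n x / 2))
          = (h (?Y x) * exp (\<beta> * (?Y x)\<^sup>2 / 2) - k (?Y x)) * exp (- (\<beta> * ms n x / 2))"
        unfolding wt_def Y2 by (simp only: left_diff_distrib mult.assoc)
      also have "\<bar>\<dots>\<bar> \<le> (exp (- (c * K\<^sup>2)) * exp (\<gamma> * (?Y x)\<^sup>2 / 2)) * 1"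
        unfolding abs_mult using b ms_nonneg[of n x] by (intro mult_mono err) auto
      finally show ?thesis unfolding Y2 by simp
    qed
    have "\<bar>?I n - ?Ik n\<bar> = \<bar>\<integral>x. h (?Y x) * wt n \<beta> x - k (?Y x) * exp (- (\<beta> * ms n x / 2)) \<partial>P n\<bar>"
      by (simp only: Bochner_Integration.integral_diff[OF i1 i2])
    also have "\<dots> \<le> (\<integral>x. \<bar>h (?Y x) * wt n \<beta> x - k (?Y x) * exp (- (\<beta> * ms n x / 2))\<bar> \<partial>P n)"
      by (rule integral_abs_bound)
    also have "\<dots> \<le> (\<integral>x. exp (- (c * K\<^sup>2)) * exp (real n * \<gamma> * (mag n x)\<^sup>2 / 2) \<partial>P n)"
      by (intro integral_mono i3 pt integrable_abs Bochner_Integration.integrable_diff i1 i2)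
    also have "\<dots> = exp (- (c * K\<^sup>2)) * A n \<gamma>" by (simp add: A_def)
    also have "\<dots> \<le> exp (- (c * K\<^sup>2)) * B" by (intro mult_left_mono B) auto
    finally show ?thesis .
  qed
  have J: "\<bar>?J - ?Jk\<bar> \<le> exp (- (c * K\<^sup>2)) * B'"
  proof -
    have i0: "integrable lborel (\<lambda>y. exp (\<gamma> * y\<^sup>2 / 2) * ?nd y)" using ndint by (simp add: has_bochner_integral_iff)
    have i1: "integrable lborel (\<lambda>y. (h y * exp (\<beta> * y\<^sup>2 / 2)) * ?nd y)"
    proof (rule Bochner_Integration.integrable_bound[OF i0])
      have "\<bar>h y\<bar> * exp (\<beta> * y\<^sup>2 / 2) * ?nd y \<le> 1 * exp (\<gamma> * y\<^sup>2 / 2) * ?nd y" for y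
        using h(2,3)[of y] g b by (intro mult_right_mono mult_mono) (auto intro!: mult_right_mono)
      then show "AE y in lborel. norm ((h y * exp (\<beta> * y\<^sup>2 / 2)) * ?nd y) \<le> norm (exp (\<gamma> * y\<^sup>2 / 2) * ?nd y)"
        by (auto intro!: AE_I2 simp: abs_mult)
    qed measurable
    have i2: "integrable lborel (\<lambda>y. k y * ?nd y)"
    proof (rule Bochner_Integration.integrable_bound)
      show "integrable lborel (\<lambda>y. E * ?nd y)"
        using beta_c_pos by (intro integrable_mult_right integrable_normal_density) simp
      have "\<bar>k y\<bar> * ?nd y \<le> E * ?nd y" for y by (intro mult_right_mono kE) auto
      then show "AE y in lborel. norm (k y * ?nd y) \<le> norm (E * ?nd y)"
        by (auto intro!: AE_I2 simp: abs_mult E_def)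
    qed measurable
    have i3: "integrable lborel (\<lambda>y. exp (- (c * K\<^sup>2)) * (exp (\<gamma> * y\<^sup>2 / 2) * ?nd y))"
      using i0 by (rule integrable_mult_right)
    have pt: "\<bar>(h y * exp (\<beta> * y\<^sup>2 / 2)) * ?nd y - k y * ?nd y\<bar> \<le> exp (- (c * K\<^sup>2)) * (exp (\<gamma> * y\<^sup>2 / 2) * ?nd y)" for y
    proof -
      have "\<bar>(h y * exp (\<beta> * y\<^sup>2 / 2)) * ?nd y - k y * ?nd y\<bar> = \<bar>h y * exp (\<beta> * y\<^sup>2 / 2) - k y\<bar> * ?nd y"
        by (simp only: left_diff_distrib[symmetric] abs_mult) simp
      also have "\<dots> \<le> (exp (- (c * K\<^sup>2)) * exp (\<gamma> * y\<^sup>2 / 2)) * ?nd y"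
        by (intro mult_right_mono err) auto
      finally show ?thesis by (simp only: mult.assoc)
    qed
    have "\<bar>?J - ?Jk\<bar> = \<bar>\<integral>y. (h y * exp (\<beta> * y\<^sup>2 / 2)) * ?nd y - k y * ?nd y \<partial>lborel\<bar>"
      by (simp only: Bochner_Integration.integral_diff[OF i1 i2])
    also have "\<dots> \<le> (\<integral>y. \<bar>(h y * exp (\<beta> * y\<^sup>2 / 2)) * ?nd y - k y * ?nd y\<bar> \<partial>lborel)"
      by (rule integral_abs_bound)
    also have "\<dots> \<le> (\<integral>y. exp (- (c * K\<^sup>2)) * (exp (\<gamma> * y\<^sup>2 / 2) * ?nd y) \<partial>lborel)"
      by (intro integral_mono i3 pt integrable_abs Bochner_Integration.integrable_diff i1 i2)
    also have "\<dots> = exp (- (c * K\<^sup>2)) * B'"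
      using ndint by (simp only: integral_mult_right_zero has_bochner_integral_integral_eq)
    finally show ?thesis .
  qed
  have "?Ik \<longlonglongrightarrow> ?e * ?Jk" by (rule clt_mag[OF b(1) kL kE])
  then have "\<exists>no. \<forall>n\<ge>no. norm (?Ik n - ?e * ?Jk) < r / 2"
    using r by (intro LIMSEQ_D) auto
  then obtain no where no: "\<And>n. no \<le> n \<Longrightarrow> \<bar>?Ik n - ?e * ?Jk\<bar> < r / 2" by auto
  show "\<exists>no. \<forall>n\<ge>no. norm (?I n - ?e * ?J) < r"
  proof (intro exI allI impI)
    fix n assume "no \<le> n"
    have "\<bar>?e * ?J - ?e * ?Jk\<bar> \<le> ?e * (exp (- (c * K\<^sup>2)) * B')"
      using J by (simp add: right_diff_distrib[symmetric] abs_mult)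
    moreover have "exp (- (c * K\<^sup>2)) * B + ?e * (exp (- (c * K\<^sup>2)) * B') < r / 2"
      using K(2) by (simp add: algebra_simps)
    ultimately have "\<bar>?I n - ?e * ?J\<bar> < r" using In[of n] no[OF \<open>no \<le> n\<close>] by linarith
    then show "norm (?I n - ?e * ?J) < r" by simp
  qed
qed

text \<open>The limit of the diagonal weight and the Gaussian normalisation \<open>?q\<close> occur
  in numerator and denominator alike and cancel. The denominator is the case \<open>h = 1\<close>,
  with Lipschitz constant 0.\<close>

lemma weighted_clt_ratio:
  fixes h :: "real \<Rightarrow> real"
  assumes b: "0 \<le> \<beta>" "\<beta> < beta_c p"
    and h: "\<And>y z. \<bar>h y - h z\<bar> \<le> L * \<bar>y - z\<bar>" "\<And>y. 0 \<le> h y" "\<And>y. h y \<le> 1"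
  shows "(\<lambda>n. (\<integral>x. h (sqrt (real n) * mag n x) * wt n \<beta> x \<partial>P n) / (\<integral>x. wt n \<beta> x \<partial>P n))
    \<longlonglongrightarrow> (\<integral>y. h y * normal_density 0 (sqrt (1 / (beta_c p - \<beta>))) y \<partial>lborel)"
proof -
  let ?q = "sqrt (beta_c p / (beta_c p - \<beta>))"
  let ?e = "exp (- (\<beta> * (1 / beta_c p) / 2))"
  have eq: "(h y * exp (\<beta> * y\<^sup>2 / 2)) * normal_density 0 (sqrt (1 / beta_c p)) y
      = ?q * (h y * normal_density 0 (sqrt (1 / (beta_c p - \<beta>))) y)" for h :: "real \<Rightarrow> real" and y
    using normal_density_tilt[OF beta_c_pos b(2), of y] by (metis mult.assoc mult.commute)
  have 1: "(\<lambda>n. \<integral>x. h (sqrt (real n) * mag n x) * wt n \<beta> x \<partial>P n)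
      \<longlonglongrightarrow> ?e * (?q * (\<integral>y. h y * normal_density 0 (sqrt (1 / (beta_c p - \<beta>))) y \<partial>lborel))"
    using weighted_clt[OF b h] unfolding eq by (simp only: integral_mult_right_zero)
  have "(\<lambda>n. \<integral>x. 1 * wt n \<beta> x \<partial>P n)
      \<longlonglongrightarrow> ?e * (?q * (\<integral>y. 1 * normal_density 0 (sqrt (1 / (beta_c p - \<beta>))) y \<partial>lborel))"
  proof -
    have "exp (\<beta> * y\<^sup>2 / 2) * normal_density 0 (sqrt (1 / beta_c p)) y
        = ?q * normal_density 0 (sqrt (1 / (beta_c p - \<beta>))) y" for y
      using eq[of "\<lambda>_. 1" y] by simp
    then show ?thesis using weighted_clt[OF b, of "\<lambda>_. 1" 0] by simp
  qed
  then have 2: "(\<lambda>n. \<integral>x. wt n \<beta> x \<partial>P n) \<longlonglongrightarrow> ?e * ?q"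
    using b by simp
  have q: "?q \<noteq> 0" using b beta_c_pos by simp
  show ?thesis using tendsto_divide[OF 1 2] q by simp
qed

end

lemma sum_pairs:
  fixes a :: "nat \<Rightarrow> real"
  shows "(\<Sum>j<n. \<Sum>i<j. a i * a j) = ((\<Sum>i<n. a i)\<^sup>2 - (\<Sum>i<n. (a i)\<^sup>2)) / 2"
proof (induction n)
  case (Suc n)
  have "(\<Sum>i<n. a i * a n) = (\<Sum>i<n. a i) * a n" by (simp add: sum_distrib_right)
  with Suc show ?case by (simp add: power2_sum field_simps)
qed simp

context lp_density
begin

subsection \<open>The Gibbs measure\<close>

definition sph :: "nat \<Rightarrow> (nat \<Rightarrow> real) \<Rightarrow> nat \<Rightarrow> real" where
  "sph n x = (\<lambda>i\<in>{..<n}. x i / norm_np n p x)"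

lemma sph_measurable [measurable]: "sph n \<in> measurable (P n) (PiM {..<n} (\<lambda>_. lborel))"
proof -
  have "(\<lambda>x. x i / norm_np n p x) \<in> measurable (P n) lborel" if "i \<in> {..<n}" for i
  proof -
    have [measurable]: "(\<lambda>x. x i) \<in> borel_measurable (P n)"
      using that unfolding P_def by measurable
    show ?thesis by measurable
  qed
  then show ?thesis unfolding sph_def[abs_def] by (rule measurable_restrict)
qed

lemma unif_sphere_eq: "unif_sphere n p = distr (P n) (PiM {..<n} (\<lambda>_. lborel)) (sph n)"
  unfolding unif_sphere_def P_def sph_def[abs_def] ..

lemma hamiltonian_sph: "exp (\<beta> * hamiltonian n (sph n x)) = wt n \<beta> x"
proof -
  have s: "(\<Sum>i<n. sph n x i) = real n * mag n x" "(\<Sum>i<n. (sph n x i)\<^sup>2) = real n * ms n x"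
    by (cases "n = 0"; simp add: sph_def mag_def ms_def)+
  have "\<beta> * hamiltonian n (sph n x) = real n * \<beta> * (mag n x)\<^sup>2 / 2 + - (\<beta> * ms n x / 2)"
    unfolding hamiltonian_def sum_pairs s
    by (cases "n = 0") (simp_all add: power_mult_distrib power2_eq_square[of "real n"] field_simps ms_def)
  then show ?thesis unfolding wt_def by (simp only: exp_add)
qed

lemma component_measurable: "i < n \<Longrightarrow> (\<lambda>\<sigma>. \<sigma> i) \<in> borel_measurable (PiM {..<n} (\<lambda>_. lborel))"
  using measurable_component_singleton[of i "{..<n}" "\<lambda>_. lborel :: real measure"] by simp

lemma hamiltonian_measurable [measurable]: "hamiltonian n \<in> borel_measurable (PiM {..<n} (\<lambda>_. lborel))"
  unfolding hamiltonian_def[abs_def]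
  by (intro borel_measurable_times borel_measurable_const borel_measurable_sum component_measurable) auto

lemma sum_component_measurable [measurable]: "(\<lambda>\<sigma>. \<Sum>i<n. \<sigma> i) \<in> borel_measurable (PiM {..<n} (\<lambda>_. lborel))"
  by (intro borel_measurable_sum component_measurable) auto

lemma partition_fn_eq: "partition_fn n p \<beta> = (\<integral>x. wt n \<beta> x \<partial>P n)"
  unfolding partition_fn_def unif_sphere_eq by (subst integral_distr) (auto simp: hamiltonian_sph)

lemma partition_le: "0 \<le> \<beta> \<Longrightarrow> partition_fn n p \<beta> \<le> A n \<beta>"
  unfolding partition_fn_eq A_def
  using integrable_wt[of \<beta> "\<lambda>_. 1" n 1] by (intro integral_mono integrable_weight wt_le) auto

lemma partition_ge: "0 \<le> \<beta> \<Longrightarrow> exp (- \<beta> / 2) * A n \<beta> \<le> partition_fn n p \<beta>"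
  unfolding partition_fn_eq A_def
  using integrable_wt[of \<beta> "\<lambda>_. 1" n 1]
  by (subst integral_mult_right_zero[symmetric]) (intro integral_mono integrable_mult_right integrable_weight wt_ge, auto)

lemma partition_pos: "0 \<le> \<beta> \<Longrightarrow> 0 < partition_fn n p \<beta>"
  using partition_ge[of \<beta> n] A_ge_1[of \<beta> n] by (smt (verit) exp_gt_zero mult_pos_pos)

lemma gibbs_integral:
  fixes f :: "(nat \<Rightarrow> real) \<Rightarrow> real"
  assumes b: "0 \<le> \<beta>" and f [measurable]: "f \<in> borel_measurable (PiM {..<n} (\<lambda>_. lborel))"
  shows "(\<integral>\<sigma>. f \<sigma> \<partial>gibbs n p \<beta>) = (\<integral>x. f (sph n x) * wt n \<beta> x \<partial>P n) / partition_fn n p \<beta>"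
proof -
  have "(\<integral>\<sigma>. f \<sigma> \<partial>gibbs n p \<beta>) = (\<integral>\<sigma>. exp (\<beta> * hamiltonian n \<sigma>) / partition_fn n p \<beta> * f \<sigma> \<partial>unif_sphere n p)"
    unfolding gibbs_def using partition_pos[OF b, of n]
    by (subst integral_density) (auto simp: unif_sphere_eq)
  also have "\<dots> = (\<integral>x. wt n \<beta> x / partition_fn n p \<beta> * f (sph n x) \<partial>P n)"
    unfolding unif_sphere_eq by (subst integral_distr) (auto simp: hamiltonian_sph)
  also have "\<dots> = (\<integral>x. f (sph n x) * wt n \<beta> x / partition_fn n p \<beta> \<partial>P n)"
    by (simp add: mult.commute)
  finally show ?thesis by simp
qed

lemma sets_gibbs [measurable_cong]: "sets (gibbs n p \<beta>) = sets (PiM {..<n} (\<lambda>_. lborel))"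
  by (simp add: gibbs_def unif_sphere_eq)

lemma prob_space_gibbs:
  assumes b: "0 \<le> \<beta>"
  shows "prob_space (gibbs n p \<beta>)"
proof
  have Z: "0 < partition_fn n p \<beta>" by (rule partition_pos[OF b])
  have "emeasure (gibbs n p \<beta>) (space (gibbs n p \<beta>)) = (\<integral>\<^sup>+\<sigma>. 1 \<partial>gibbs n p \<beta>)" by simp
  also have "\<dots> = (\<integral>\<^sup>+x. ennreal (wt n \<beta> x / partition_fn n p \<beta>) \<partial>P n)"
    unfolding gibbs_def unif_sphere_eq
    by (subst nn_integral_density, simp, simp, subst nn_integral_distr) (auto simp: hamiltonian_sph)
  also have "\<dots> = ennreal (\<integral>x. wt n \<beta> x / partition_fn n p \<beta> \<partial>P n)"
    using integrable_wt[OF b, of "\<lambda>_. 1" n 1] Z wt_pos[of n \<beta>]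
    by (intro nn_integral_eq_integral) (auto intro!: AE_I2 less_imp_le divide_pos_pos)
  also have "\<dots> = 1" using Z by (simp add: partition_fn_eq)
  finally show "emeasure (gibbs n p \<beta>) (space (gibbs n p \<beta>)) = 1" .
qed

lemma mean_sph: "(\<Sum>i<n. sph n x i) / real n = mag n x" "(\<Sum>i<n. sph n x i) / sqrt (real n) = sqrt (real n) * mag n x"
proof -
  show 1: "(\<Sum>i<n. sph n x i) / real n = mag n x" by (simp add: sph_def mag_def)
  have "s / sqrt (real n) = sqrt (real n) * (s / real n)" for s
    by (cases "n = 0") (simp_all add: field_simps)
  then show "(\<Sum>i<n. sph n x i) / sqrt (real n) = sqrt (real n) * mag n x" by (simp only: 1)
qed

lemma magnetization_law_integral:
  fixes g :: "real \<Rightarrow> real"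
  assumes b: "0 \<le> \<beta>" and g [measurable]: "g \<in> borel_measurable borel"
  shows "(\<integral>y. g y \<partial>magnetization_law n p \<beta>) = (\<integral>x. g (mag n x) * wt n \<beta> x \<partial>P n) / partition_fn n p \<beta>"
  unfolding magnetization_law_def
  by (subst integral_distr) (auto simp: gibbs_integral[OF b] mean_sph)

lemma scaled_magnetization_law_integral:
  fixes g :: "real \<Rightarrow> real"
  assumes b: "0 \<le> \<beta>" and g [measurable]: "g \<in> borel_measurable borel"
  shows "(\<integral>y. g y \<partial>scaled_magnetization_law n p \<beta>)
    = (\<integral>x. g (sqrt (real n) * mag n x) * wt n \<beta> x \<partial>P n) / partition_fn n p \<beta>"
  unfolding scaled_magnetization_law_def
  by (subst integral_distr) (auto simp: gibbs_integral[OF b] mean_sph)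

text \<open>Transfers estimates for the simplified weight to Gibbs probabilities: the diagonal is
  dropped in the numerator, and in the denominator it costs at most
  \<open>exp (\<beta> / 2)\<close>.\<close>

lemma magnetization_law_le:
  assumes b: "0 \<le> \<beta>" and S: "S \<in> sets borel" and t: "0 \<le> t"
    and bound: "(\<integral>\<^sup>+x. ennreal (exp (real n * \<beta> * (mag n x)\<^sup>2 / 2)) * indicator {x. mag n x \<in> S} x \<partial>P n) \<le> ennreal t"
  shows "measure (magnetization_law n p \<beta>) S \<le> exp (\<beta> / 2) * t / A n \<beta>"
proof -
  note [measurable] = S
  let ?w = "\<lambda>x. exp (real n * \<beta> * (mag n x)\<^sup>2 / 2)"
  have sp: "space (magnetization_law n p \<beta>) = UNIV" by (simp add: magnetization_law_def)
  have "measure (magnetization_law n p \<beta>) S = (\<integral>y. indicat_real S y \<partial>magnetization_law n p \<beta>)"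
    by (simp add: sp)
  also have "\<dots> = (\<integral>x. indicat_real S (mag n x) * wt n \<beta> x \<partial>P n) / partition_fn n p \<beta>"
    by (rule magnetization_law_integral[OF b]) measurable
  also have "\<dots> \<le> t / (exp (- \<beta> / 2) * A n \<beta>)"
  proof (rule frac_le)
    have i: "integrable (P n) (\<lambda>x. indicat_real S (mag n x) * wt n \<beta> x)"
    proof (rule integrable_wt[OF b])
      show "\<bar>indicat_real S (mag n x)\<bar> \<le> 1" for x by (simp add: indicator_def)
    qed measurable
    have "ennreal (\<integral>x. indicat_real S (mag n x) * wt n \<beta> x \<partial>P n) = (\<integral>\<^sup>+x. ennreal (indicat_real S (mag n x) * wt n \<beta> x) \<partial>P n)"
      by (intro nn_integral_eq_integral[symmetric] i AE_I2 mult_nonneg_nonneg less_imp_le[OF wt_pos]) simp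
    also have "\<dots> \<le> (\<integral>\<^sup>+x. ennreal (?w x) * indicator {x. mag n x \<in> S} x \<partial>P n)"
      using wt_le[OF b] by (intro nn_integral_mono) (auto simp: indicator_def intro!: ennreal_leI)
    also note bound
    finally show "(\<integral>x. indicat_real S (mag n x) * wt n \<beta> x \<partial>P n) \<le> t"
      using t by (subst (asm) ennreal_le_iff) auto
    show "exp (- \<beta> / 2) * A n \<beta> \<le> partition_fn n p \<beta>" by (rule partition_ge[OF b])
    show "0 < exp (- \<beta> / 2) * A n \<beta>" using A_ge_1[OF b, of n] by simp
  qed (use t in auto)
  also have "\<dots> = exp (\<beta> / 2) * t / A n \<beta>" by (simp add: exp_minus field_simps)
  finally show ?thesis .
qed

lemma free_energy:
  assumes b: "0 \<le> \<beta>"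
  shows "(\<lambda>n. ln (partition_fn n p \<beta>) / real n) \<longlonglongrightarrow> var_formula1 p \<beta>"
proof -
  have "(\<lambda>n. ln (A n \<beta>) / real n - ln (partition_fn n p \<beta>) / real n) \<longlonglongrightarrow> 0"
  proof (rule Lim_null_comparison[where g = "\<lambda>n. (\<beta> / 2) / real n"])
    show "\<forall>\<^sub>F n in sequentially. norm (ln (A n \<beta>) / real n - ln (partition_fn n p \<beta>) / real n) \<le> (\<beta> / 2) / real n"
    proof (rule always_eventually, rule allI)
      fix n
      have "ln (partition_fn n p \<beta>) \<le> ln (A n \<beta>)"
        using partition_le[OF b, of n] partition_pos[OF b, of n] by (intro ln_mono) auto
      moreover have "ln (exp (- \<beta> / 2) * A n \<beta>) \<le> ln (partition_fn n p \<beta>)"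
        using partition_ge[OF b, of n] A_ge_1[OF b, of n] by (intro ln_mono) auto
      moreover have "ln (exp (- \<beta> / 2) * A n \<beta>) = - \<beta> / 2 + ln (A n \<beta>)"
        using A_ge_1[OF b, of n] by (simp add: ln_mult)
      ultimately have "\<bar>ln (A n \<beta>) - ln (partition_fn n p \<beta>)\<bar> \<le> \<beta> / 2" by linarith
      then show "norm (ln (A n \<beta>) / real n - ln (partition_fn n p \<beta>) / real n) \<le> (\<beta> / 2) / real n"
        using divide_right_mono[of "\<bar>ln (A n \<beta>) - ln (partition_fn n p \<beta>)\<bar>" "\<beta> / 2" "real n"]
        by (simp only: real_norm_def diff_divide_distrib[symmetric] abs_divide abs_of_nat of_nat_0_le_iff)
    qed
    show "(\<lambda>n. (\<beta> / 2) / real n) \<longlonglongrightarrow> 0" by (rule lim_const_over_n)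
  qed
  from tendsto_diff[OF limit_var_formula1(1)[OF b] this] show ?thesis by simp
qed

subsection \<open>The subcritical phase\<close>

lemma subcritical_limit:
  assumes b: "0 \<le> \<beta>" "\<beta> < beta_c p"
  shows "(\<lambda>n. ln (partition_fn n p \<beta>) / real n) \<longlonglongrightarrow> 0"
proof -
  obtain B where B: "\<And>n. A n \<beta> \<le> B" using A_bounded[OF b] by auto
  have "(\<lambda>n. ln (A n \<beta>) / real n) \<longlonglongrightarrow> 0"
  proof (rule Lim_null_comparison[OF always_eventually lim_const_over_n[of "ln B"]], rule allI)
    fix n
    have "0 \<le> ln (A n \<beta>)" "ln (A n \<beta>) \<le> ln B"
      using A_ge_1[OF b(1), of n] B[of n] by (auto intro!: ln_mono)
    then show "norm (ln (A n \<beta>) / real n) \<le> ln B / real n"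
      by (simp add: abs_divide divide_right_mono)
  qed
  then have "var_formula1 p \<beta> = 0"
    using limit_var_formula1(1)[OF b(1)] LIMSEQ_unique by blast
  then show ?thesis using free_energy[OF b(1)] by simp
qed

lemma subcritical_bounded:
  assumes b: "0 \<le> \<beta>" "\<beta> < beta_c p"
  shows "bdd_above (range (\<lambda>n. partition_fn n p \<beta>))"
proof -
  obtain B where "\<And>n. A n \<beta> \<le> B" using A_bounded[OF b] by auto
  then show ?thesis
    by (intro bdd_aboveI[of _ B]) (auto intro: order_trans[OF partition_le[OF b(1)]])
qed

text \<open>A gap in temperature acts as an exponential Chebyshev inequality: where
  \<open>\<bar>mag\<bar> \<ge> \<epsilon>\<close>, the weight at \<open>\<beta>\<close> is at most
  \<open>exp (- c * n)\<close> times the weight at \<open>\<gamma>\<close>, whose integral is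
  bounded.\<close>

lemma subcritical_concentration:
  assumes b: "0 \<le> \<beta>" "\<beta> < beta_c p" and e: "0 < \<epsilon>"
  shows "(\<lambda>n. measure (magnetization_law n p \<beta>) {x. \<bar>x\<bar> \<ge> \<epsilon>}) \<longlonglongrightarrow> 0"
proof -
  define \<gamma> where "\<gamma> = (\<beta> + beta_c p) / 2"
  have g: "\<beta> < \<gamma>" "\<gamma> < beta_c p" "0 \<le> \<gamma>" using b by (auto simp: \<gamma>_def)
  obtain B where B: "\<And>n. A n \<gamma> \<le> B" using A_bounded[OF g(3,2)] by auto
  have Bpos: "0 < B" using A_ge_1[OF g(3), of 0] B[of 0] by linarith
  define c where "c = (\<gamma> - \<beta>) * \<epsilon>\<^sup>2 / 2"
  have c: "0 < c" using g e by (simp add: c_def)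
  have lim: "(\<lambda>n. exp (\<beta> / 2) * (exp (- (c * real n)) * B)) \<longlonglongrightarrow> exp (\<beta> / 2) * (0 * B)"
    using c by (intro tendsto_mult tendsto_const filterlim_compose[OF exp_at_bot] filterlim_compose[OF filterlim_uminus_at_bot_at_top]
          filterlim_tendsto_pos_mult_at_top[OF tendsto_const _ filterlim_real_sequentially])
  have le: "measure (magnetization_law n p \<beta>) {x. \<bar>x\<bar> \<ge> \<epsilon>} \<le> exp (\<beta> / 2) * (exp (- (c * real n)) * B)" for n
  proof -
    have "(\<integral>\<^sup>+x. ennreal (exp (real n * \<beta> * (mag n x)\<^sup>2 / 2)) * indicator {x. mag n x \<in> {x. \<bar>x\<bar> \<ge> \<epsilon>}} x \<partial>P n)
        \<le> (\<integral>\<^sup>+x. ennreal (exp (- (c * real n))) * ennreal (exp (real n * \<gamma> * (mag n x)\<^sup>2 / 2)) \<partial>P n)"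
    proof (rule nn_integral_mono)
      fix x
      have "exp (real n * \<beta> * (mag n x)\<^sup>2 / 2) \<le> exp (- (c * real n)) * exp (real n * \<gamma> * (mag n x)\<^sup>2 / 2)"
        if "\<epsilon> \<le> \<bar>mag n x\<bar>"
      proof -
        have "\<epsilon>\<^sup>2 \<le> (mag n x)\<^sup>2" using that e by (metis abs_le_square_iff abs_of_pos)
        then have "real n * ((\<gamma> - \<beta>) / 2) * \<epsilon>\<^sup>2 \<le> real n * ((\<gamma> - \<beta>) / 2) * (mag n x)\<^sup>2"
          using g by (intro mult_left_mono) auto
        then have "real n * \<beta> * (mag n x)\<^sup>2 / 2 \<le> - (c * real n) + real n * \<gamma> * (mag n x)\<^sup>2 / 2"
          by (simp add: c_def algebra_simps diff_divide_distrib)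
        then show ?thesis by (simp add: exp_add[symmetric])
      qed
      then show "ennreal (exp (real n * \<beta> * (mag n x)\<^sup>2 / 2)) * indicator {x. mag n x \<in> {x. \<bar>x\<bar> \<ge> \<epsilon>}} x
        \<le> ennreal (exp (- (c * real n))) * ennreal (exp (real n * \<gamma> * (mag n x)\<^sup>2 / 2))"
        by (auto simp: indicator_def ennreal_mult[symmetric] intro!: ennreal_leI)
    qed
    also have "\<dots> = ennreal (exp (- (c * real n))) * ennreal (A n \<gamma>)"
      by (subst nn_integral_cmult, measurable) (simp only: nn_A[OF g(3)])
    also have "\<dots> \<le> ennreal (exp (- (c * real n)) * B)"
      using Bpos by (subst ennreal_mult) (auto intro!: mult_left_mono ennreal_leI B)
    finally have "measure (magnetization_law n p \<beta>) {x. \<bar>x\<bar> \<ge> \<epsilon>} \<le> exp (\<beta> / 2) * (exp (- (c * real n)) * B) / A n \<beta>"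
      using Bpos by (intro magnetization_law_le[OF b(1)]) auto
    also have "\<dots> \<le> exp (\<beta> / 2) * (exp (- (c * real n)) * B) / 1"
      using A_ge_1[OF b(1), of n] Bpos by (intro divide_left_mono) auto
    finally show ?thesis by simp
  qed
  show ?thesis
  proof (rule tendsto_sandwich[OF _ _ tendsto_const[of 0]])
    show "\<forall>\<^sub>F n in sequentially. measure (magnetization_law n p \<beta>) {x. \<bar>x\<bar> \<ge> \<epsilon>} \<le> exp (\<beta> / 2) * (exp (- (c * real n)) * B)"
      by (intro always_eventually allI le)
  qed (use lim in auto)
qed

lemma subcritical_clt:
  assumes b: "0 \<le> \<beta>" "\<beta> < beta_c p"
  shows "weak_conv_m (\<lambda>n. scaled_magnetization_law n p \<beta>)
    (density lborel (\<lambda>x. ennreal (normal_density 0 (sqrt (1 / (beta_c p - \<beta>))) x)))"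
proof (rule integral_cts_step_conv_imp_weak_conv)
  fix n
  interpret gibbs: prob_space "gibbs n p \<beta>" by (rule prob_space_gibbs[OF b(1)])
  show "real_distribution (scaled_magnetization_law n p \<beta>)"
    unfolding scaled_magnetization_law_def by (rule gibbs.real_distribution_distr) measurable
next
  show "real_distribution (density lborel (\<lambda>x. ennreal (normal_density 0 (sqrt (1 / (beta_c p - \<beta>))) x)))"
    using prob_space_normal_density[of "sqrt (1 / (beta_c p - \<beta>))" 0] b
    by (simp add: real_distribution_def real_distribution_axioms_def)
next
  fix u v :: real assume uv: "u < v"
  have [measurable]: "cts_step u v \<in> borel_measurable borel"
    unfolding cts_step_def[abs_def] by measurable
  have "(\<lambda>n. (\<integral>x. cts_step u v (sqrt (real n) * mag n x) * wt n \<beta> x \<partial>P n) / (\<integral>x. wt n \<beta> x \<partial>P n))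
    \<longlonglongrightarrow> (\<integral>y. cts_step u v y * normal_density 0 (sqrt (1 / (beta_c p - \<beta>))) y \<partial>lborel)"
    using uv by (intro weighted_clt_ratio[OF b cts_step_lipschitz]) (auto simp: cts_step_def)
  then show "(\<lambda>n. integral\<^sup>L (scaled_magnetization_law n p \<beta>) (cts_step u v))
    \<longlonglongrightarrow> integral\<^sup>L (density lborel (\<lambda>x. ennreal (normal_density 0 (sqrt (1 / (beta_c p - \<beta>))) x))) (cts_step u v)"
    by (simp add: scaled_magnetization_law_integral[OF b(1)] partition_fn_eq integral_density mult.commute)
qed

subsection \<open>The supercritical phase\<close>

lemma supercritical_pos:
  assumes b: "beta_c p < \<beta>"
  shows "0 < var_formula1 p \<beta>"
proof -
  obtain x where "x \<in> {0..1}" "0 < G \<beta> x" using G_pos[OF b] by auto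
  then show ?thesis
    using limit_var_formula1(2)[of \<beta> x] b beta_c_pos by force
qed

lemma supercritical_concentration:
  assumes b: "beta_c p < \<beta>"
  shows "\<exists>K. closed K \<and> K \<subseteq> {0<..1} \<and>
    (\<forall>U. open U \<and> K \<union> uminus ` K \<subseteq> U \<longrightarrow> (\<lambda>n. measure (magnetization_law n p \<beta>) (- U)) \<longlonglongrightarrow> 0)"
proof -
  have b0: "0 \<le> \<beta>" using b beta_c_pos by linarith
  define F where "F = var_formula1 p \<beta>"
  have F: "0 < F" unfolding F_def by (rule supercritical_pos[OF b])
  have GF: "G \<beta> x \<le> F" if "x \<in> {0..1}" for x
    unfolding F_def by (rule limit_var_formula1(2)[OF b0 that])
  \<comment> \<open>The points where \<open>G\<close> reaches the limiting free energy, which bounds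
    \<open>G\<close> on \<open>[0, 1]\<close>. Zero is excluded because
    \<open>G \<beta> 0 = 0 < F\<close>.\<close>
  define K where "K = {0..1} \<inter> G \<beta> -` {F}"
  have "closed K"
    unfolding K_def using continuous_G[OF b0]
    by (intro closed_Int closed_vimage) auto
  moreover have "K \<subseteq> {0<..1}"
  proof
    fix x assume "x \<in> K"
    then have "x \<in> {0..1}" "x \<noteq> 0" using F G_0[of \<beta>] by (auto simp: K_def)
    then show "x \<in> {0<..1}" by auto
  qed
  moreover have "(\<lambda>n. measure (magnetization_law n p \<beta>) (- U)) \<longlonglongrightarrow> 0"
    if U: "open U" "K \<union> uminus ` K \<subseteq> U" for U
  proof -
    \<comment> \<open>The absolute values of magnetizations outside \<open>U\<close>:
      \<open>x\<close> or \<open>- x\<close> is not in \<open>U\<close>. This set is compact and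
      misses \<open>K\<close>, so \<open>G\<close> stays below \<open>F\<close> by a fixed gap on
      it.\<close>
    define C where "C = {0..1} \<inter> (- U \<union> uminus -` (- U))"
    have "closed (- U \<union> uminus -` (- U))"
      using U(1) by (intro closed_Un closed_vimage continuous_intros) auto
    then have C: "compact C" "C \<subseteq> {0..1}" by (auto simp: C_def intro: compact_Int_closed)
    have less: "G \<beta> x < F" if "x \<in> C" for x
    proof (rule ccontr)
      assume "\<not> G \<beta> x < F"
      then have "x \<in> K" using GF[of x] that by (auto simp: C_def K_def)
      then have "x \<in> U" "- x \<in> U" using U(2) by auto
      then show False using that by (auto simp: C_def)
    qed
    have "\<exists>g<F. \<forall>x\<in>C. G \<beta> x \<le> g"
    proof (cases "C = {}")
      case False
      obtain x where "x \<in> C" "\<forall>y\<in>C. G \<beta> y \<le> G \<beta> x"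
        using continuous_attains_sup[OF C(1) False continuous_on_subset[OF continuous_G[OF b0]]] by auto
      then show ?thesis using less by blast
    qed (auto intro: exI[of _ "F - 1"])
    then obtain g where g: "g < F" "\<And>x. x \<in> C \<Longrightarrow> G \<beta> x \<le> g" by auto
    \<comment> \<open>A quarter of the gap: one share is lost in the numerator and one in the
      denominator, which leaves the decay rate \<open>2 * \<eta>\<close>.\<close>
    define \<eta> where "\<eta> = (F - g) / 4"
    have eta: "0 < \<eta>" using g by (simp add: \<eta>_def)
    have upper: "\<forall>\<^sub>F n in sequentially.
      (\<integral>\<^sup>+x. ennreal (exp (real n * \<beta> * (mag n x)\<^sup>2 / 2)) * indicator {x. \<bar>mag n x\<bar> \<in> C} x \<partial>P n) \<le> ennreal (exp (real n * (g + \<eta>)))"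
      by (rule upper_compact[OF b0 C _ eta]) (rule g(2))
    have "\<forall>\<^sub>F n in sequentially. F - \<eta> < ln (A n \<beta>) / real n"
      using limit_var_formula1(1)[OF b0] eta by (intro order_tendstoD(1)) (auto simp: F_def)
    then have ev: "\<forall>\<^sub>F n in sequentially. measure (magnetization_law n p \<beta>) (- U) \<le> exp (\<beta> / 2) * exp (- (2 * \<eta> * real n))"
      using upper eventually_gt_at_top[of "0::nat"]
    proof eventually_elim
      case (elim n)
      have "(\<integral>\<^sup>+x. ennreal (exp (real n * \<beta> * (mag n x)\<^sup>2 / 2)) * indicator {x. mag n x \<in> - U} x \<partial>P n)
         \<le> (\<integral>\<^sup>+x. ennreal (exp (real n * \<beta> * (mag n x)\<^sup>2 / 2)) * indicator {x. \<bar>mag n x\<bar> \<in> C} x \<partial>P n)"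
      proof (rule nn_integral_mono)
        fix x
        have "\<bar>mag n x\<bar> \<in> C" if "mag n x \<in> - U"
          using that abs_mag_le_1[of n x] by (cases "0 \<le> mag n x") (auto simp: C_def)
        then show "ennreal (exp (real n * \<beta> * (mag n x)\<^sup>2 / 2)) * indicator {x. mag n x \<in> - U} x
            \<le> ennreal (exp (real n * \<beta> * (mag n x)\<^sup>2 / 2)) * indicator {x. \<bar>mag n x\<bar> \<in> C} x"
          by (auto simp: indicator_def)
      qed
      also note elim(2)
      finally have "measure (magnetization_law n p \<beta>) (- U) \<le> exp (\<beta> / 2) * exp (real n * (g + \<eta>)) / A n \<beta>"
        using U(1) by (intro magnetization_law_le[OF b0]) auto
      also have "\<dots> \<le> exp (\<beta> / 2) * exp (real n * (g + \<eta>)) / exp (real n * (F - \<eta>))"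
      proof (rule divide_left_mono)
        have "real n * (F - \<eta>) \<le> ln (A n \<beta>)" using elim(1,3) by (simp add: pos_less_divide_eq mult.commute)
        then show "exp (real n * (F - \<eta>)) \<le> A n \<beta>"
          using A_ge_1[OF b0, of n] by (subst (asm) ln_ge_iff) auto
        show "0 < A n \<beta> * exp (real n * (F - \<eta>))" using A_ge_1[OF b0, of n] by simp
      qed simp
      also have "\<dots> = exp (\<beta> / 2) * exp (real n * (g + \<eta>) - real n * (F - \<eta>))"
        by (simp add: exp_diff)
      also have "real n * (g + \<eta>) - real n * (F - \<eta>) = - (2 * \<eta> * real n)"
        by (simp add: \<eta>_def field_simps)
      finally show ?case .
    qed
    have lim: "(\<lambda>n. exp (\<beta> / 2) * exp (- (2 * \<eta> * real n))) \<longlonglongrightarrow> exp (\<beta> / 2) * 0"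
      using eta by (intro tendsto_mult tendsto_const filterlim_compose[OF exp_at_bot] filterlim_compose[OF filterlim_uminus_at_bot_at_top]
          filterlim_tendsto_pos_mult_at_top[OF tendsto_const _ filterlim_real_sequentially]) auto
    show ?thesis
      by (rule tendsto_sandwich[OF _ ev tendsto_const[of 0]]) (use lim in auto)
  qed
  ultimately show ?thesis by blast
qed

end

theorem theorem1p1:
  fixes p \<beta> :: real
  assumes "p \<ge> 2" and "\<beta> \<ge> 0"
  shows "((\<lambda>n. ln (partition_fn n p \<beta>) / real n) \<longlongrightarrow> var_formula1 p \<beta>) sequentially
       \<and> var_formula1 p \<beta> = var_formula2 p \<beta>
       \<and> (\<beta> < beta_c p \<longrightarrow>
            (\<forall>\<epsilon>>0. (\<lambda>n. measure (magnetization_law n p \<beta>) {x. \<bar>x\<bar> \<ge> \<epsilon>}) \<longlonglongrightarrow> 0)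
          \<and> weak_conv_m (\<lambda>n. scaled_magnetization_law n p \<beta>)
              (density lborel (\<lambda>x. ennreal (normal_density 0 (sqrt (1 / (beta_c p - \<beta>))) x)))
          \<and> bdd_above (range (\<lambda>n. partition_fn n p \<beta>))
          \<and> (\<lambda>n. ln (partition_fn n p \<beta>) / real n) \<longlonglongrightarrow> 0)
       \<and> (\<beta> > beta_c p \<longrightarrow>
            (\<exists>K. closed K \<and> K \<subseteq> {0<..1} \<and>
               (\<forall>U. open U \<and> K \<union> uminus ` K \<subseteq> U \<longrightarrow>
                  (\<lambda>n. measure (magnetization_law n p \<beta>) (- U)) \<longlonglongrightarrow> 0))
          \<and> (\<exists>L. (\<lambda>n. ln (partition_fn n p \<beta>) / real n) \<longlonglongrightarrow> L \<and> L > 0))"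
proof -
  interpret lp_density p by unfold_locales (rule assms(1))
  note b = assms(2)
  show ?thesis
  proof (intro conjI impI allI)
    show "(\<lambda>n. ln (partition_fn n p \<beta>) / real n) \<longlonglongrightarrow> var_formula1 p \<beta>"
      by (rule free_energy[OF b])
    show "var_formula1 p \<beta> = var_formula2 p \<beta>"
      by (rule var_formulas_eq[OF b])
  next
    fix \<epsilon> :: real
    assume "\<beta> < beta_c p" "0 < \<epsilon>"
    with b show "(\<lambda>n. measure (magnetization_law n p \<beta>) {x. \<bar>x\<bar> \<ge> \<epsilon>}) \<longlonglongrightarrow> 0"
      by (rule subcritical_concentration)
  next
    assume "\<beta> < beta_c p"
    with b show "weak_conv_m (\<lambda>n. scaled_magnetization_law n p \<beta>)
        (density lborel (\<lambda>x. ennreal (normal_density 0 (sqrt (1 / (beta_c p - \<beta>))) x)))"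
      by (rule subcritical_clt)
  next
    assume "\<beta> < beta_c p"
    with b show "bdd_above (range (\<lambda>n. partition_fn n p \<beta>))"
      by (rule subcritical_bounded)
  next
    assume "\<beta> < beta_c p"
    with b show "(\<lambda>n. ln (partition_fn n p \<beta>) / real n) \<longlonglongrightarrow> 0"
      by (rule subcritical_limit)
  next
    assume "beta_c p < \<beta>"
    then show "\<exists>K. closed K \<and> K \<subseteq> {0<..1} \<and> (\<forall>U. open U \<and> K \<union> uminus ` K \<subseteq> U \<longrightarrow>
        (\<lambda>n. measure (magnetization_law n p \<beta>) (- U)) \<longlonglongrightarrow> 0)"
      by (rule supercritical_concentration)
  next
    assume "beta_c p < \<beta>"
    then have "0 < var_formula1 p \<beta>" by (rule supercritical_pos)
    with free_energy[OF b]
    show "\<exists>L. (\<lambda>n. ln (partition_fn n p \<beta>) / real n) \<longlonglongrightarrow> L \<and> L > 0"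
      by blast
  qed
qed

end
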